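(* Let $n\geq 1$ and $f\in F(n)$. If $f$ has at least one fixed point, then there exists $h\in F(n)$ with $h\sim f$ such that $\mathcal{A}(h)$ has exactly $\mathrm{fp}(f)$ attractors. If $f$ has no fixed point, then there exists $h\in F(n)$ with $h\sim f$ such that $\mathcal{A}(h)$ has a unique attractor, and this attractor has size at most $4$.
   Context: $F(n)$ is the set of all functions $f:\{0,1\}^n\to\{0,1\}^n$, written $f=(f_1,\dots,f_n)$. $e_i$ is the configuration with a $1$ exactly in component $i$; addition is componentwise modulo $2$. The asynchronous graph $\mathcal{A}(f)$ is the digraph on $\{0,1\}^n$ with an arc from $x$ to $x+e_i$ whenever $f_i(x)\neq x_i$. An attractor of a digraph on $\{0,1\}^n$ is an inclusion-minimal non-empty set $X\subseteq\{0,1\}^n$ such that there is no arc from $X$ to its complement. $\mathcal{S}(f)$ has an arc $x\to f(x)$ for every $x$; $f\sim h$ means $\mathcal{S}(f)$ and $\mathcal{S}(h)$ are isomorphic. A fixed point of $f$ is $x$ with $f(x)=x$; $\mathrm{fp}(f)$ is the number of fixed points. *)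

theory Defs
  imports "HOL-Analysis.Finite_Cartesian_Product" "HOL-Library.Z2"
begin

text \<open>
  The set of configurations \<open>{0,1}\<^sup>n\<close> is the type \<^typ>\<open>bit ^ 'n\<close> with \<open>n = CARD('n) \<ge> 1\<close>.
  Addition on this type is componentwise modulo 2, the component \<open>f\<^sub>i(x)\<close> is \<open>f x $ i\<close>,
  and \<open>e\<^sub>i\<close> is \<open>axis i 1\<close>. A digraph on the configurations is given by its set of arcs.
\<close>

instance bit :: finite
proof
  have "(UNIV :: bit set) = {0, 1}"
    using bit_not_zero_iff by blast
  then show "finite (UNIV :: bit set)"
    by (metis finite.emptyI finite.insertI)
qed

type_synonym 'n config = "bit ^ 'n"

definition async_graph :: "('n::finite config \<Rightarrow> 'n config) \<Rightarrow> ('n config \<times> 'n config) set" where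
  "async_graph f = {(x, x + axis i 1) | x i. f x $ i \<noteq> x $ i}"

definition sync_graph :: "('n::finite config \<Rightarrow> 'n config) \<Rightarrow> ('n config \<times> 'n config) set" where
  "sync_graph f = {(x, f x) | x. True}"

text \<open>Isomorphism of digraphs whose vertex sets are the whole types.\<close>

definition digraph_isomorphic :: "('a \<times> 'a) set \<Rightarrow> ('b \<times> 'b) set \<Rightarrow> bool" where
  "digraph_isomorphic G H \<longleftrightarrow> (\<exists>\<pi>. bij \<pi> \<and> (\<forall>x y. (x, y) \<in> G \<longleftrightarrow> (\<pi> x, \<pi> y) \<in> H))"

definition sync_equiv :: "('n::finite config \<Rightarrow> 'n config) \<Rightarrow> ('n config \<Rightarrow> 'n config) \<Rightarrow> bool"
    (infix "\<sim>\<^sub>S" 50) where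
  "f \<sim>\<^sub>S h \<longleftrightarrow> digraph_isomorphic (sync_graph f) (sync_graph h)"

definition trap_set :: "('a \<times> 'a) set \<Rightarrow> 'a set \<Rightarrow> bool" where
  "trap_set G X \<longleftrightarrow> X \<noteq> {} \<and> \<not> (\<exists>x \<in> X. \<exists>y \<in> - X. (x, y) \<in> G)"

definition attractor :: "('a \<times> 'a) set \<Rightarrow> 'a set \<Rightarrow> bool" where
  "attractor G X \<longleftrightarrow> trap_set G X \<and> \<not> (\<exists>Y. Y \<subset> X \<and> trap_set G Y)"

definition fixed_points :: "('a \<Rightarrow> 'a) \<Rightarrow> 'a set" where
  "fixed_points f = {x. f x = x}"

definition fp :: "('a \<Rightarrow> 'a) \<Rightarrow> nat" where
  "fp f = card (fixed_points f)"

end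

theory Submission
  imports Defs
begin

text \<open>
  Conjugating \<open>f\<close> means choosing a bijection \<open>\<pi>\<close> from the vertices of \<open>f\<close> to the subsets of the
  coordinates. Whenever \<open>\<pi> x\<close> is not contained in \<open>\<pi> (f x)\<close>, the label of \<open>x\<close> has an asynchronous arc
  to a smaller set; if this fails only for a few harmless vertices, every label reaches a fixed
  point or the empty set.

  Labels are handed out by increasing size. A vertex inserted after its image descends, so a
  non-periodic part causes no trouble, and on each cycle only one arc \<open>c \<mapsto> f c\<close> goes up; it suffices
  to reserve for \<open>f c\<close> a label that does not contain the label of \<open>c\<close>. The last label, the full set,
  contains every other one: it is given to a non-periodic vertex without preimages, or to a vertex
  of a cycle of length at least three whose predecessor carries a coatom and then escapes through
  the full set and another coatom.

  Without fixed points a small attractor is planted around the empty set: \<open>{} \<leftrightarrow> {i}\<close> on a 2-cycle;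
  \<open>{i}, {j} \<mapsto> {} \<mapsto> {i, j}\<close> on a periodic vertex with two preimages; and the path
  \<open>{i}, {}, {j}, {j, k}\<close> with \<open>{i} \<mapsto> {} \<mapsto> {i, j}\<close> and \<open>{j, k} \<mapsto> {j} \<mapsto> {k}\<close> in the remaining cases
  (permutations without short cycles, and two exceptions in dimension three). On that path the
  image of \<open>{k}\<close> may carry the full set, because \<open>{k}\<close> then climbs to \<open>{j, k}\<close>. Divisibility of \<open>2\<^sup>n\<close>
  provides the cycles that are long enough.
\<close>

text \<open>The obstacle throughout is the full set. A vertex whose image carries it cannot descend,
  so its carrier must have no preimage, or be fixed without other preimages, or have an exceptional
  preimage whose ascent leads back down. The reverse inclusion must be prevented only where a
  labelled vertex has an unlabelled image. This works unless the planted labels occupy all sets of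
  some size that avoid the critical one, as happens in dimension three with {}, {i}, {j}, {i, j}:
  the only pair that misses k is {i, j}. Hence {k} is planted too when the cycle is long enough, and
  a triangle next to a second cycle needs the path in dimension three. The bound 4 is the size of
  that path, and of the whole cube in dimension two.\<close>

text \<open>The asynchronous graph of \<open>\<pi> \<circ> f \<circ> \<pi>\<^sup>-\<^sup>1\<close> for a bijection \<open>\<pi>\<close>, on supports of configurations.\<close>

definition label_graph :: "('v \<Rightarrow> 'v) \<Rightarrow> ('v \<Rightarrow> 'n set) \<Rightarrow> ('n set \<times> 'n set) set" where
  "label_graph f \<pi> =
     {(\<pi> x, \<pi> x - {i}) | x i. i \<in> \<pi> x \<and> i \<notin> \<pi> (f x)} \<union>
     {(\<pi> x, insert i (\<pi> x)) | x i. i \<notin> \<pi> x \<and> i \<in> \<pi> (f x)}"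

section \<open>Supports and conjugation by a labelling\<close>

definition ones :: "bit ^ 'n \<Rightarrow> 'n set" where
  "ones x = {i. x $ i = 1}"

lemma ones_eq_iff: "ones x = ones y \<longleftrightarrow> x = y" for x y :: "bit ^ 'n::finite"
proof -
  have bit_eq: "a = b \<longleftrightarrow> (a = 1 \<longleftrightarrow> b = 1)" for a b :: bit
    by (cases a; cases b) simp_all
  show ?thesis
    unfolding vec_eq_iff ones_def set_eq_iff mem_Collect_eq by (subst bit_eq) (rule refl)
qed

lemma surj_ones: "surj (ones :: bit ^ 'n::finite \<Rightarrow> 'n set)"
proof (rule surjI)
  fix A :: "'n set"
  show "ones (\<chi> i. if i \<in> A then 1 else 0) = A" by (auto simp: ones_def)
qed

lemma bij_ones: "bij (ones :: bit ^ 'n::finite \<Rightarrow> 'n set)"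
  by (rule bijI) (auto simp: inj_def ones_eq_iff surj_ones)

lemma card_config: "CARD('n::finite config) = 2 ^ CARD('n)"
proof -
  have "CARD('n config) = CARD('n set)"
    using bij_betw_same_card[OF bij_ones] .
  also have "\<dots> = 2 ^ CARD('n)" by (simp add: card_Pow flip: Pow_UNIV)
  finally show ?thesis .
qed

lemma ones_add_axis:
  "ones (x + axis i 1) = (if i \<in> ones x then ones x - {i} else insert i (ones x))"
  for x :: "bit ^ 'n::finite"
proof -
  have "x $ i = 0 \<or> x $ i = 1" by (metis bit_not_one_iff)
  then show ?thesis by (auto simp: ones_def axis_def)
qed

text \<open>Arcs are read off as toggles of one coordinate. Injectivity identifies the vertex behind
  a label, so the image that governs an arc is unambiguous.\<close>

lemma label_graph_iff:
  assumes "inj \<pi>"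
  shows "(\<pi> x, B) \<in> label_graph f \<pi> \<longleftrightarrow>
    (\<exists>i. (i \<in> \<pi> (f x)) \<noteq> (i \<in> \<pi> x) \<and> B = (if i \<in> \<pi> x then \<pi> x - {i} else insert i (\<pi> x)))"
    (is "?L \<longleftrightarrow> ?R")
proof
  assume ?L
  then consider y i where "\<pi> x = \<pi> y" "B = \<pi> y - {i}" "i \<in> \<pi> y" "i \<notin> \<pi> (f y)"
    | y i where "\<pi> x = \<pi> y" "B = insert i (\<pi> y)" "i \<notin> \<pi> y" "i \<in> \<pi> (f y)"
    unfolding label_graph_def by blast
  then show ?R by cases (use injD[OF assms] in metis)+
next
  assume ?R
  then obtain i where "(i \<in> \<pi> (f x)) \<noteq> (i \<in> \<pi> x)"
    "B = (if i \<in> \<pi> x then \<pi> x - {i} else insert i (\<pi> x))" by blast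
  then show ?L unfolding label_graph_def by (cases "i \<in> \<pi> x") auto
qed

text \<open>\<open>\<rho>\<close> sends a configuration to the vertex labelled by its support, and
  \<open>h\<close> is \<open>f\<close> conjugated by it. So \<open>\<rho>\<close> itself is the
  isomorphism, and the support of \<open>h x\<close> is the label of \<open>f (\<rho> x)\<close>.
  The third clause lets fixed points be counted on the side of \<open>f\<close>.\<close>

lemma relabel:
  fixes f :: "'n::finite config \<Rightarrow> 'n config" and \<pi> :: "'n config \<Rightarrow> 'n set"
  assumes "bij \<pi>"
  shows "\<exists>h. h \<sim>\<^sub>S f
    \<and> (\<forall>x y. (x, y) \<in> async_graph h \<longleftrightarrow> (ones x, ones y) \<in> label_graph f \<pi>)
    \<and> (\<forall>v x. ones x = \<pi> v \<longrightarrow> (h x = x \<longleftrightarrow> f v = v))"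
proof -
  define \<rho> where "\<rho> = inv \<pi> \<circ> ones"
  have bij_\<rho>: "bij \<rho>"
    unfolding \<rho>_def by (intro bij_comp bij_ones bij_imp_bij_inv assms)
  define h where "h = inv \<rho> \<circ> f \<circ> \<rho>"
  have \<pi>\<rho>: "\<pi> (\<rho> x) = ones x" for x
    using assms by (simp add: \<rho>_def bij_is_surj surj_f_inv_f)
  have \<rho>h: "\<rho> (h x) = f (\<rho> x)" for x
    using bij_\<rho> by (simp add: h_def bij_is_surj surj_f_inv_f)
  have ones_h: "ones (h x) = \<pi> (f (\<rho> x))" for x
    using \<pi>\<rho>[of "h x"] by (simp add: \<rho>h)
  have inj_\<pi>: "\<pi> v = \<pi> w \<longleftrightarrow> v = w" for v w
    using assms by (simp add: bij_is_inj inj_eq)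
  have "h \<sim>\<^sub>S f"
    unfolding sync_equiv_def digraph_isomorphic_def sync_graph_def
  proof (intro exI[of _ \<rho>] conjI allI)
    fix x y
    show "(x, y) \<in> {(x, h x) |x. True} \<longleftrightarrow> (\<rho> x, \<rho> y) \<in> {(x, f x) |x. True}"
      using \<rho>h[of x] injD[OF bij_is_inj[OF bij_\<rho>], of y "h x"] by auto
  qed (fact bij_\<rho>)
  moreover have "(x, y) \<in> async_graph h \<longleftrightarrow> (ones x, ones y) \<in> label_graph f \<pi>" for x y
  proof -
    have "(x, y) \<in> async_graph h \<longleftrightarrow> (\<exists>i. h x $ i \<noteq> x $ i \<and> y = x + axis i 1)"
      by (auto simp: async_graph_def)
    also have "\<dots> \<longleftrightarrow> (\<exists>i. (i \<in> ones (h x)) \<noteq> (i \<in> ones x) \<and> ones y = ones (x + axis i 1))"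
    proof -
      have "h x $ i \<noteq> x $ i \<longleftrightarrow> (i \<in> ones (h x)) \<noteq> (i \<in> ones x)" for i
        unfolding ones_def mem_Collect_eq by (metis bit_not_one_iff)
      then show ?thesis by (simp add: ones_eq_iff)
    qed
    also have "\<dots> \<longleftrightarrow> (\<pi> (\<rho> x), ones y) \<in> label_graph f \<pi>"
      unfolding label_graph_iff[OF bij_is_inj[OF assms]] by (simp only: ones_add_axis ones_h \<pi>\<rho>)
    finally show ?thesis by (simp add: \<pi>\<rho>)
  qed
  moreover have "h x = x \<longleftrightarrow> f v = v" if "ones x = \<pi> v" for v x
  proof -
    have "\<rho> x = v" using that \<pi>\<rho>[of x] inj_\<pi>[of "\<rho> x" v] by simp
    then show ?thesis using ones_h[of x] that ones_eq_iff[of "h x" x] inj_\<pi>[of "f v" v] by simp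
  qed
  ultimately show ?thesis by blast
qed

section \<open>Attractors and reachability\<close>

lemma trap_set_rtrancl:
  assumes "trap_set G X" "(x, y) \<in> G\<^sup>*" "x \<in> X"
  shows "y \<in> X"
  using assms(2,3) by induction (use assms(1) in \<open>auto simp: trap_set_def\<close>)

lemma trap_set_reachable: "trap_set G {y. (x, y) \<in> G\<^sup>*}"
  unfolding trap_set_def by (auto intro: rtrancl_into_rtrancl)

text \<open>Every trap set contains \<open>r\<close>, hence everything reachable from
  \<open>r\<close>; that reachable set is itself a trap set, so it is the least one.\<close>

lemma unique_attractor:
  assumes "\<And>x. (x, r) \<in> G\<^sup>*"
  shows "{Y. attractor G Y} = {{y. (r, y) \<in> G\<^sup>*}}"
proof -
  let ?R = "{y. (r, y) \<in> G\<^sup>*}"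
  have sub: "?R \<subseteq> Y" if "trap_set G Y" for Y
  proof -
    obtain y where "y \<in> Y" using \<open>trap_set G Y\<close> unfolding trap_set_def by blast
    then have "r \<in> Y" using trap_set_rtrancl[OF that] assms by blast
    then show ?thesis using trap_set_rtrancl[OF that] by blast
  qed
  have "attractor G ?R"
    unfolding attractor_def using trap_set_reachable[of G r] sub by (auto dest: psubsetD)
  moreover have "Y = ?R" if "attractor G Y" for Y
  proof (rule ccontr)
    assume "Y \<noteq> ?R"
    then have "?R \<subset> Y" using that sub by (auto simp: attractor_def)
    then show False using that trap_set_reachable[of G r] unfolding attractor_def by metis
  qed
  ultimately show ?thesis by blast
qed

text \<open>Each point of \<open>P\<close> is a sink, so its singleton is a trap set; any trap set
  contains such a point, so a minimal one is that singleton.\<close>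

lemma attractors_singletons:
  assumes fixed: "\<And>x y. x \<in> P \<Longrightarrow> (x, y) \<notin> G"
    and reach: "\<And>x. \<exists>p \<in> P. (x, p) \<in> G\<^sup>*"
  shows "{Y. attractor G Y} = (\<lambda>x. {x}) ` P"
proof -
  have trap: "trap_set G {x}" if "x \<in> P" for x
    using fixed[OF that] by (auto simp: trap_set_def)
  have "attractor G {x}" if "x \<in> P" for x
    unfolding attractor_def using trap[OF that] by (auto simp: trap_set_def)
  moreover have "Y \<in> (\<lambda>x. {x}) ` P" if "attractor G Y" for Y
  proof -
    have Y: "trap_set G Y" and min: "\<And>Z. Z \<subset> Y \<Longrightarrow> \<not> trap_set G Z"
      using that by (auto simp: attractor_def)
    obtain y where "y \<in> Y" using Y unfolding trap_set_def by blast
    obtain p where "p \<in> P" "(y, p) \<in> G\<^sup>*" using reach by blast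
    then have "p \<in> Y" using trap_set_rtrancl[OF Y _ \<open>y \<in> Y\<close>] by blast
    then have "Y = {p}" using min[of "{p}"] trap[OF \<open>p \<in> P\<close>] by blast
    with \<open>p \<in> P\<close> show ?thesis by blast
  qed
  ultimately show ?thesis by blast
qed

lemma rtrancl_ones:
  fixes x y :: "bit ^ 'n::finite"
  assumes "\<And>x y. (x, y) \<in> G \<longleftrightarrow> (ones x, ones y) \<in> H" and "(ones x, ones y) \<in> H\<^sup>*"
  shows "(x, y) \<in> G\<^sup>*"
proof -
  have "(x, y) \<in> G\<^sup>*" if "(ones x, B) \<in> H\<^sup>*" "B = ones y" for B y
    using that
  proof (induction arbitrary: y rule: rtrancl_induct)
    case base
    then show ?case by (simp add: ones_eq_iff)
  next
    case (step A B)
    obtain z where "A = ones z" using surj_ones by (metis surjE)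
    then have "(x, z) \<in> G\<^sup>*" "(z, y) \<in> G" using step assms(1) by auto
    then show ?case by simp
  qed
  then show ?thesis using assms(2) by blast
qed

lemma config_of_labelling_fixed_points:
  fixes f :: "'n::finite config \<Rightarrow> 'n config" and \<pi> :: "'n config \<Rightarrow> 'n set"
  assumes "bij \<pi>" and reach: "\<And>A. \<exists>z \<in> fixed_points f. (A, \<pi> z) \<in> (label_graph f \<pi>)\<^sup>*"
  shows "\<exists>h. h \<sim>\<^sub>S f \<and> card {X. attractor (async_graph h) X} = fp f"
proof -
  obtain h where h: "h \<sim>\<^sub>S f"
    and G: "\<And>x y. (x, y) \<in> async_graph h \<longleftrightarrow> (ones x, ones y) \<in> label_graph f \<pi>"
    and fix_iff: "\<And>v x. ones x = \<pi> v \<Longrightarrow> h x = x \<longleftrightarrow> f v = v"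
    using relabel[OF assms(1), of f] by auto
  define \<sigma> where "\<sigma> = inv ones \<circ> \<pi>"
  have ones_\<sigma>: "ones (\<sigma> v) = \<pi> v" for v
    by (simp add: \<sigma>_def surj_ones surj_f_inv_f)
  have inj_\<sigma>: "inj \<sigma>"
    by (rule injI) (metis ones_\<sigma> assms(1) bij_is_inj injD)
  let ?P = "\<sigma> ` fixed_points f"
  have "{X. attractor (async_graph h) X} = (\<lambda>x. {x}) ` ?P"
  proof (rule attractors_singletons)
    fix x y assume "x \<in> ?P"
    then have "h x = x" using fix_iff ones_\<sigma> by (auto simp: fixed_points_def)
    then show "(x, y) \<notin> async_graph h" by (auto simp: async_graph_def)
  next
    fix x
    show "\<exists>p \<in> ?P. (x, p) \<in> (async_graph h)\<^sup>*"
      using reach[of "ones x"] rtrancl_ones[OF G, of x] by (auto simp flip: ones_\<sigma>)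
  qed
  moreover have "card ((\<lambda>x. {x}) ` ?P) = card ?P" by (rule card_image) simp
  moreover have "card ?P = fp f"
    unfolding fp_def by (rule card_image[OF inj_on_subset[OF inj_\<sigma>]]) simp
  ultimately have "card {X. attractor (async_graph h) X} = fp f" by simp
  with h show ?thesis by blast
qed

text \<open>\<open>X\<close> need not be minimal: the unique attractor is the set reachable from the
  empty support, and \<open>X\<close> only bounds it from above.\<close>

lemma config_of_labelling_small_attractor:
  fixes f :: "'n::finite config \<Rightarrow> 'n config" and \<pi> :: "'n config \<Rightarrow> 'n set"
  assumes "bij \<pi>" and reach: "\<And>A. (A, {}) \<in> (label_graph f \<pi>)\<^sup>*"
    and trap: "trap_set (label_graph f \<pi>) X" and "{} \<in> X" "card X \<le> 4"
  shows "\<exists>h. h \<sim>\<^sub>S f \<and> (\<exists>X. {Y. attractor (async_graph h) Y} = {X} \<and> card X \<le> 4)"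
proof -
  obtain h where h: "h \<sim>\<^sub>S f"
    and G: "\<And>x y. (x, y) \<in> async_graph h \<longleftrightarrow> (ones x, ones y) \<in> label_graph f \<pi>"
    using relabel[OF assms(1), of f] by auto
  have ones_0: "ones (0 :: 'n config) = {}" by (simp add: ones_def)
  let ?R = "{y. (0, y) \<in> (async_graph h)\<^sup>*}"
  have "(x, 0) \<in> (async_graph h)\<^sup>*" for x
    by (rule rtrancl_ones[OF G]) (simp add: ones_0 reach)
  then have unique: "{Y. attractor (async_graph h) Y} = {?R}" by (rule unique_attractor)
  have "0 \<in> (ones -` X :: 'n config set)" using \<open>{} \<in> X\<close> ones_0 by simp
  then have "trap_set (async_graph h) (ones -` X)"
    using trap unfolding trap_set_def G by blast
  then have "?R \<subseteq> ones -` X"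
    using trap_set_rtrancl[of "async_graph h" "ones -` X" 0] \<open>{} \<in> X\<close> ones_0 by auto
  moreover have "card (ones -` X :: 'n config set) = card X"
    by (rule card_vimage_inj) (auto simp: inj_def ones_eq_iff surj_ones)
  ultimately have "card ?R \<le> 4"
    using \<open>card X \<le> 4\<close> card_mono[of "ones -` X :: 'n config set" ?R] finite by simp
  with h unique show ?thesis by blast
qed

section \<open>Descent in the label graph\<close>

definition descends :: "('v \<Rightarrow> 'v) \<Rightarrow> ('v \<Rightarrow> 'n set) \<Rightarrow> 'v \<Rightarrow> bool" where
  "descends f \<pi> x \<longleftrightarrow> \<not> \<pi> x \<subseteq> \<pi> (f x)"

lemma label_graph_down:
  assumes "i \<in> \<pi> x" "i \<notin> \<pi> (f x)"
  shows "(\<pi> x, \<pi> x - {i}) \<in> label_graph f \<pi>"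
  using assms unfolding label_graph_def by blast

lemma label_graph_up:
  assumes "i \<notin> \<pi> x" "i \<in> \<pi> (f x)"
  shows "(\<pi> x, insert i (\<pi> x)) \<in> label_graph f \<pi>"
  using assms unfolding label_graph_def by blast

text \<open>Induction on the size of the label: a descending vertex has an arc to a proper subset.
  Only labels inside \<open>A\<close> are constrained, so the lemma also applies to a part of the
  cube that avoids a bad vertex.\<close>

lemma reach_below:
  fixes \<pi> :: "'v \<Rightarrow> 'n::finite set"
  assumes "surj \<pi>"
    and "\<And>x. \<pi> x \<subseteq> A \<Longrightarrow> x \<in> T \<or> descends f \<pi> x \<or> (\<exists>t \<in> T. (\<pi> x, \<pi> t) \<in> (label_graph f \<pi>)\<^sup>*)"
  shows "\<exists>t \<in> T. (A, \<pi> t) \<in> (label_graph f \<pi>)\<^sup>*"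
  using assms(2)
proof (induction "card A" arbitrary: A rule: less_induct)
  case less
  obtain x where x: "A = \<pi> x" using assms(1) by (metis surjE)
  consider "x \<in> T" | "descends f \<pi> x" | "\<exists>t \<in> T. (\<pi> x, \<pi> t) \<in> (label_graph f \<pi>)\<^sup>*"
    using less.prems[of x] x by blast
  then show ?case
  proof cases
    case 2
    then obtain i where i: "i \<in> \<pi> x" "i \<notin> \<pi> (f x)" by (auto simp: descends_def)
    have "card (A - {i}) < card A" using i x by (intro card_Diff1_less) auto
    then have "\<exists>t \<in> T. (A - {i}, \<pi> t) \<in> (label_graph f \<pi>)\<^sup>*"
      by (rule less.hyps) (rule less.prems, blast)
    moreover have "(A, A - {i}) \<in> label_graph f \<pi>" using label_graph_down i x by metis
    ultimately show ?thesis by (meson converse_rtrancl_into_rtrancl)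
  qed (use x in auto)
qed

text \<open>The exceptional vertex \<open>c\<close> climbs to the full label and leaves it through another coatom.\<close>

lemma reach_over_top:
  fixes \<pi> :: "'v \<Rightarrow> 'n::finite set"
  assumes "bij \<pi>"
    and down: "\<And>x. x \<noteq> c \<Longrightarrow> x \<in> T \<or> descends f \<pi> x"
    and c: "\<pi> c = - {j}" "\<pi> (f c) = UNIV" "f (f c) \<noteq> c" "f (f c) \<noteq> f c"
  shows "\<exists>t \<in> T. (A, \<pi> t) \<in> (label_graph f \<pi>)\<^sup>*"
proof -
  have inj: "\<pi> x = \<pi> y \<longleftrightarrow> x = y" for x y
    using assms(1) by (simp add: bij_is_inj inj_eq)
  \<comment> \<open>The image of \<open>f c\<close> has a label different from \<open>UNIV\<close>
    and from the coatom of \<open>c\<close>, so it misses a coordinate other than \<open>j\<close>.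
    Removing that coordinate leads from the full set to another coatom.\<close>
  have "\<pi> (f (f c)) \<noteq> UNIV" "\<pi> (f (f c)) \<noteq> - {j}" using c inj by metis+
  then obtain i where i: "i \<notin> \<pi> (f (f c))" "i \<noteq> j" by blast
  have "(\<pi> c, UNIV) \<in> label_graph f \<pi>"
  proof -
    have "insert j (- {j}) = UNIV" by blast
    then show ?thesis using label_graph_up[of j \<pi> c f] c by simp
  qed
  moreover have "(UNIV, - {i}) \<in> label_graph f \<pi>"
    using label_graph_down[of i \<pi> "f c" f] i c by (simp add: Compl_eq_Diff_UNIV)
  \<comment> \<open>The label \<open>- {j}\<close> of \<open>c\<close> does not occur below
    \<open>- {i}\<close>, so every vertex there descends or lies in \<open>T\<close>.\<close>
  moreover have "\<exists>t \<in> T. (- {i}, \<pi> t) \<in> (label_graph f \<pi>)\<^sup>*"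
  proof (rule reach_below[OF bij_is_surj[OF assms(1)]])
    fix x assume "\<pi> x \<subseteq> - {i}"
    then have "x \<noteq> c" using c i by auto
    then show "x \<in> T \<or> descends f \<pi> x \<or> (\<exists>t\<in>T. (\<pi> x, \<pi> t) \<in> (label_graph f \<pi>)\<^sup>*)"
      using down by blast
  qed
  ultimately have "\<exists>t \<in> T. (\<pi> c, \<pi> t) \<in> (label_graph f \<pi>)\<^sup>*"
    by (meson converse_rtrancl_into_rtrancl)
  then show ?thesis
    using down by (intro reach_below[OF bij_is_surj[OF assms(1)]]) metis
qed

subsection \<open>Cycles of a finite map\<close>

text \<open>The injectivity clause makes \<open>m\<close> the least period, so that
  \<open>cycle_set\<close> has exactly \<open>m\<close> elements.\<close>

definition is_cycle :: "('v \<Rightarrow> 'v) \<Rightarrow> 'v \<Rightarrow> nat \<Rightarrow> bool" where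
  "is_cycle f c m \<longleftrightarrow> 0 < m \<and> (f ^^ m) c = c \<and> inj_on (\<lambda>i. (f ^^ i) c) {..<m}"

definition cycle_set :: "('v \<Rightarrow> 'v) \<Rightarrow> 'v \<Rightarrow> nat \<Rightarrow> 'v set" where
  "cycle_set f c m = (\<lambda>i. (f ^^ i) c) ` {..<m}"

lemma card_cycle_set: "is_cycle f c m \<Longrightarrow> card (cycle_set f c m) = m"
  by (simp add: is_cycle_def cycle_set_def card_image)

lemma cycle_set_self: "is_cycle f c m \<Longrightarrow> c \<in> cycle_set f c m"
  unfolding is_cycle_def cycle_set_def by (rule image_eqI[of _ _ 0]) auto

lemma cycle_set_subset:
  assumes "f ` W \<subseteq> W" "c \<in> W"
  shows "cycle_set f c m \<subseteq> W"
proof -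
  have "(f ^^ i) c \<in> W" for i by (induction i) (use assms in auto)
  then show ?thesis by (auto simp: cycle_set_def)
qed

lemma cycle_set_closed:
  assumes "is_cycle f c m"
  shows "f ` cycle_set f c m \<subseteq> cycle_set f c m"
proof clarify
  fix x assume "x \<in> cycle_set f c m"
  then obtain i where i: "i < m" "x = (f ^^ i) c" by (auto simp: cycle_set_def)
  show "f x \<in> cycle_set f c m"
  proof (cases "Suc i < m")
    case True
    then show ?thesis using i unfolding cycle_set_def by (intro image_eqI[of _ _ "Suc i"]) auto
  next
    case False
    then have "Suc i = m" using i by simp
    then have "f x = c" using i assms by (auto simp: is_cycle_def)
    then show ?thesis using cycle_set_self[OF assms] by simp
  qed
qed

text \<open>Injectivity on the invariant set lets equal iterates be cancelled back to
  \<open>c\<close>, so the first repetition is a return to \<open>c\<close> itself and not to a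
  later point.\<close>

lemma obtain_cycle:
  assumes "inj_on f W" "f ` W \<subseteq> W" "c \<in> W" "finite W"
  obtains m where "is_cycle f c m"
proof -
  have in_W: "(f ^^ i) x \<in> W" if "x \<in> W" for i x
    by (induction i) (use that assms(2) in auto)
  have cancel: "x = y" if "(f ^^ i) x = (f ^^ i) y" "x \<in> W" "y \<in> W" for i x y
    using that(1)
  proof (induction i)
    case (Suc i)
    then show ?case using inj_onD[OF assms(1)] in_W that by simp
  qed simp
  have period: "(f ^^ (j - i)) c = c" if "i < j" "(f ^^ i) c = (f ^^ j) c" for i j
  proof -
    have "(f ^^ i) ((f ^^ (j - i)) c) = (f ^^ i) c"
      using that funpow_add[of i "j - i" f] by simp
    then show ?thesis using cancel in_W assms(3) by blast
  qed
  have "\<not> inj (\<lambda>i. (f ^^ i) c)"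
    using in_W[OF assms(3)] assms(4) by (metis finite_subset image_subsetI infinite_UNIV_nat finite_imageD)
  then obtain i j where "i < j" "(f ^^ i) c = (f ^^ j) c"
    unfolding inj_def by (metis linorder_neqE_nat)
  then have ex: "\<exists>m. 0 < m \<and> (f ^^ m) c = c" using period by (metis zero_less_diff)
  define m where "m = (LEAST m. 0 < m \<and> (f ^^ m) c = c)"
  have m: "0 < m" "(f ^^ m) c = c"
    using LeastI_ex[OF ex] by (auto simp: m_def)
  have least: "m \<le> k" if "0 < k" "(f ^^ k) c = c" for k
    unfolding m_def using that by (intro Least_le) simp
  have neq: "(f ^^ i) c \<noteq> (f ^^ j) c" if "i < j" "j < m" for i j
    using least[of "j - i"] period[of i j] that by fastforce
  have "inj_on (\<lambda>i. (f ^^ i) c) {..<m}"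
    by (rule linorder_inj_onI) (use neq in auto)
  with m that show ?thesis by (simp add: is_cycle_def)
qed

lemma cycle_complement:
  assumes "inj_on f W" "f ` W \<subseteq> W" "c \<in> W" "is_cycle f c m"
  shows "f ` (W - cycle_set f c m) \<subseteq> W - cycle_set f c m"
proof clarify
  fix x assume x: "x \<in> W" "x \<notin> cycle_set f c m"
  have "f x \<notin> cycle_set f c m"
  proof
    assume "f x \<in> cycle_set f c m"
    then obtain i where i: "i < m" "f x = (f ^^ i) c" by (auto simp: cycle_set_def)
    \<comment> \<open>The index of the predecessor on the cycle, wrapping from 0 to
      \<open>m - 1\<close>. By injectivity it is the only preimage inside \<open>W\<close>.\<close>
    define k where "k = (if i = 0 then m - 1 else i - 1)"
    have "k < m" using i by (auto simp: k_def)
    moreover have "f ((f ^^ k) c) = (f ^^ Suc k) c" by simp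
    moreover have "(f ^^ Suc k) c = f x"
      using i assms(4) by (cases "i = 0") (simp_all add: k_def is_cycle_def del: funpow.simps)
    ultimately have k: "k < m" "f ((f ^^ k) c) = f x" by simp_all
    have "(f ^^ k) c \<in> cycle_set f c m" using k by (auto simp: cycle_set_def)
    moreover have "(f ^^ k) c = x"
      using k inj_onD[OF assms(1)] cycle_set_subset[OF assms(2,3)] x calculation by blast
    ultimately show False using x by simp
  qed
  then show "f x \<in> W - cycle_set f c m" using assms(2) x by blast
qed

text \<open>One cycle after the other is peeled off. Read contrapositively, this produces a cycle
  whose length is not 2 in a set of odd size, and one whose length is not 3 in a set of size
  \<open>2 ^ n\<close>.\<close>

lemma cycle_lengths_dvd_card:
  assumes "finite W" "inj_on f W" "f ` W \<subseteq> W"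
    and "\<And>c m. c \<in> W \<Longrightarrow> is_cycle f c m \<Longrightarrow> m = d"
  shows "d dvd card W"
  using assms
proof (induction "card W" arbitrary: W rule: less_induct)
  case less
  show ?case
  proof (cases "W = {}")
    case False
    then obtain c where c: "c \<in> W" by blast
    obtain m where m: "is_cycle f c m" using obtain_cycle[OF less.prems(2,3) c less.prems(1)] .
    let ?O = "cycle_set f c m"
    have sub: "?O \<subseteq> W" using cycle_set_subset[OF less.prems(3) c] .
    have cardO: "card ?O = d" using card_cycle_set[OF m] less.prems(4)[OF c m] by simp
    have "card (W - ?O) < card W"
      using c cycle_set_self[OF m] less.prems(1) by (intro psubset_card_mono) auto
    then have "d dvd card (W - ?O)"
      using less.prems cycle_complement[OF less.prems(2,3) c m]
      by (intro less.hyps) (auto intro: inj_on_subset)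
    moreover have "card W = card (W - ?O) + card ?O"
      using sub less.prems(1) by (metis card_Diff_subset card_mono finite_subset le_add_diff_inverse2)
    ultimately show ?thesis using cardO by simp
  qed simp
qed

definition periodic :: "('v \<Rightarrow> 'v) \<Rightarrow> 'v set" where
  "periodic f = {x. \<exists>k>0. (f ^^ k) x = x}"

lemma periodic_closed: "f ` periodic f \<subseteq> periodic f"
  unfolding periodic_def by (auto simp: funpow_swap1) (metis funpow_swap1)

text \<open>Two periodic points have the common period \<open>k * l\<close>, so
  \<open>k * l - 1\<close> further steps take the common image back to both of them.\<close>

lemma inj_on_periodic: "inj_on f (periodic f)"
proof (rule inj_onI)
  fix x y assume xy: "x \<in> periodic f" "y \<in> periodic f" "f x = f y"
  then obtain k l where kl: "k > 0" "(f ^^ k) x = x" "l > 0" "(f ^^ l) y = y"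
    by (auto simp: periodic_def)
  have x: "(f ^^ (k * l)) x = x" for l
    by (induction l) (simp_all add: funpow_add kl)
  have y: "(f ^^ (l * k)) y = y" for k
    by (induction k) (simp_all add: funpow_add kl)
  obtain j where j: "k * l = Suc j" using kl by (metis gr0_conv_Suc nat_0_less_mult_iff)
  have "(f ^^ (k * l)) x = (f ^^ j) (f x)" "(f ^^ (k * l)) y = (f ^^ j) (f y)"
    unfolding j by (simp_all add: funpow_swap1)
  then show "x = y" using x[of l] y[of k] xy(3) by (simp add: mult.commute)
qed

lemma eventually_periodic:
  fixes f :: "'v::finite \<Rightarrow> 'v"
  shows "\<exists>k. (f ^^ k) x \<in> periodic f"
proof -
  have "\<not> inj (\<lambda>i. (f ^^ i) x)"
    using finite_imageD infinite_UNIV_nat finite by blast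
  then obtain i j where ij: "i < j" "(f ^^ i) x = (f ^^ j) x"
    unfolding inj_def by (metis linorder_neqE_nat)
  have "(f ^^ (j - i)) ((f ^^ i) x) = (f ^^ (j - i + i)) x" by (simp add: funpow_add)
  then have "(f ^^ (j - i)) ((f ^^ i) x) = (f ^^ i) x" using ij by simp
  then show ?thesis unfolding periodic_def using ij(1) by (metis (mono_tags, lifting) mem_Collect_eq zero_less_diff)
qed

lemma is_cycle_periodic: "is_cycle f c m \<Longrightarrow> cycle_set f c m \<subseteq> periodic f"
  by (rule cycle_set_subset[OF periodic_closed]) (auto simp: is_cycle_def periodic_def)

subsection \<open>Partial labellings\<close>

lemma card_compl: "card (- A) = CARD('a) - card A" for A :: "'a::finite set"
  unfolding Compl_eq_Diff_UNIV by (rule card_Diff_subset) simp_all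

text \<open>\<open>D0\<close> holds the labels planted by hand and \<open>E\<close> the vertices
  excused from descending. Down-closure is not asked of \<open>UNIV\<close>, which may be planted
  long before its subsets are used up.\<close>

locale labelling =
  fixes f :: "'v::finite \<Rightarrow> 'v" and D0 :: "'n::finite set set" and E :: "'v set"
  assumes card_vertices: "CARD('v) = 2 ^ CARD('n)"
    and down_closed: "B \<in> D0 \<Longrightarrow> A \<subseteq> B \<Longrightarrow> B \<noteq> UNIV \<Longrightarrow> A \<in> D0"
begin

text \<open>The third clause records that labels beyond \<open>D0\<close> were taken in order of
  size. Descent is demanded only once the image is labelled too. The last clause keeps unlabelled
  vertices from mapping to the carrier of the full set, where they could never descend.\<close>

definition partial :: "('v \<Rightarrow> 'n set) \<Rightarrow> 'v set \<Rightarrow> bool" where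
  "partial \<pi> S \<longleftrightarrow> inj_on \<pi> S \<and> D0 \<subseteq> \<pi> ` S
     \<and> (\<forall>A \<in> \<pi> ` S - D0. \<forall>B. B \<notin> \<pi> ` S \<longrightarrow> card A \<le> card B)
     \<and> (\<forall>x \<in> S - E. f x \<in> S \<longrightarrow> f x = x \<or> descends f \<pi> x)
     \<and> (\<forall>y. y \<notin> S \<longrightarrow> f y \<in> S \<longrightarrow> \<pi> (f y) \<noteq> UNIV)"

definition lowest :: "('v \<Rightarrow> 'n set) \<Rightarrow> 'v set \<Rightarrow> 'n set \<Rightarrow> bool" where
  "lowest \<pi> S A \<longleftrightarrow> A \<notin> \<pi> ` S \<and> (\<forall>B. B \<notin> \<pi> ` S \<longrightarrow> card A \<le> card B)"

text \<open>These are the levels to which a reserve label may still have to move. The full level is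
  left out, as \<open>UNIV\<close> contains every \<open>u\<close>.\<close>

definition avoidable :: "'n set \<Rightarrow> nat \<Rightarrow> bool" where
  "avoidable u k \<longleftrightarrow>
     (\<forall>l. k < l \<longrightarrow> l < CARD('n) \<longrightarrow> (\<exists>w. w \<notin> D0 \<and> card w = l \<and> \<not> u \<subseteq> w))"

definition room :: "'v set \<Rightarrow> nat \<Rightarrow> bool" where
  "room S m \<longleftrightarrow> m < card (- S) \<and> (UNIV \<in> D0 \<or> Suc m < card (- S))"

lemma card_labels: "CARD('n set) = 2 ^ CARD('n)"
  by (simp add: card_Pow flip: Pow_UNIV)

lemma card_unused_labels:
  fixes \<pi> :: "'v \<Rightarrow> 'n set"
  assumes "inj_on \<pi> S"
  shows "card (- \<pi> ` S) = card (- S)"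
  unfolding card_compl card_image[OF assms] card_vertices card_labels ..

lemma full_labelling:
  assumes "partial \<pi> UNIV"
  shows "bij \<pi>" "x \<notin> E \<Longrightarrow> f x = x \<or> descends f \<pi> x"
proof -
  have inj: "inj \<pi>" using assms by (simp add: partial_def)
  then have "- range \<pi> = {}" using card_unused_labels[of \<pi> UNIV] by simp
  then show "bij \<pi>" using inj by (intro bijI) auto
qed (use assms in \<open>auto simp: partial_def\<close>)

lemma partial_inj: "partial \<pi> S \<Longrightarrow> inj_on \<pi> S"
  by (simp add: partial_def)

lemma partial_card_le:
  "partial \<pi> S \<Longrightarrow> A \<in> \<pi> ` S \<Longrightarrow> A \<notin> D0 \<Longrightarrow> B \<notin> \<pi> ` S \<Longrightarrow> card A \<le> card B"
  by (simp add: partial_def)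

lemma unused_not_below:
  assumes "partial \<pi> S" "A \<notin> \<pi> ` S" "B \<in> \<pi> ` S" "B \<noteq> UNIV"
  shows "\<not> A \<subseteq> B"
proof
  assume sub: "A \<subseteq> B"
  have "D0 \<subseteq> \<pi> ` S" using assms(1) by (simp add: partial_def)
  then have "B \<notin> D0" using assms(2,4) down_closed[OF _ sub] by blast
  then have "card B \<le> card A" using assms by (auto simp: partial_def)
  then have "A = B" using sub by (simp add: card_seteq)
  then show False using assms by simp
qed

lemma image_fun_upd_insert: "y \<notin> S \<Longrightarrow> \<pi>(y := A) ` insert y S = insert A (\<pi> ` S)"
  by auto

text \<open>\<open>y\<close> itself descends by \<open>unused_not_below\<close>. The only danger is
  a labelled preimage of \<open>y\<close>, which the last hypothesis takes care of.\<close>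

lemma partial_insert:
  assumes "partial \<pi> S" "y \<notin> S" "lowest \<pi> S A"
    and "\<And>x. x \<in> S - E \<Longrightarrow> f x = y \<Longrightarrow> \<not> \<pi> x \<subseteq> A"
  shows "partial (\<pi>(y := A)) (insert y S)"
proof -
  let ?\<pi> = "\<pi>(y := A)"
  have img: "?\<pi> ` insert y S = insert A (\<pi> ` S)" by (rule image_fun_upd_insert[OF assms(2)])
  have A: "A \<notin> \<pi> ` S" "\<And>B. B \<notin> \<pi> ` S \<Longrightarrow> card A \<le> card B"
    using assms(3) by (auto simp: lowest_def)
  have "inj_on \<pi> S" using assms(1) by (rule partial_inj)
  then have "inj_on ?\<pi> (insert y S)"
    using A(1) assms(2) by (auto simp: inj_on_def)
  moreover have "D0 \<subseteq> insert A (\<pi> ` S)" using assms(1) by (auto simp: partial_def)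
  moreover have "card B \<le> card C" if "B \<in> insert A (\<pi> ` S) - D0" "C \<notin> insert A (\<pi> ` S)" for B C
    using that A partial_card_le[OF assms(1)] by blast
  moreover have "f x = x \<or> descends f ?\<pi> x" if x: "x \<in> insert y S - E" "f x \<in> insert y S" for x
  proof -
    consider "x = y" "f x = y" | "x = y" "f x \<in> S" "f x \<noteq> y" | "x \<in> S" "x \<noteq> y" "f x = y"
      | "x \<in> S" "x \<noteq> y" "f x \<in> S" "f x \<noteq> y"
      using x by blast
    then show ?thesis
    proof cases
      case 2
      then have "\<not> A \<subseteq> \<pi> (f x)"
        using unused_not_below[OF assms(1) A(1)] assms(1,2) by (auto simp: partial_def)
      then show ?thesis using 2 by (simp add: descends_def)
    next
      case 3
      then show ?thesis using assms(4)[of x] x by (simp add: descends_def)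
    next
      case 4
      then show ?thesis using assms(1) x by (auto simp: partial_def descends_def)
    qed simp
  qed
  moreover have "?\<pi> (f z) \<noteq> UNIV" if z: "z \<notin> insert y S" "f z \<in> insert y S" for z
  proof (cases "f z = y")
    case True
    have "A \<noteq> UNIV"
    proof
      assume "A = UNIV"
      then have "B = UNIV" if "B \<notin> \<pi> ` S" for B
        using A(2)[OF that] card_seteq[of "UNIV :: 'n set" B] by auto
      then have "- \<pi> ` S \<subseteq> {UNIV}" by auto
      then have "card (- \<pi> ` S) \<le> 1" using card_mono[of "{UNIV}" "- \<pi> ` S"] by simp
      moreover have "card {y, z} \<le> card (- S)" using z assms(2) by (intro card_mono) auto
      ultimately show False
        using z card_unused_labels[OF \<open>inj_on \<pi> S\<close>] by auto
    qed
    then show ?thesis using True by simp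
  next
    case False
    then show ?thesis using z assms(1) by (auto simp: partial_def)
  qed
  ultimately show ?thesis unfolding partial_def img by blast
qed

lemma ex_lowest:
  assumes "inj_on \<pi> S" "S \<noteq> UNIV"
  shows "\<exists>A. lowest \<pi> S A"
proof -
  have "card (- S) \<noteq> 0" using assms(2) by auto
  then have "card (- \<pi> ` S) \<noteq> 0" using card_unused_labels[OF assms(1)] by simp
  then have "- \<pi> ` S \<noteq> {}" by force
  then obtain A where "is_arg_min card (\<lambda>A. A \<in> - \<pi> ` S) A"
    using ex_is_arg_min_if_finite[of "- \<pi> ` S" card] by auto
  then show ?thesis by (auto simp: lowest_def is_arg_min_linorder)
qed

lemma extend_to_all:
  assumes "partial \<pi> S" "f ` S \<subseteq> S" "\<And>y. \<exists>k. (f ^^ k) y \<in> S"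
  shows "\<exists>\<pi>'. partial \<pi>' UNIV \<and> (\<forall>x \<in> S. \<pi>' x = \<pi> x)"
  using assms
proof (induction "card (- S)" arbitrary: \<pi> S rule: less_induct)
  case less
  show ?case
  proof (cases "S = UNIV")
    case True
    then show ?thesis using less.prems by auto
  next
    case False
    then obtain y where "y \<notin> S" by blast
    \<comment> \<open>The point \<open>z\<close> just before the orbit of \<open>y\<close> enters
      \<open>S\<close> lies outside \<open>S\<close> and has its image inside.\<close>
    define k where "k = (LEAST k. (f ^^ k) y \<in> S)"
    have k: "(f ^^ k) y \<in> S" unfolding k_def using less.prems(3) by (rule LeastI_ex)
    then obtain j where j: "k = Suc j" using \<open>y \<notin> S\<close> by (cases k) auto
    define z where "z = (f ^^ j) y"
    have "z \<notin> S" unfolding z_def using not_less_Least[of j "\<lambda>k. (f ^^ k) y \<in> S"] j k_def by simp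
    have "f z \<in> S" using k j by (simp add: z_def)
    obtain A where A: "lowest \<pi> S A"
      using ex_lowest[OF partial_inj[OF less.prems(1)] False] by blast
    have "partial (\<pi>(z := A)) (insert z S)"
      using less.prems \<open>z \<notin> S\<close> by (intro partial_insert A) auto
    moreover have "card (- insert z S) < card (- S)"
      using \<open>z \<notin> S\<close> by (intro psubset_card_mono) auto
    moreover have "f ` insert z S \<subseteq> insert z S" using less.prems(2) \<open>f z \<in> S\<close> by auto
    moreover have "\<exists>k. (f ^^ k) y \<in> insert z S" for y using less.prems(3) by blast
    ultimately obtain \<pi>' where "partial \<pi>' UNIV" "\<forall>x \<in> insert z S. \<pi>' x = (\<pi>(z := A)) x"
      using less.hyps by blast
    then show ?thesis using \<open>z \<notin> S\<close> by (metis fun_upd_other insertI2)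
  qed
qed

section \<open>Keeping a label in reserve\<close>

lemma reserve_next_level:
  assumes "partial \<pi> S" "y \<notin> S" "lowest \<pi> S w" "\<And>v. lowest \<pi> S v \<Longrightarrow> v = w"
    and "room S 1" "avoidable u k" "k \<le> card w"
  shows "\<exists>w'. lowest (\<pi>(y := w)) (insert y S) w' \<and> \<not> u \<subseteq> w' \<and> k \<le> card w'"
proof -
  let ?\<pi> = "\<pi>(y := w)"
  have img: "?\<pi> ` insert y S = insert w (\<pi> ` S)" by (rule image_fun_upd_insert[OF assms(2)])
  have inj: "inj_on \<pi> S" using assms(1) by (simp add: partial_def)
  have w: "w \<notin> \<pi> ` S" "\<And>B. B \<notin> \<pi> ` S \<Longrightarrow> card w \<le> card B"
    using assms(3) by (auto simp: lowest_def)
  have inj': "inj_on ?\<pi> (insert y S)" using inj w(1) assms(2) by (auto simp: inj_on_def)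
  have "insert y S \<noteq> UNIV"
  proof
    assume "insert y S = UNIV"
    then have "- S \<subseteq> {y}" by blast
    then have "card (- S) \<le> 1" using card_mono[of "{y}" "- S"] by simp
    then show False using assms(5) by (simp add: room_def)
  qed
  then obtain w0 where w0: "lowest ?\<pi> (insert y S) w0" using ex_lowest[OF inj'] by blast
  then have w0': "w0 \<notin> \<pi> ` S" "w0 \<noteq> w" "\<And>B. B \<notin> \<pi> ` S \<Longrightarrow> B \<noteq> w \<Longrightarrow> card w0 \<le> card B"
    unfolding lowest_def img by auto
  have "card w0 \<noteq> card w"
    using assms(4)[of w0] w w0' by (auto simp: lowest_def)
  then have gt: "card w < card w0" using w(2)[OF w0'(1)] by simp
  have "w0 \<noteq> UNIV"
  proof
    assume U: "w0 = UNIV"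
    then have "B = UNIV" if "B \<notin> \<pi> ` S" "B \<noteq> w" for B
      using w0'(3)[OF that] card_seteq[of "UNIV :: 'n set" B] by auto
    then have "- \<pi> ` S \<subseteq> {w, UNIV}" by auto
    then have "card (- \<pi> ` S) \<le> card {w, UNIV}" by (intro card_mono) auto
    also have "\<dots> \<le> 2" by (simp add: card_insert_if)
    finally have "card (- S) \<le> 2" using card_unused_labels[OF inj] by simp
    moreover have "UNIV \<notin> D0" using U w0'(1) assms(1) by (auto simp: partial_def)
    ultimately show False using assms(5) by (auto simp: room_def)
  qed
  then have "card w0 < CARD('n)" by (intro psubset_card_mono) auto
  then obtain w' where w': "w' \<notin> D0" "card w' = card w0" "\<not> u \<subseteq> w'"
    using assms(6,7) gt unfolding avoidable_def by (meson le_less_trans)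
  have "w' \<notin> \<pi> ` S"
  proof
    assume "w' \<in> \<pi> ` S"
    then have "card w' \<le> card w" using w' w(1) partial_card_le[OF assms(1)] by blast
    then show False using w' gt by simp
  qed
  then have "lowest ?\<pi> (insert y S) w'"
    unfolding lowest_def img using w' w0'(3) gt by auto
  then show ?thesis using w' gt assms(7) by auto
qed

lemma insert_keeping_reserve:
  assumes "partial \<pi> S" "y \<notin> S" "\<And>x. x \<in> S \<Longrightarrow> f x \<noteq> y"
    and w: "lowest \<pi> S w" "\<not> u \<subseteq> w" "k \<le> card w"
    and "room S 1" "avoidable u k"
  shows "\<exists>\<pi>' w'. partial \<pi>' (insert y S) \<and> (\<forall>x \<in> S. \<pi>' x = \<pi> x)
    \<and> lowest \<pi>' (insert y S) w' \<and> \<not> u \<subseteq> w' \<and> k \<le> card w'"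
proof (cases "\<exists>v. lowest \<pi> S v \<and> v \<noteq> w")
  case True
  then obtain v where v: "lowest \<pi> S v" "v \<noteq> w" by blast
  have "partial (\<pi>(y := v)) (insert y S)"
    using assms by (intro partial_insert v) auto
  moreover have "lowest (\<pi>(y := v)) (insert y S) w"
    using w(1) v(2) unfolding lowest_def image_fun_upd_insert[OF assms(2)] by auto
  ultimately show ?thesis using w(2,3) assms(2) by (intro exI[of _ "\<pi>(y := v)"] exI[of _ w]) auto
next
  case False
  then obtain w' where "lowest (\<pi>(y := w)) (insert y S) w'" "\<not> u \<subseteq> w'" "k \<le> card w'"
    using reserve_next_level[OF assms(1,2) w(1) _ assms(7,8) w(3)] by blast
  moreover have "partial (\<pi>(y := w)) (insert y S)"
    using assms by (intro partial_insert w) auto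
  ultimately show ?thesis using assms(2) by (intro exI[of _ "\<pi>(y := w)"] exI[of _ w']) auto
qed

text \<open>Another label of the same size as \<open>u\<close> cannot contain \<open>u\<close>; if
  none is left, the reserve comes from a higher level.\<close>

lemma insert_reserving:
  assumes "partial \<pi> S" "y \<notin> S" "\<And>x. x \<in> S \<Longrightarrow> f x \<noteq> y"
    and u: "lowest \<pi> S u"
    and "room S 1" "avoidable u (card u)"
  shows "\<exists>w. partial (\<pi>(y := u)) (insert y S)
    \<and> lowest (\<pi>(y := u)) (insert y S) w \<and> \<not> u \<subseteq> w \<and> card u \<le> card w"
proof -
  have "partial (\<pi>(y := u)) (insert y S)"
    using assms by (intro partial_insert u) auto
  moreover have "\<exists>w. lowest (\<pi>(y := u)) (insert y S) w \<and> \<not> u \<subseteq> w \<and> card u \<le> card w"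
  proof (cases "\<exists>v. lowest \<pi> S v \<and> v \<noteq> u")
    case True
    then obtain v where v: "lowest \<pi> S v" "v \<noteq> u" by blast
    then have eq: "card v = card u" using u by (auto simp: lowest_def intro: le_antisym)
    then have "\<not> u \<subseteq> v" using v(2) card_subset_eq[of v u] by auto
    moreover have "lowest (\<pi>(y := u)) (insert y S) v"
      using v unfolding lowest_def image_fun_upd_insert[OF assms(2)] by auto
    ultimately show ?thesis using eq by auto
  next
    case False
    then show ?thesis using reserve_next_level[OF assms(1,2) u _ assms(5,6)] by blast
  qed
  ultimately show ?thesis by blast
qed

text \<open>The vertices \<open>g a \<mapsto> \<dots> \<mapsto> g (b - 1)\<close> are inserted backwards, so that each of them is
  mapped to a vertex that already has a lower label.\<close>

lemma insert_path_keeping_reserve: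
  fixes g :: "nat \<Rightarrow> 'v"
  assumes "partial \<pi> S" "\<And>i. f (g i) = g (Suc i)" "inj_on g {a..<b}" "g ` {a..<b} \<inter> S = {}"
    and "\<And>x. x \<in> S \<Longrightarrow> f x \<notin> g ` {a..<b}" "g b \<notin> g ` {a..<b}"
    and "lowest \<pi> S w" "\<not> u \<subseteq> w" "k \<le> card w"
    and "room S (b - a)" "avoidable u k"
  shows "\<exists>\<pi>' w'. partial \<pi>' (S \<union> g ` {a..<b}) \<and> (\<forall>x \<in> S. \<pi>' x = \<pi> x)
    \<and> lowest \<pi>' (S \<union> g ` {a..<b}) w' \<and> \<not> u \<subseteq> w' \<and> k \<le> card w'"
  using assms
proof (induction b arbitrary: \<pi> S w)
  case 0
  then show ?case by (intro exI[of _ \<pi>] exI[of _ w]) simp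
next
  case (Suc b)
  show ?case
  proof (cases "a \<le> b")
    case False
    then show ?thesis using Suc.prems by (intro exI[of _ \<pi>] exI[of _ w]) simp
  next
    case True
    then have ab: "{a..<Suc b} = insert b {a..<b}" by auto
    have b: "g b \<notin> S" "g b \<notin> g ` {a..<b}"
      using Suc.prems(3,4) by (auto simp: ab)
    have "room S 1" using Suc.prems(10) True unfolding room_def by auto
    then obtain \<pi>1 w1 where 1: "partial \<pi>1 (insert (g b) S)" "\<forall>x \<in> S. \<pi>1 x = \<pi> x"
      "lowest \<pi>1 (insert (g b) S) w1" "\<not> u \<subseteq> w1" "k \<le> card w1"
      using insert_keeping_reserve[OF Suc.prems(1) b(1) _ Suc.prems(7-9) _ Suc.prems(11)] Suc.prems(5)
      unfolding ab by blast
    have "card (- S) = Suc (card (- insert (g b) S))"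
      using b(1) card_Suc_Diff1[of "- S" "g b"] by (simp add: Compl_insert)
    then have "room (insert (g b) S) (b - a)"
      using Suc.prems(10) True unfolding room_def by auto
    moreover have "f x \<notin> g ` {a..<b}" if "x \<in> insert (g b) S" for x
      using that Suc.prems(2,5,6) unfolding ab by auto
    moreover have "g ` {a..<b} \<inter> insert (g b) S = {}" using b Suc.prems(4) unfolding ab by auto
    moreover have "inj_on g {a..<b}" using Suc.prems(3) unfolding ab by auto
    ultimately obtain \<pi>2 w2 where 2: "partial \<pi>2 (insert (g b) S \<union> g ` {a..<b})"
      "\<forall>x \<in> insert (g b) S. \<pi>2 x = \<pi>1 x"
      "lowest \<pi>2 (insert (g b) S \<union> g ` {a..<b}) w2" "\<not> u \<subseteq> w2" "k \<le> card w2"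
      using Suc.IH[of \<pi>1 "insert (g b) S" w1] 1 b(2) Suc.prems(2,11) by blast
    have "S \<union> g ` {a..<Suc b} = insert (g b) S \<union> g ` {a..<b}" unfolding ab by auto
    then show ?thesis using 1 2 by (intro exI[of _ \<pi>2] exI[of _ w2]) simp
  qed
qed

text \<open>The start \<open>g a\<close> comes last and takes the reserve. Its labelled preimages
  outside \<open>E\<close> have labels containing \<open>u\<close>, which the reserve does not
  contain, so they descend. Unless \<open>UNIV\<close> is planted, the path must leave a label over,
  because a reserve is never \<open>UNIV\<close>.\<close>

lemma insert_path:
  fixes g :: "nat \<Rightarrow> 'v"
  assumes "partial \<pi> S" "\<And>i. f (g i) = g (Suc i)" "inj_on g {a..<b}" "g ` {a..<b} \<inter> S = {}"
    and "\<And>x. x \<in> S \<Longrightarrow> f x \<notin> g ` {Suc a..<b}" "g b \<notin> g ` {a..<b}"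
    and "\<And>x. x \<in> S - E \<Longrightarrow> f x = g a \<Longrightarrow> u \<subseteq> \<pi> x"
    and "lowest \<pi> S w" "\<not> u \<subseteq> w" "k \<le> card w"
    and "UNIV \<in> D0 \<or> b - a < card (- S)" "avoidable u k" "a < b"
  shows "\<exists>\<pi>'. partial \<pi>' (S \<union> g ` {a..<b}) \<and> (\<forall>x \<in> S. \<pi>' x = \<pi> x)"
proof -
  have ab: "{a..<b} = insert a {Suc a..<b}" using assms(13) by auto
  have "card (g ` {a..<b}) \<le> card (- S)" using assms(4) by (intro card_mono) auto
  then have "b - a \<le> card (- S)" using assms(3) by (simp add: card_image)
  then have "room S (b - Suc a)" using assms(11,13) unfolding room_def by auto
  moreover have "inj_on g {Suc a..<b}" "g ` {Suc a..<b} \<inter> S = {}" "g b \<notin> g ` {Suc a..<b}"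
    using assms(3,4,6) unfolding ab by auto
  ultimately obtain \<pi>1 w1 where 1: "partial \<pi>1 (S \<union> g ` {Suc a..<b})" "\<forall>x \<in> S. \<pi>1 x = \<pi> x"
    "lowest \<pi>1 (S \<union> g ` {Suc a..<b}) w1" "\<not> u \<subseteq> w1"
    using insert_path_keeping_reserve[OF assms(1,2) _ _ assms(5) _ assms(8-10) _ assms(12)] by blast
  have a: "g a \<notin> S \<union> g ` {Suc a..<b}" using assms(3,4) unfolding ab by auto
  have "partial (\<pi>1(g a := w1)) (insert (g a) (S \<union> g ` {Suc a..<b}))"
  proof (rule partial_insert[OF 1(1) a 1(3)])
    fix x assume x: "x \<in> S \<union> g ` {Suc a..<b} - E" "f x = g a"
    have "x \<notin> g ` {Suc a..<b}"
    proof
      assume "x \<in> g ` {Suc a..<b}"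
      then obtain i where i: "Suc a \<le> i" "i < b" "x = g i" by auto
      then have eq: "g (Suc i) = g a" using assms(2) x by simp
      show False
      proof (cases "Suc i < b")
        case True
        then show False using inj_onD[OF assms(3) eq] i by auto
      next
        case False
        then have "Suc i = b" using i by simp
        then show False using eq assms(6) i by auto
      qed
    qed
    then show "\<not> \<pi>1 x \<subseteq> w1" using assms(7)[of x] x 1(2,4) by auto
  qed
  moreover have "insert (g a) (S \<union> g ` {Suc a..<b}) = S \<union> g ` {a..<b}" unfolding ab by auto
  ultimately show ?thesis using 1(2) a by (intro exI[of _ "\<pi>1(g a := w1)"]) auto
qed

end

section \<open>The last path and the full set\<close>

context labelling
begin

text \<open>The one kind of non-descending vertex that \<open>reach_over_top\<close> tolerates. The
  two inequalities give the full set an exit towards a different coatom.\<close>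

definition climbs_to_top :: "('v \<Rightarrow> 'n set) \<Rightarrow> 'v \<Rightarrow> bool" where
  "climbs_to_top \<pi> d \<longleftrightarrow>
     (\<exists>j. \<pi> d = - {j}) \<and> \<pi> (f d) = UNIV \<and> f (f d) \<noteq> d \<and> f (f d) \<noteq> f d"

text \<open>When a path \<open>g 1 \<mapsto> g 2 \<mapsto> \<dots>\<close> must fill all remaining labels, the full label goes to \<open>g 2\<close>;
  then \<open>g 1\<close> cannot descend, but as \<open>g 1\<close> receives a coatom this is harmless.\<close>

lemma insert_last_path:
  fixes g :: "nat \<Rightarrow> 'v"
  assumes "partial \<pi> S" "\<And>i. f (g i) = g (Suc i)" "inj_on g {1..<b}" "- S = g ` {1..<b}"
    and "\<And>x. x \<in> S \<Longrightarrow> f x \<notin> g ` {2..<b}" "g b \<in> S"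
    and "\<And>x. x \<in> S - E \<Longrightarrow> f x = g 1 \<Longrightarrow> u \<subseteq> \<pi> x"
    and "lowest \<pi> S w" "\<not> u \<subseteq> w" "k \<le> card w"
    and "avoidable u k" "3 \<le> b" "UNIV \<notin> \<pi> ` S"
    and C: "C \<notin> D0" "Suc (card C) = CARD('n)"
  shows "\<exists>\<pi>' d. bij \<pi>' \<and> (\<forall>x \<in> S. \<pi>' x = \<pi> x) \<and> climbs_to_top \<pi>' d
    \<and> (\<forall>x. x \<notin> E \<longrightarrow> x \<noteq> d \<longrightarrow> f x = x \<or> descends f \<pi>' x)"
proof -
  have split: "{1..<b} = {1, 2} \<union> {3..<b}" using assms(12) by auto
  have notS: "g i \<notin> S" if "1 \<le> i" "i < b" for i
    using assms(4) that by (metis ComplD atLeastLessThan_iff image_eqI)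
  have neq: "g i \<noteq> g j" if "1 \<le> i" "i < b" "1 \<le> j" "j \<le> b" "i \<noteq> j" for i j
  proof (cases "j = b")
    case True
    then show ?thesis using notS[of i] assms(6) that by auto
  next
    case False
    then show ?thesis using inj_onD[OF assms(3), of i j] that by auto
  qed
  let ?S1 = "S \<union> g ` {3..<b}"
  have "card (- S) = b - 1" unfolding assms(4) using assms(3) by (simp add: card_image)
  then have room: "room S (b - 3)" using assms(12) by (auto simp: room_def)
  have inj_g: "inj_on g {3..<b}" using assms(3) by (rule inj_on_subset) auto
  have disj: "g ` {3..<b} \<inter> S = {}" using notS by auto
  have pre: "f x \<notin> g ` {3..<b}" if "x \<in> S" for x using assms(5)[OF that] by auto
  have gb: "g b \<notin> g ` {3..<b}" using disj assms(6) by blast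
  \<comment> \<open>Everything from \<open>g 3\<close> on is inserted in the usual way, so that just
    \<open>g 1\<close> and \<open>g 2\<close> remain for the last two labels.\<close>
  obtain \<pi>1 w1 where 1: "partial \<pi>1 ?S1" "\<forall>x \<in> S. \<pi>1 x = \<pi> x"
    "lowest \<pi>1 ?S1 w1" "\<not> u \<subseteq> w1"
    using insert_path_keeping_reserve[where g = g and a = 3, OF assms(1,2) inj_g disj pre gb
        assms(8-10) room assms(11)] by auto
  have g12: "g 1 \<notin> ?S1" "g 2 \<notin> ?S1" "g 1 \<noteq> g 2"
  proof -
    have "\<forall>i \<in> {3..<b}. g 1 \<noteq> g i \<and> g 2 \<noteq> g i"
      using neq[of 1] neq[of 2] assms(12) by auto
    then show "g 1 \<notin> ?S1" "g 2 \<notin> ?S1" using notS[of 1] notS[of 2] assms(12) by auto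
    show "g 1 \<noteq> g 2" using neq[of 1 2] assms(12) by auto
  qed
  have compl1: "- ?S1 = {g 1, g 2}"
  proof -
    have "- ?S1 = g ` {1..<b} - g ` {3..<b}" using assms(4) by auto
    then show ?thesis unfolding split using g12 by auto
  qed
  have pre1: "\<not> \<pi>1 x \<subseteq> w1" if x: "x \<in> ?S1 - E" "f x = g 1" for x
  proof -
    have "x \<notin> g ` {3..<b}"
    proof
      assume "x \<in> g ` {3..<b}"
      then obtain i where "3 \<le> i" "i < b" "x = g i" by auto
      then show False using x(2) assms(2) neq[of 1 "Suc i"] by simp
    qed
    then show ?thesis using assms(7)[of x] x 1(2,4) by auto
  qed
  define \<pi>2 where "\<pi>2 = \<pi>1(g 1 := w1)"
  define S2 where "S2 = insert (g 1) ?S1"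
  have 2: "partial \<pi>2 S2"
    unfolding \<pi>2_def S2_def using partial_insert[OF 1(1) g12(1) 1(3)] pre1 by blast
  have compl2: "- S2 = {g 2}" unfolding S2_def using compl1 g12(3) by auto
  then have card2: "card (- \<pi>2 ` S2) = 1"
    using card_unused_labels[OF partial_inj[OF 2]] by simp
  have "UNIV \<notin> \<pi>2 ` S2"
  proof
    assume U: "UNIV \<in> \<pi>2 ` S2"
    have "- \<pi>2 ` S2 \<noteq> {}" using card2 by (intro notI) simp
    then obtain B where B: "B \<notin> \<pi>2 ` S2" by blast
    have "UNIV \<notin> D0" using assms(1,13) by (auto simp: partial_def)
    then have "CARD('n) \<le> card B" using partial_card_le[OF 2 U _ B] by blast
    then have "B = UNIV" using card_seteq[of "UNIV :: 'n set" B] by simp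
    then show False using B U by simp
  qed
  then have "UNIV \<in> - \<pi>2 ` S2" by simp
  moreover obtain B where "- \<pi>2 ` S2 = {B}" using card2 by (rule card_1_singletonE)
  ultimately have unused2: "- \<pi>2 ` S2 = {UNIV}" by (metis singletonD)
  have img2: "\<pi>2 ` S2 = insert w1 (\<pi>1 ` ?S1)"
    unfolding \<pi>2_def S2_def by (rule image_fun_upd_insert[OF g12(1)])
  let ?\<pi>3 = "\<pi>2(g 2 := UNIV)"
  have all: "insert (g 2) S2 = UNIV" using compl2 by auto
  have notin2: "g 2 \<notin> S2" using compl2 by auto
  have inj2: "inj_on \<pi>2 S2" using partial_inj[OF 2] .
  have "range ?\<pi>3 = insert UNIV (\<pi>2 ` S2)"
    using image_fun_upd_insert[OF notin2, of \<pi>2 UNIV] unfolding all .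
  then have "surj ?\<pi>3" using unused2 by auto
  moreover have "inj ?\<pi>3"
  proof -
    have "inj_on ?\<pi>3 (insert (g 2) S2)"
      using inj2 notin2 \<open>UNIV \<notin> \<pi>2 ` S2\<close> by (simp add: inj_on_def image_iff) metis
    then show ?thesis unfolding all .
  qed
  ultimately have "bij ?\<pi>3" by (intro bijI)
  moreover have "\<forall>x \<in> S. ?\<pi>3 x = \<pi> x" using 1(2) g12 by (auto simp: \<pi>2_def)
  moreover have "climbs_to_top ?\<pi>3 (g 1)"
  proof -
    have "w1 \<noteq> UNIV" using 1(4) by auto
    then have lt: "card w1 < CARD('n)" by (intro psubset_card_mono) auto
    have "card w1 = card C"
    proof (cases "C \<in> \<pi>1 ` ?S1")
      case True
      then have "card C \<le> card w1"
        using partial_card_le[OF 1(1) True C(1)] 1(3) by (auto simp: lowest_def)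
      then show ?thesis using lt C(2) by simp
    next
      case False
      moreover have "C \<noteq> UNIV" using C(2) by auto
      ultimately show ?thesis using unused2 img2 by auto
    qed
    then have "card (- w1) = 1" using C(2) by (simp add: card_compl)
    then obtain j where "- w1 = {j}" by (metis card_1_singletonE)
    then have "w1 = - {j}" by auto
    moreover have "g 3 \<noteq> g 1" "g 3 \<noteq> g 2" using neq[of 1 3] neq[of 2 3] assms(12) by auto
    moreover have "f (g 1) = g 2" "f (g 2) = g 3"
      using assms(2)[of 1] assms(2)[of 2] by (simp_all add: numeral_2_eq_2 numeral_3_eq_3)
    ultimately show ?thesis using g12(3) by (auto simp: climbs_to_top_def \<pi>2_def)
  qed
  moreover have "f x = x \<or> descends f ?\<pi>3 x" if x: "x \<notin> E" "x \<noteq> g 1" for x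
  proof (cases "x = g 2")
    case True
    have "f x \<noteq> g 2" using assms(2)[of 2] neq[of 2 3] assms(12) True by simp
    then have "?\<pi>3 (f x) \<noteq> ?\<pi>3 (g 2)" by (simp only: inj_eq[OF \<open>inj ?\<pi>3\<close>] not_False_eq_True)
    then have "\<not> ?\<pi>3 x \<subseteq> ?\<pi>3 (f x)" unfolding True fun_upd_same by blast
    then show ?thesis unfolding descends_def by (rule disjI2)
  next
    case False
    then have "x \<in> ?S1" using x(2) compl1 by (metis ComplI empty_iff insert_iff)
    have "f x \<noteq> g 2"
    proof
      assume eq: "f x = g 2"
      show False
      proof (cases "x \<in> S")
        case True
        then show False using assms(5)[OF True] eq assms(12) by auto
      next
        case False
        then obtain i where "3 \<le> i" "i < b" "x = g i" using \<open>x \<in> ?S1\<close> by auto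
        then show False using eq assms(2) neq[of 2 "Suc i"] by simp
      qed
    qed
    then have "f x \<in> S2" using compl2 by (metis ComplI singletonD)
    then have "f x = x \<or> descends f \<pi>2 x"
      using 2 x(1) \<open>x \<in> ?S1\<close> by (auto simp: partial_def S2_def)
    then show ?thesis unfolding descends_def fun_upd_other[OF False] fun_upd_other[OF \<open>f x \<noteq> g 2\<close>] .
  qed
  ultimately show ?thesis by blast
qed

end

section \<open>Opening and inserting whole cycles\<close>

locale spread_labelling = labelling f D0 E
  for f :: "'v::finite \<Rightarrow> 'v" and D0 :: "'n::finite set set" and E :: "'v set" +
  assumes spread: "u \<notin> D0 \<Longrightarrow> card u < l \<Longrightarrow> l < CARD('n) \<Longrightarrow>
    \<exists>w. w \<notin> D0 \<and> card w = l \<and> \<not> u \<subseteq> w"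
begin

lemma avoidable_fresh: "u \<notin> D0 \<Longrightarrow> avoidable u (card u)"
  unfolding avoidable_def using spread by blast

lemma lowest_fresh: "partial \<pi> S \<Longrightarrow> lowest \<pi> S u \<Longrightarrow> u \<notin> D0"
  by (auto simp: partial_def lowest_def)

text \<open>The cycle is opened at \<open>c\<close>, which takes a smallest label \<open>u\<close>;
  the others follow backwards, and \<open>f c\<close> comes last with a reserve that does not
  contain \<open>u\<close>. So even \<open>c\<close> descends. A fixed point is simply
  inserted.\<close>

lemma insert_cycle:
  assumes "partial \<pi> S" "f ` S \<subseteq> S" "is_cycle f c m" "cycle_set f c m \<inter> S = {}"
    and "UNIV \<in> D0 \<or> m < card (- S)"
  shows "\<exists>\<pi>'. partial \<pi>' (S \<union> cycle_set f c m) \<and> (\<forall>x \<in> S. \<pi>' x = \<pi> x)"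
proof -
  define g where "g = (\<lambda>i. (f ^^ i) c)"
  have g: "f (g i) = g (Suc i)" "g 0 = c" "g m = c" for i
    using assms(3) by (simp_all add: g_def is_cycle_def)
  have inj: "inj_on g {..<m}" and set: "cycle_set f c m = g ` {..<m}" and "0 < m"
    using assms(3) by (simp_all add: g_def is_cycle_def cycle_set_def)
  have notS: "g i \<notin> S" if "i < m" for i
    using assms(4) that unfolding set by blast
  have c: "c \<notin> S" using assms(4) cycle_set_self[OF assms(3)] by auto
  then obtain u where u: "lowest \<pi> S u"
    using ex_lowest[OF partial_inj[OF assms(1)]] by blast
  have pre: "f x \<noteq> c" if "x \<in> S" for x using that c assms(2) by auto
  show ?thesis
  proof (cases "m = 1")
    case True
    then have "S \<union> cycle_set f c m = insert c S" by (auto simp: cycle_set_def)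
    moreover have "partial (\<pi>(c := u)) (insert c S)"
      using pre by (intro partial_insert[OF assms(1) c u]) auto
    ultimately show ?thesis using c by (intro exI[of _ "\<pi>(c := u)"]) auto
  next
    case False
    then have m: "2 \<le> m" using \<open>0 < m\<close> by simp
    have "card (cycle_set f c m) \<le> card (- S)" using assms(4) by (intro card_mono) auto
    then have le: "m \<le> card (- S)" using card_cycle_set[OF assms(3)] by simp
    then have "room S 1" using m assms(5) by (auto simp: room_def)
    have av: "avoidable u (card u)" using lowest_fresh[OF assms(1) u] by (rule avoidable_fresh)
    obtain w where w: "partial (\<pi>(c := u)) (insert c S)"
      "lowest (\<pi>(c := u)) (insert c S) w" "\<not> u \<subseteq> w" "card u \<le> card w"
      using insert_reserving[OF assms(1) c pre u \<open>room S 1\<close> av] by blast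
    have split: "{..<m} = insert 0 {1..<m}" using m by auto
    have c1: "c \<notin> g ` {1..<m}" using inj unfolding split using g(2) by auto
    have "\<exists>\<pi>'. partial \<pi>' (insert c S \<union> g ` {1..<m}) \<and> (\<forall>x \<in> insert c S. \<pi>' x = (\<pi>(c := u)) x)"
    proof (rule insert_path[where g = g, OF w(1) g(1) _ _ _ _ _ w(2-4) _ av])
      show "inj_on g {1..<m}" using inj by (rule inj_on_subset) auto
      show "g ` {1..<m} \<inter> insert c S = {}" using c1 notS by auto
      show "g m \<notin> g ` {1..<m}" using c1 g(3) by simp
      show "UNIV \<in> D0 \<or> m - 1 < card (- insert c S)"
        using assms(5) c m card_Suc_Diff1[of "- S" c] by (auto simp: Compl_insert)
      show "1 < m" using m by simp
      fix x
      show "f x \<notin> g ` {Suc 1..<m}" if x: "x \<in> insert c S"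
      proof (cases "x = c")
        case True
        then have "f x = g 1" using g(1)[of 0] g(2) by simp
        moreover have "g 1 \<noteq> g i" if "i \<in> {Suc 1..<m}" for i
          using inj_onD[OF inj, of 1 i] that by auto
        ultimately show ?thesis by (metis imageE)
      next
        case False
        then have "f x \<in> S" using x assms(2) by auto
        then show ?thesis using notS by auto
      qed
      show "u \<subseteq> (\<pi>(c := u)) x" if x: "x \<in> insert c S - E" "f x = g 1"
      proof (cases "x = c")
        case False
        then have "g 1 \<in> S" using x assms(2) by auto
        then show ?thesis using notS[of 1] m by auto
      qed simp
    qed
    moreover have "insert c S \<union> g ` {1..<m} = S \<union> cycle_set f c m"
      unfolding set split using g(2) by auto
    moreover have "\<forall>x \<in> S. (\<pi>(c := u)) x = \<pi> x" using c by auto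
    ultimately show ?thesis by (metis insertI2)
  qed
qed

lemma insert_cycles:
  assumes "partial \<pi> S" "f ` S \<subseteq> S" "inj_on f W" "f ` W \<subseteq> W" "W \<inter> S = {}"
    and "UNIV \<in> D0 \<or> card W < card (- S)"
  shows "\<exists>\<pi>'. partial \<pi>' (S \<union> W) \<and> (\<forall>x \<in> S. \<pi>' x = \<pi> x)"
  using assms
proof (induction "card W" arbitrary: W \<pi> S rule: less_induct)
  case less
  show ?case
  proof (cases "W = {}")
    case True
    then show ?thesis using less.prems(1) by (intro exI[of _ \<pi>]) simp
  next
    case False
    then obtain c where c: "c \<in> W" by blast
    obtain m where m: "is_cycle f c m" using obtain_cycle[OF less.prems(3,4) c] by auto
    let ?O = "cycle_set f c m"
    have sub: "?O \<subseteq> W" using cycle_set_subset[OF less.prems(4) c] .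
    have cardO: "card ?O = m" using card_cycle_set[OF m] .
    have cardW: "card W = card (W - ?O) + m"
      using sub cardO by (metis card_Diff_subset card_mono finite le_add_diff_inverse2)
    obtain \<pi>1 where 1: "partial \<pi>1 (S \<union> ?O)" "\<forall>x \<in> S. \<pi>1 x = \<pi> x"
    proof -
      have "UNIV \<in> D0 \<or> m < card (- S)" using less.prems(6) cardW by linarith
      moreover have "?O \<inter> S = {}" using sub less.prems(5) by blast
      ultimately show ?thesis using that insert_cycle[OF less.prems(1,2) m] by blast
    qed
    have "card (W - ?O) < card W" using cardW m by (simp add: is_cycle_def)
    moreover have "f ` (S \<union> ?O) \<subseteq> S \<union> ?O" using cycle_set_closed[OF m] less.prems(2) by blast
    moreover have "inj_on f (W - ?O)" using less.prems(3) by (rule inj_on_subset) blast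
    moreover have "UNIV \<in> D0 \<or> card (W - ?O) < card (- (S \<union> ?O))"
    proof -
      have "- (S \<union> ?O) = - S - ?O" by auto
      moreover have "?O \<subseteq> - S" using sub less.prems(5) by auto
      ultimately have "card (- (S \<union> ?O)) = card (- S) - m"
        using cardO by (simp add: card_Diff_subset)
      then show ?thesis using less.prems(6) cardW by linarith
    qed
    ultimately obtain \<pi>2 where 2: "partial \<pi>2 (S \<union> ?O \<union> (W - ?O))" "\<forall>x \<in> S \<union> ?O. \<pi>2 x = \<pi>1 x"
      using less.hyps[of "W - ?O" \<pi>1 "S \<union> ?O"] 1(1) cycle_complement[OF less.prems(3,4) c m]
        less.prems(5) by blast
    moreover have "S \<union> ?O \<union> (W - ?O) = S \<union> W" using sub by blast
    ultimately show ?thesis using 1(2) by (intro exI[of _ \<pi>2]) auto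
  qed
qed

text \<open>This cycle uses up all labels. From length three on, \<open>f c\<close> can take the
  last coatom and its image the full set; then \<open>g 3\<close> differs from \<open>g 1\<close>,
  as \<open>climbs_to_top\<close> requires.\<close>

lemma insert_last_cycle:
  assumes "partial \<pi> S" "f ` S \<subseteq> S" "is_cycle f c m" "cycle_set f c m = - S" "3 \<le> m"
    and "UNIV \<notin> \<pi> ` S" and C: "C \<notin> D0" "Suc (card C) = CARD('n)"
  shows "\<exists>\<pi>' d. bij \<pi>' \<and> (\<forall>x \<in> S. \<pi>' x = \<pi> x) \<and> climbs_to_top \<pi>' d
    \<and> (\<forall>x. x \<notin> E \<longrightarrow> x \<noteq> d \<longrightarrow> f x = x \<or> descends f \<pi>' x)"
proof -
  define g where "g = (\<lambda>i. (f ^^ i) c)"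
  have g: "f (g i) = g (Suc i)" "g 0 = c" "g m = c" for i
    using assms(3) by (simp_all add: g_def is_cycle_def)
  have inj: "inj_on g {..<m}" and set: "- S = g ` {..<m}"
    using assms(3,4) by (simp_all add: g_def is_cycle_def cycle_set_def)
  have c: "c \<notin> S" using assms(4) cycle_set_self[OF assms(3)] by auto
  then obtain u where u: "lowest \<pi> S u"
    using ex_lowest[OF partial_inj[OF assms(1)]] by blast
  have pre: "f x \<noteq> c" if "x \<in> S" for x using that c assms(2) by auto
  have card_S: "card (- S) = m" using card_cycle_set[OF assms(3)] assms(4) by simp
  have "room S 1" using card_S assms(5) by (auto simp: room_def)
  have av: "avoidable u (card u)" using lowest_fresh[OF assms(1) u] by (rule avoidable_fresh)
  obtain w where w: "partial (\<pi>(c := u)) (insert c S)"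
    "lowest (\<pi>(c := u)) (insert c S) w" "\<not> u \<subseteq> w" "card u \<le> card w"
    using insert_reserving[OF assms(1) c pre u \<open>room S 1\<close> av] by blast
  have split: "{..<m} = insert 0 {1..<m}" using assms(5) by auto
  have c1: "c \<notin> g ` {1..<m}" using inj unfolding split using g(2) by auto
  have "\<exists>\<pi>' d. bij \<pi>' \<and> (\<forall>x \<in> insert c S. \<pi>' x = (\<pi>(c := u)) x) \<and> climbs_to_top \<pi>' d
    \<and> (\<forall>x. x \<notin> E \<longrightarrow> x \<noteq> d \<longrightarrow> f x = x \<or> descends f \<pi>' x)"
  proof (rule insert_last_path[where g = g, OF w(1) g(1) _ _ _ _ _ w(2-4) av assms(5) _ C])
    show "inj_on g {1..<m}" using inj by (rule inj_on_subset) auto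
    show "- insert c S = g ` {1..<m}" using c1 set unfolding split by (auto simp: g(2))
    show "g m \<in> insert c S" using g(3) by simp
    have "u \<noteq> UNIV"
    proof
      assume "u = UNIV"
      then have "B = UNIV" if "B \<notin> \<pi> ` S" for B
        using u card_seteq[of "UNIV :: 'n set" B] that by (auto simp: lowest_def)
      then have "- \<pi> ` S \<subseteq> {UNIV}" by auto
      then have "card (- \<pi> ` S) \<le> 1" using card_mono[of "{UNIV}" "- \<pi> ` S"] by simp
      then show False
        using card_unused_labels[OF partial_inj[OF assms(1)]] card_S assms(5) by simp
    qed
    then show "UNIV \<notin> (\<pi>(c := u)) ` insert c S"
      using assms(6) unfolding image_fun_upd_insert[OF c] by auto
    fix x
    show "f x \<notin> g ` {2..<m}" if x: "x \<in> insert c S"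
    proof (cases "x = c")
      case True
      then have "f x = g 1" using g(1)[of 0] g(2) by simp
      moreover have "g 1 \<noteq> g i" if "i \<in> {2..<m}" for i
        using inj_onD[OF inj, of 1 i] that by auto
      ultimately show ?thesis by (metis imageE)
    next
      case False
      then have "f x \<in> S" using x assms(2) by auto
      then show ?thesis using set by auto
    qed
    show "u \<subseteq> (\<pi>(c := u)) x" if x: "x \<in> insert c S - E" "f x = g 1"
    proof (cases "x = c")
      case False
      then have "g 1 \<in> S" using x assms(2) by auto
      moreover have "g 1 \<in> - S" using set assms(5) by auto
      ultimately show ?thesis by simp
    qed simp
  qed
  moreover have "\<forall>x \<in> S. (\<pi>(c := u)) x = \<pi> x" using c by auto
  ultimately show ?thesis by (metis insertI2)
qed

end

section \<open>Completing a partial labelling\<close>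

context labelling
begin

lemma partialI_base:
  assumes "inj_on \<pi> S" "\<pi> ` S = D0"
    and "\<And>x. x \<in> S \<Longrightarrow> x \<notin> E \<Longrightarrow> f x \<in> S \<Longrightarrow> f x = x \<or> descends f \<pi> x"
    and "\<And>y. y \<notin> S \<Longrightarrow> f y \<in> S \<Longrightarrow> \<pi> (f y) \<noteq> UNIV"
  shows "partial \<pi> S"
  using assms unfolding partial_def by blast

lemma unused_not_UNIV:
  assumes "partial \<pi> S" "S \<noteq> UNIV" "UNIV \<notin> D0"
  shows "UNIV \<notin> \<pi> ` S"
proof
  assume U: "UNIV \<in> \<pi> ` S"
  obtain B where "lowest \<pi> S B" using ex_lowest[OF partial_inj[OF assms(1)] assms(2)] by blast
  then have B: "B \<notin> \<pi> ` S" by (simp add: lowest_def)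
  then have "CARD('n) \<le> card B" using partial_card_le[OF assms(1) U assms(3)] by blast
  then have "B = UNIV" using card_seteq[of "UNIV :: 'n set" B] by simp
  then show False using B U by simp
qed

text \<open>Fills a gap in a cycle that is already partly planted. Labelled vertices may lead into
  the gap only at its start, and their labels contain \<open>u\<close>.\<close>

lemma insert_cycle_segment:
  fixes c :: 'v
  defines "g \<equiv> \<lambda>i. (f ^^ i) c"
  assumes "partial \<pi> S" "is_cycle f c m" "1 \<le> a" "b \<le> m" "g b \<in> S"
    and "\<And>i. a \<le> i \<Longrightarrow> i < b \<Longrightarrow> g i \<notin> S"
    and "\<And>x i. x \<in> S \<Longrightarrow> a \<le> i \<Longrightarrow> i < b \<Longrightarrow> f x = g i \<Longrightarrow> i = a \<and> u \<subseteq> \<pi> x"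
    and "\<And>w. lowest \<pi> S w \<Longrightarrow> \<not> u \<subseteq> w \<and> k \<le> card w" "avoidable u k"
    and "UNIV \<in> D0 \<or> b - a < card (- S)"
  shows "\<exists>\<pi>'. partial \<pi>' (S \<union> g ` {a..<b}) \<and> (\<forall>x \<in> S. \<pi>' x = \<pi> x)"
proof (cases "a < b")
  case False
  then show ?thesis using assms(2) by (intro exI[of _ \<pi>]) simp
next
  case True
  have inj: "inj_on g {..<m}" using assms(3) by (simp add: is_cycle_def g_def)
  have "S \<noteq> UNIV" using assms(7)[of a] True by auto
  then obtain w where w: "lowest \<pi> S w" using ex_lowest[OF partial_inj[OF assms(2)]] by blast
  then have w': "\<not> u \<subseteq> w" "k \<le> card w" using assms(9) by auto
  show ?thesis
  proof (rule insert_path[where g = g, OF assms(2) _ _ _ _ _ _ w w' assms(11) assms(10) True])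
    show "f (g i) = g (Suc i)" for i by (simp add: g_def)
    show "inj_on g {a..<b}" using inj by (rule inj_on_subset) (use assms(5) in auto)
    show disj: "g ` {a..<b} \<inter> S = {}" using assms(7) by auto
    show "g b \<notin> g ` {a..<b}" using disj assms(6) by blast
    show "f x \<notin> g ` {Suc a..<b}" if "x \<in> S" for x
    proof
      assume "f x \<in> g ` {Suc a..<b}"
      then obtain i where "Suc a \<le> i" "i < b" "f x = g i" by auto
      then show False using assms(8)[OF that, of i] by simp
    qed
    show "u \<subseteq> \<pi> x" if "x \<in> S - E" "f x = g a" for x
      using assms(8)[of x a] that True by simp
  qed
qed

definition completed :: "('v \<Rightarrow> 'n set) \<Rightarrow> bool" where
  "completed \<pi> \<longleftrightarrow> bij \<pi> \<and> ((\<forall>x. x \<notin> E \<longrightarrow> f x = x \<or> descends f \<pi> x)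
     \<or> (\<exists>d. climbs_to_top \<pi> d \<and> (\<forall>x. x \<notin> E \<longrightarrow> x \<noteq> d \<longrightarrow> f x = x \<or> descends f \<pi> x)))"

lemma completed_reach:
  assumes "completed \<pi>" "E \<subseteq> T" "\<And>x. f x = x \<Longrightarrow> x \<in> T"
  shows "\<exists>t \<in> T. (A, \<pi> t) \<in> (label_graph f \<pi>)\<^sup>*"
proof -
  have bij: "bij \<pi>" using assms(1) by (simp add: completed_def)
  consider "\<forall>x. x \<notin> E \<longrightarrow> f x = x \<or> descends f \<pi> x"
    | d where "climbs_to_top \<pi> d" "\<forall>x. x \<notin> E \<longrightarrow> x \<noteq> d \<longrightarrow> f x = x \<or> descends f \<pi> x"
    using assms(1) unfolding completed_def by blast
  then show ?thesis
  proof cases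
    case 1
    then show ?thesis
      using assms(2,3) by (intro reach_below[OF bij_is_surj[OF bij]]) (metis subsetD)
  next
    case 2
    then obtain j where j: "\<pi> d = - {j}" "\<pi> (f d) = UNIV" "f (f d) \<noteq> d" "f (f d) \<noteq> f d"
      unfolding climbs_to_top_def by blast
    show ?thesis
      by (rule reach_over_top[OF bij _ j]) (use 2(2) assms(2,3) in \<open>metis subsetD\<close>)
  qed
qed

lemma completed_full: "partial \<pi> UNIV \<Longrightarrow> completed \<pi>"
  using full_labelling[of \<pi>] by (simp add: completed_def)

end

lemma funpow_in: "f ` S \<subseteq> S \<Longrightarrow> y \<in> S \<Longrightarrow> (f ^^ i) y \<in> S"
  by (induction i) auto

lemma periodic_complement_closed:
  assumes "f ` S \<subseteq> S"
  shows "f ` (periodic f - S) \<subseteq> periodic f - S"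
proof clarify
  fix x assume x: "x \<in> periodic f" "x \<notin> S"
  then obtain k where k: "k > 0" "(f ^^ k) x = x" by (auto simp: periodic_def)
  then obtain j where j: "k = Suc j" by (metis gr0_conv_Suc)
  have "(f ^^ j) (f x) \<notin> S" using k j x(2) by (simp add: funpow_swap1)
  then have "f x \<notin> S" using funpow_in[OF assms, of "f x" j] by auto
  then show "f x \<in> periodic f - S" using periodic_closed[of f] x(1) by auto
qed

context spread_labelling
begin

text \<open>If the full set is not planted, some non-periodic vertex is still unlabelled after the
  cycles, so the cycles never have to use the full set.\<close>

lemma extend_cycles_first:
  assumes "partial \<pi> S" "f ` S \<subseteq> S" "UNIV \<in> D0 \<or> \<not> - S \<subseteq> periodic f"
  shows "\<exists>\<pi>'. partial \<pi>' UNIV \<and> (\<forall>x \<in> S. \<pi>' x = \<pi> x)"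
proof -
  let ?W = "periodic f - S"
  have closed: "f ` ?W \<subseteq> ?W" by (rule periodic_complement_closed[OF assms(2)])
  have "inj_on f ?W" using inj_on_periodic by (rule inj_on_subset) blast
  moreover have "UNIV \<in> D0 \<or> card ?W < card (- S)"
  proof (cases "UNIV \<in> D0")
    case False
    then have "?W \<subset> - S" using assms(3) by blast
    then show ?thesis by (simp add: psubset_card_mono)
  qed simp
  ultimately obtain \<pi>1 where 1: "partial \<pi>1 (S \<union> ?W)" "\<forall>x \<in> S. \<pi>1 x = \<pi> x"
    using insert_cycles[OF assms(1,2) _ closed] by auto
  have "f ` (S \<union> ?W) \<subseteq> S \<union> ?W" using closed assms(2) by blast
  moreover have "\<exists>k. (f ^^ k) y \<in> S \<union> ?W" for y using eventually_periodic[of f y] by blast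
  ultimately obtain \<pi>2 where "partial \<pi>2 UNIV" "\<forall>x \<in> S \<union> ?W. \<pi>2 x = \<pi>1 x"
    using extend_to_all[OF 1(1)] by blast
  then show ?thesis using 1(2) by (intro exI[of _ \<pi>2]) auto
qed

text \<open>Without a non-periodic vertex to take the full set, one cycle of length at least three
  is held back and inserted last.\<close>

lemma extend_over_top:
  assumes "partial \<pi> S" "f ` S \<subseteq> S" "- S \<subseteq> periodic f" "UNIV \<notin> D0"
    and c: "c \<notin> S" "is_cycle f c m" "3 \<le> m"
    and C: "C \<notin> D0" "Suc (card C) = CARD('n)"
  shows "\<exists>\<pi>'. completed \<pi>' \<and> (\<forall>x \<in> S. \<pi>' x = \<pi> x)"
proof -
  have closed: "f ` (- S) \<subseteq> - S"
    using periodic_complement_closed[OF assms(2)] assms(3) by blast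
  have inj: "inj_on f (- S)" using inj_on_periodic assms(3) by (rule inj_on_subset)
  let ?O = "cycle_set f c m"
  let ?W = "- S - ?O"
  have O: "?O \<subseteq> - S" using cycle_set_subset[OF closed] c(1) by simp
  have "c \<in> ?O" using cycle_set_self[OF c(2)] .
  have closedW: "f ` ?W \<subseteq> ?W" using cycle_complement[OF inj closed _ c(2)] c(1) by simp
  have "inj_on f ?W" using inj by (rule inj_on_subset) blast
  moreover have "card ?W < card (- S)" using \<open>c \<in> ?O\<close> c(1) by (intro psubset_card_mono) auto
  ultimately obtain \<pi>1 where 1: "partial \<pi>1 (S \<union> ?W)" "\<forall>x \<in> S. \<pi>1 x = \<pi> x"
    using insert_cycles[OF assms(1,2) _ closedW] by auto
  have "f ` (S \<union> ?W) \<subseteq> S \<union> ?W" using closedW assms(2) by blast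
  moreover have rest: "?O = - (S \<union> ?W)" using O by blast
  moreover have "UNIV \<notin> \<pi>1 ` (S \<union> ?W)"
    using unused_not_UNIV[OF 1(1) _ assms(4)] rest \<open>c \<in> ?O\<close> by blast
  ultimately obtain \<pi>2 d where "bij \<pi>2" "\<forall>x \<in> S \<union> ?W. \<pi>2 x = \<pi>1 x" "climbs_to_top \<pi>2 d"
    "\<forall>x. x \<notin> E \<longrightarrow> x \<noteq> d \<longrightarrow> f x = x \<or> descends f \<pi>2 x"
    using insert_last_cycle[OF 1(1) _ c(2) _ c(3) _ C] by metis
  then show ?thesis using 1(2) unfolding completed_def by (intro exI[of _ \<pi>2]) auto
qed

lemma complete:
  assumes "partial \<pi> S" "f ` S \<subseteq> S" "UNIV \<notin> D0"
    and "S = UNIV \<or> \<not> - S \<subseteq> periodic f \<or> (\<exists>c m. c \<notin> S \<and> is_cycle f c m \<and> 3 \<le> m)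
      \<and> (\<exists>C. C \<notin> D0 \<and> Suc (card C) = CARD('n))"
  shows "\<exists>\<pi>'. completed \<pi>' \<and> (\<forall>x \<in> S. \<pi>' x = \<pi> x)"
proof (cases "S = UNIV")
  case True
  then show ?thesis using assms(1) completed_full by auto
next
  case False
  show ?thesis
  proof (cases "- S \<subseteq> periodic f")
    case True
    then obtain c m C where "c \<notin> S" "is_cycle f c m" "3 \<le> m" "C \<notin> D0" "Suc (card C) = CARD('n)"
      using False assms(4) by blast
    then show ?thesis using extend_over_top[OF assms(1,2) True assms(3)] by blast
  next
    case False
    then show ?thesis using extend_cycles_first[OF assms(1,2)] completed_full by blast
  qed
qed

end

definition has_small_attractor :: "('v \<Rightarrow> 'v) \<Rightarrow> ('v \<Rightarrow> 'n set) \<Rightarrow> bool" where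
  "has_small_attractor f \<pi> \<longleftrightarrow> bij \<pi> \<and> (\<forall>A. (A, {}) \<in> (label_graph f \<pi>)\<^sup>*)
     \<and> (\<exists>X. trap_set (label_graph f \<pi>) X \<and> {} \<in> X \<and> card X \<le> 4)"

lemma trap_set_label_graph:
  assumes "inj \<pi>" "X = \<pi> ` V" "V \<noteq> {}"
    and "\<And>v i. v \<in> V \<Longrightarrow> i \<in> \<pi> v \<Longrightarrow> i \<notin> \<pi> (f v) \<Longrightarrow> \<pi> v - {i} \<in> X"
    and "\<And>v i. v \<in> V \<Longrightarrow> i \<notin> \<pi> v \<Longrightarrow> i \<in> \<pi> (f v) \<Longrightarrow> insert i (\<pi> v) \<in> X"
  shows "trap_set (label_graph f \<pi>) X"
proof -
  have "B \<in> X" if v: "v \<in> V" and arc: "(\<pi> v, B) \<in> label_graph f \<pi>" for v B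
  proof -
    obtain i where i: "(i \<in> \<pi> (f v)) \<noteq> (i \<in> \<pi> v)"
      "B = (if i \<in> \<pi> v then \<pi> v - {i} else insert i (\<pi> v))"
      using arc label_graph_iff[OF assms(1)] by metis
    then show ?thesis using assms(4,5)[OF v, of i] by (cases "i \<in> \<pi> v") auto
  qed
  then show ?thesis unfolding trap_set_def assms(2) using assms(2,3) by blast
qed

text \<open>Any set of size \<open>l\<close> that omits one chosen element of \<open>u\<close> will
  do, as \<open>D0\<close> has no set of that size.\<close>

lemma ex_avoiding_subset:
  fixes u :: "'n::finite set"
  assumes "u \<noteq> {}" "l < CARD('n)" "\<And>w. w \<in> D0 \<Longrightarrow> card w \<noteq> l"
  shows "\<exists>w. w \<notin> D0 \<and> card w = l \<and> \<not> u \<subseteq> w"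
proof -
  obtain i where i: "i \<in> u" using assms(1) by blast
  have "l \<le> card (- {i})" using assms(2) by (simp add: card_compl)
  then obtain w where "w \<subseteq> - {i}" "card w = l" by (metis obtain_subset_with_card_n)
  then show ?thesis using i assms(3) by blast
qed

lemma card_coatom: "Suc (card (- {j})) = CARD('n)" for j :: "'n::finite"
  by (simp add: card_compl)

lemma length_one_cycle: "is_cycle f c 1 \<longleftrightarrow> f c = c"
  by (auto simp: is_cycle_def inj_on_def)

lemma length_two_cycle: "is_cycle f c 2 \<Longrightarrow> f (f c) = c"
  by (simp add: is_cycle_def numeral_2_eq_2)

lemma cycle_length_le: "is_cycle f c m \<Longrightarrow> m \<le> CARD('v)" for c :: "'v::finite"
  using card_cycle_set[of f c m] card_mono[of UNIV "cycle_set f c m"] by simp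

section \<open>Maps with a fixed point\<close>

text \<open>The question is who takes the full set: a second fixed point if \<open>f\<close> is a
  permutation with one, otherwise a non-periodic vertex, otherwise a cycle of length at least three.
  The latter exists because \<open>2 ^ n - 1\<close> is odd.\<close>

lemma fixed_point_case:
  fixes f :: "'v::finite \<Rightarrow> 'v"
  assumes card: "CARD('v) = 2 ^ CARD('n::finite)" and z: "f z = z"
  shows "\<exists>\<pi> :: 'v \<Rightarrow> 'n set. bij \<pi> \<and>
    (\<forall>A. \<exists>t \<in> fixed_points f. (A, \<pi> t) \<in> (label_graph f \<pi>)\<^sup>*)"
proof (cases "periodic f = UNIV \<and> (\<exists>z'. z' \<noteq> z \<and> f z' = z')")
  case True
  then obtain z' where z': "z' \<noteq> z" "f z' = z'" by blast
  interpret spread_labelling f "{{}, UNIV :: 'n set}" "{}"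
  proof unfold_locales
    fix u :: "'n set" and l assume "u \<notin> {{}, UNIV}" "card u < l" "l < CARD('n)"
    then show "\<exists>w. w \<notin> {{}, UNIV} \<and> card w = l \<and> \<not> u \<subseteq> w"
      by (intro ex_avoiding_subset) auto
  qed (use card in auto)
  have inj: "inj f" using inj_on_periodic[of f] True by simp
  have "partial ((\<lambda>_. UNIV)(z := {})) {z, z'}"
  proof (rule partialI_base)
    fix y assume "y \<notin> {z, z'}" "f y \<in> {z, z'}"
    \<comment> \<open>In a permutation \<open>z'\<close> has no preimage besides itself, so no
      unlabelled vertex maps to the carrier of \<open>UNIV\<close>.\<close>
    then show "((\<lambda>_. UNIV)(z := {})) (f y) \<noteq> UNIV" using injD[OF inj, of y z'] z z' by auto
  qed (use z z' in auto)
  then obtain \<pi> where \<pi>: "partial \<pi> UNIV" using extend_cycles_first z z' by fastforce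
  have "\<exists>t \<in> fixed_points f. (A, \<pi> t) \<in> (label_graph f \<pi>)\<^sup>*" for A
    using completed_reach[OF completed_full[OF \<pi>], of "fixed_points f"] by (simp add: fixed_points_def)
  then show ?thesis using full_labelling(1)[OF \<pi>] by blast
next
  case False
  interpret spread_labelling f "{{} :: 'n set}" "{}"
  proof unfold_locales
    fix u :: "'n set" and l assume "u \<notin> {{}}" "card u < l" "l < CARD('n)"
    then show "\<exists>w. w \<notin> {{}} \<and> card w = l \<and> \<not> u \<subseteq> w"
      by (intro ex_avoiding_subset) auto
  qed (use card in auto)
  have base: "partial (\<lambda>_. {}) {z}"
    by (rule partialI_base) (use z in auto)
  have "{z} = UNIV \<or> \<not> - {z} \<subseteq> periodic f \<or> (\<exists>c m. c \<notin> {z} \<and> is_cycle f c m \<and> 3 \<le> m)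
      \<and> (\<exists>C :: 'n set. C \<notin> {{}} \<and> Suc (card C) = CARD('n))"
  proof (cases "- {z} \<subseteq> periodic f")
    case perm: True
    have "z \<in> periodic f" using z unfolding periodic_def by (auto intro: exI[of _ 1])
    then have "x \<in> periodic f" for x using subsetD[OF perm, of x] by (cases "x = z") auto
    then have "periodic f = UNIV" by auto
    then have inj: "inj f" and nofix: "\<And>x. f x = x \<Longrightarrow> x = z"
      using inj_on_periodic[of f] False by auto
    have closed: "f ` (- {z}) \<subseteq> - {z}" using injD[OF inj, of _ z] z by auto
    have "odd (card (- {z}))" using card by (simp add: card_compl)
    then have "\<not> (\<forall>c m. c \<in> - {z} \<longrightarrow> is_cycle f c m \<longrightarrow> m = 2)"
      using cycle_lengths_dvd_card[of "- {z}" f 2] closed inj by (meson finite inj_on_subset subset_UNIV)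
    then obtain c m where c: "c \<noteq> z" "is_cycle f c m" "m \<noteq> 2" by auto
    have "m \<noteq> 1" using c nofix length_one_cycle by metis
    then have "3 \<le> m" using c by (auto simp: is_cycle_def)
    have "CARD('n) \<noteq> 1"
      using cycle_length_le[OF c(2)] \<open>3 \<le> m\<close> card by auto
    then have "- {undefined :: 'n} \<notin> {{}}"
      using card_coatom[of "undefined :: 'n"] by auto
    then have "\<exists>C :: 'n set. C \<notin> {{}} \<and> Suc (card C) = CARD('n)"
      using card_coatom[of "undefined :: 'n"] by (intro exI conjI)
    moreover have "\<exists>c m. c \<notin> {z} \<and> is_cycle f c m \<and> 3 \<le> m" using c \<open>3 \<le> m\<close> by auto
    ultimately show ?thesis by (intro disjI2 conjI)
  qed blast
  then obtain \<pi> where \<pi>: "completed \<pi>" using complete[OF base] z by auto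
  have "\<exists>t \<in> fixed_points f. (A, \<pi> t) \<in> (label_graph f \<pi>)\<^sup>*" for A
    using completed_reach[OF \<pi>, of "fixed_points f"] by (simp add: fixed_points_def)
  then show ?thesis using \<pi> unfolding completed_def by blast
qed


section \<open>Maps with a 2-cycle and no fixed point\<close>

lemma two_cycle_attractor:
  assumes "bij \<pi>" "\<And>A. (A, {}) \<in> (label_graph f \<pi>)\<^sup>*"
    and "\<pi> z = {}" "\<pi> z' = {i}" "f z = z'" "f z' = z"
  shows "has_small_attractor f \<pi>"
proof -
  have "trap_set (label_graph f \<pi>) {{}, {i}}"
    by (rule trap_set_label_graph[where V = "{z, z'}", OF bij_is_inj[OF assms(1)]])
      (use assms(3-6) in auto)
  then show ?thesis using assms(1,2) unfolding has_small_attractor_def by (auto intro!: exI[of _ "{{}, {i}}"])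
qed

lemma reach_empty_label:
  fixes \<pi> :: "'v \<Rightarrow> 'n::finite set"
  assumes "bij \<pi>" "\<pi> z = {}"
    and "\<And>x. x \<noteq> z \<Longrightarrow> descends f \<pi> x \<or> (\<pi> x, {}) \<in> (label_graph f \<pi>)\<^sup>*"
  shows "(A, {}) \<in> (label_graph f \<pi>)\<^sup>*"
  using reach_below[OF bij_is_surj[OF assms(1)], of A "{z}" f] assms(2,3) by auto

lemma bij_of_inj:
  fixes \<pi> :: "'v::finite \<Rightarrow> 'n::finite set"
  assumes "CARD('v) = 2 ^ CARD('n)" "inj \<pi>"
  shows "bij \<pi>"
proof -
  have "card (range \<pi>) = CARD('n set)"
    using assms by (simp add: card_image card_Pow flip: Pow_UNIV)
  then have "range \<pi> = UNIV" by (metis card_subset_eq finite subset_UNIV)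
  then show ?thesis using assms(2) by (simp add: bij_def)
qed

text \<open>In dimension two the bound 4 is the number of all labels, so only reachability of the
  empty set matters.\<close>

lemma small_attractor_two_dim:
  fixes \<pi> :: "'v \<Rightarrow> 'n::finite set"
  assumes "CARD('n) = 2" "bij \<pi>" "\<And>A. (A, {}) \<in> (label_graph f \<pi>)\<^sup>*"
  shows "has_small_attractor f \<pi>"
proof -
  have "trap_set (label_graph f \<pi>) UNIV" by (simp add: trap_set_def)
  moreover have "CARD('n set) = 4" using assms(1) by (simp add: card_Pow flip: Pow_UNIV)
  ultimately show ?thesis using assms(2,3) unfolding has_small_attractor_def
    by (intro conjI exI[of _ UNIV]) auto
qed

lemma ex_three_elements:
  assumes "3 \<le> CARD('n::finite)"
  shows "\<exists>i j k :: 'n. i \<noteq> j \<and> j \<noteq> k \<and> i \<noteq> k"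
proof -
  obtain A :: "'n set" where "card A = 3" using assms by (metis obtain_subset_with_card_n)
  then show ?thesis by (auto simp: card_3_iff)
qed

text \<open>Labels of size two in the initial part are only \<open>{i, j}\<close> and \<open>{j, k}\<close>, so \<open>{i, k}\<close> stays free.\<close>

lemma ex_avoiding_three:
  fixes u :: "'n::finite set"
  assumes ijk: "i \<noteq> j" "j \<noteq> k" "i \<noteq> k" and l: "2 \<le> l" "l < CARD('n)"
    and D0: "D0 \<subseteq> {{}, {i}, {j}, {k}, {i, j}, {j, k}, UNIV}"
    and u: "u \<noteq> {}" "l = 2 \<Longrightarrow> \<not> u \<subseteq> {i, k}"
  shows "\<exists>w. w \<notin> D0 \<and> card w = l \<and> \<not> u \<subseteq> w"
proof (cases "l = 2")
  case True
  have "{i, k} \<noteq> UNIV" using ijk by auto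
  then have "{i, k} \<notin> D0" using D0 ijk by (auto simp: doubleton_eq_iff)
  then show ?thesis using True ijk u(2) by (intro exI[of _ "{i, k}"]) auto
next
  case False
  have "card w \<noteq> l" if "w \<in> D0" for w
    using D0 that ijk l False by (auto simp: card_insert_if)
  then show ?thesis using ex_avoiding_subset[OF u(1) l(2)] by blast
qed

text \<open>Serves all the larger planted families, which are parts of the seven path labels. Only
  the pair \<open>{j, k}\<close> asks for the extra member \<open>{k}\<close>.\<close>

lemma down_closed_three:
  assumes D0: "D0 \<subseteq> {{}, {i}, {j}, {k}, {i, j}, {j, k}, UNIV}" "{{}, {i}, {j}} \<subseteq> D0"
      "{j, k} \<in> D0 \<Longrightarrow> {k} \<in> D0"
    and "B \<in> D0" "A \<subseteq> B" "B \<noteq> UNIV"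
  shows "A \<in> D0"
proof -
  have two: "A \<in> {{}, {x}, {y}, {x, y}}" if "A \<subseteq> {x, y}" for x y
    using that by (cases "x \<in> A"; cases "y \<in> A") auto
  have "B \<in> {{}, {i}, {j}, {k}, {i, j}, {j, k}}" using subsetD[OF D0(1) assms(4)] assms(6) by simp
  then consider "B = {}" | x where "B = {x}" | "B = {i, j}" | "B = {j, k}" by blast
  then show ?thesis
  proof cases
    case 2
    then have "A = {} \<or> A = B" using assms(5) by auto
    then show ?thesis using assms(4) D0(2) by auto
  next
    case 3
    then show ?thesis using two[of i j] assms(4,5) D0(2) by auto
  next
    case 4
    then show ?thesis using two[of j k] assms(4,5) D0(2,3) by auto
  qed (use assms in auto)
qed

text \<open>A new singleton is neither \<open>{i}\<close> nor \<open>{k}\<close> and so is not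
  contained in the free pair \<open>{i, k}\<close>. This is the purpose of planting
  \<open>{k}\<close>.\<close>

lemma ex_avoiding_spread:
  fixes u :: "'n::finite set"
  assumes ijk: "i \<noteq> j" "j \<noteq> k" "i \<noteq> k"
    and D0: "D0 \<subseteq> {{}, {i}, {j}, {k}, {i, j}, {j, k}, UNIV}" "{{}, {i}, {k}} \<subseteq> D0"
    and u: "u \<notin> D0" "card u < l" "l < CARD('n)"
  shows "\<exists>w. w \<notin> D0 \<and> card w = l \<and> \<not> u \<subseteq> w"
proof (rule ex_avoiding_three[OF ijk _ u(3) D0(1)])
  have ne: "u \<noteq> {}" using u(1) D0(2) by auto
  then have "card u \<noteq> 0" by simp
  then show "2 \<le> l" using u(2) by linarith
  show "\<not> u \<subseteq> {i, k}" if "l = 2"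
  proof
    assume "u \<subseteq> {i, k}"
    moreover have "card u = 1" using that u(2) \<open>card u \<noteq> 0\<close> by linarith
    then obtain x where "u = {x}" by (rule card_1_singletonE)
    ultimately show False using u(1) D0(2) by auto
  qed
qed (use u(1) D0(2) in auto)

lemma ex_coatom_three:
  fixes i j k :: "'n::finite"
  assumes ijk: "i \<noteq> j" "j \<noteq> k" "i \<noteq> k" and "3 \<le> CARD('n)"
    and D0: "D0 \<subseteq> {{}, {i}, {j}, {k}, {i, j}, {j, k}, UNIV}"
  shows "\<exists>C. C \<notin> D0 \<and> Suc (card C) = CARD('n)"
proof -
  \<comment> \<open>With \<open>u = UNIV\<close> non-containment is automatic for proper subsets, so
    this only asks for a coatom outside \<open>D0\<close>.\<close>
  obtain w where "w \<notin> D0" "card w = CARD('n) - 1"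
    using ex_avoiding_three[OF ijk _ _ D0, of "CARD('n) - 1" UNIV] assms(4) ijk by fastforce
  then show ?thesis using assms(4) by (intro exI[of _ w]) auto
qed

text \<open>With 2-cycles only, no vertex can satisfy \<open>climbs_to_top\<close>. In dimension at
  least three the full set is planted opposite \<open>{j}\<close> instead: \<open>{j}\<close> climbs
  to \<open>{i, j}\<close>, whose partner \<open>{k}\<close> lets it drop to \<open>{i}\<close> and
  from there to the empty set.\<close>

lemma involution_case:
  fixes f :: "'v::finite \<Rightarrow> 'v"
  assumes card: "CARD('v) = 2 ^ CARD('n::finite)" and inv: "\<And>x. f (f x) = x" "\<And>x. f x \<noteq> x"
  shows "\<exists>\<pi> :: 'v \<Rightarrow> 'n set. has_small_attractor f \<pi>"
proof -
  have eq: "f x = f y \<longleftrightarrow> x = y" for x y using inv(1) by metis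
  have eq': "f x = y \<longleftrightarrow> x = f y" for x y using inv(1) by metis
  fix z :: 'v
  consider "CARD('n) = 1" | "CARD('n) = 2" | "3 \<le> CARD('n)"
    using zero_less_card_finite[where 'a = 'n] by linarith
  then show ?thesis
  proof cases
    case 1
    then obtain i :: 'n where i: "UNIV = {i}" by (metis card_1_singletonE)
    have "card {z, f z} = CARD('v)" using inv(2)[of z] 1 card by simp
    then have S: "{z, f z} = UNIV" by (metis card_subset_eq finite subset_UNIV)
    define \<pi> where "\<pi> = (\<lambda>x. if x = z then {} else {i})"
    have "inj_on \<pi> {z, f z}" using inv(2)[of z] by (auto simp: \<pi>_def)
    then have bij: "bij \<pi>" unfolding S using card by (intro bij_of_inj)
    have "descends f \<pi> x" if "x \<noteq> z" for x
    proof -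
      have "x = f z" using that S by blast
      then show ?thesis using that inv(1) by (simp add: descends_def \<pi>_def)
    qed
    then have "(A, {}) \<in> (label_graph f \<pi>)\<^sup>*" for A
      by (intro reach_empty_label[OF bij, of z]) (auto simp: \<pi>_def)
    then show ?thesis
      using two_cycle_attractor[OF bij, of f z "f z" i] inv by (auto simp: \<pi>_def)
  next
    case 2
    then obtain i j :: 'n where ij: "UNIV = {i, j}" "i \<noteq> j" by (metis card_2_iff)
    have "card {z, f z} \<noteq> CARD('v)" using inv(2)[of z] 2 card by simp
    then obtain c where c: "c \<noteq> z" "c \<noteq> f z" by (metis UNIV_eq_I insertCI)
    have dist: "f z \<noteq> z" "f c \<noteq> c" "f c \<noteq> z" "f c \<noteq> f z"
      using inv c by metis+
    then have "card {z, f z, c, f c} = CARD('v)" using c 2 card by auto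
    then have S: "{z, f z, c, f c} = UNIV" by (metis card_subset_eq finite subset_UNIV)
    \<comment> \<open>\<open>c\<close> and \<open>f c\<close> get incomparable labels and
      \<open>f z\<close> maps to the carrier of the empty set, so all vertices but \<open>z\<close>
      descend.\<close>
    define \<pi> where "\<pi> = (\<lambda>x. if x = z then {} else if x = c then {i} else if x = f c then {j} else {i, j})"
    have \<pi>: "\<pi> z = {}" "\<pi> c = {i}" "\<pi> (f c) = {j}" "\<pi> (f z) = {i, j}"
      using c dist by (auto simp: \<pi>_def)
    have "inj_on \<pi> {z, f z, c, f c}" using ij(2) by (auto simp: \<pi>)
    then have bij: "bij \<pi>" unfolding S using card by (intro bij_of_inj)
    have "descends f \<pi> x" if "x \<noteq> z" for x
    proof -
      have "x = f z \<or> x = c \<or> x = f c" using that S by blast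
      then show ?thesis using ij(2) inv(1) by (auto simp: descends_def \<pi>)
    qed
    then have "(A, {}) \<in> (label_graph f \<pi>)\<^sup>*" for A
      by (intro reach_empty_label[OF bij, of z]) (auto simp: \<pi>)
    then show ?thesis using small_attractor_two_dim[OF 2 bij] by blast
  next
    case 3
    then obtain i j k :: 'n where ijk: "i \<noteq> j" "j \<noteq> k" "i \<noteq> k" using ex_three_elements by blast
    have cardV: "8 \<le> CARD('v)" using card power_increasing[OF 3, of "2::nat"] by simp
    have "card {z, f z} \<noteq> CARD('v)" using inv(2)[of z] cardV by simp
    then obtain c where c: "c \<noteq> z" "c \<noteq> f z" by (metis UNIV_eq_I insertCI)
    have "card {z, f z, c, f c} \<le> 4" by (simp add: card_insert_if)
    then have "{z, f z, c, f c} \<noteq> UNIV" using cardV by auto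
    then obtain v where v: "v \<noteq> z" "v \<noteq> f z" "v \<noteq> c" "v \<noteq> f c" by blast
    have dist: "f z \<noteq> z" "f c \<noteq> c" "f c \<noteq> z" "f c \<noteq> f z" "f v \<noteq> v" "f v \<noteq> z" "f v \<noteq> f z"
      "f v \<noteq> c" "f v \<noteq> f c"
      using inv c v by metis+
    let ?D0 = "{{}, {i}, {j}, {k}, {i, j}, UNIV}"
    interpret spread_labelling f ?D0 "{z, c}"
    proof unfold_locales
      fix A B :: "'n set" assume "B \<in> ?D0" "A \<subseteq> B" "B \<noteq> UNIV"
      then show "A \<in> ?D0" by (rule down_closed_three[of ?D0 i j k, rotated 3]) auto
    next
      fix u :: "'n set" and l assume u: "u \<notin> ?D0" "card u < l" "l < CARD('n)"
      then show "\<exists>w. w \<notin> ?D0 \<and> card w = l \<and> \<not> u \<subseteq> w"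
        by (intro ex_avoiding_spread[OF ijk _ _ u]) auto
    qed (use card in auto)
    define \<pi>0 where "\<pi>0 = (\<lambda>x. if x = z then {} else if x = f z then {i} else if x = c then {j}
      else if x = f c then UNIV else if x = v then {i, j} else {k})"
    have \<pi>0: "\<pi>0 z = {}" "\<pi>0 (f z) = {i}" "\<pi>0 c = {j}" "\<pi>0 (f c) = UNIV" "\<pi>0 v = {i, j}" "\<pi>0 (f v) = {k}"
      using c v dist by (auto simp: \<pi>0_def)
    let ?S = "{z, f z, c, f c, v, f v}"
    have UNIV_neq: "UNIV \<noteq> {i, j}" "UNIV \<noteq> {x}" for x :: 'n
      using ijk by (metis UNIV_I insertE singletonD)+
    have base: "partial \<pi>0 ?S"
    proof (rule partialI_base)
      show "inj_on \<pi>0 ?S" using ijk UNIV_neq by (auto simp: \<pi>0)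
      show "\<pi>0 ` ?S = ?D0" by (auto simp: \<pi>0)
      show "f x = x \<or> descends f \<pi>0 x" if "x \<in> ?S" "x \<notin> {z, c}" for x
      proof -
        have "x = f z \<or> x = f c \<or> x = v \<or> x = f v" using that by auto
        then show ?thesis using ijk UNIV_neq(2)[of j] inv(1) by (auto simp: \<pi>0 descends_def)
      qed
      show "\<pi>0 (f y) \<noteq> UNIV" if "y \<notin> ?S" "f y \<in> ?S" for y
        using that eq' inv(1) by auto
    qed
    have closed: "f ` ?S \<subseteq> ?S" using inv(1) by auto
    obtain \<pi> where full: "partial \<pi> UNIV" and "\<forall>x \<in> ?S. \<pi> x = \<pi>0 x"
      using extend_cycles_first[OF base closed] by blast
    then have \<pi>: "\<pi> z = {}" "\<pi> (f z) = {i}" "\<pi> c = {j}" "\<pi> (f c) = UNIV" "\<pi> v = {i, j}" "\<pi> (f v) = {k}"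
      using \<pi>0 by auto
    let ?G = "label_graph f \<pi>"
    have "({j}, {i, j}) \<in> ?G" using label_graph_up[of i \<pi> c f] ijk by (simp add: \<pi>)
    moreover have "({i, j}, {i}) \<in> ?G"
      using label_graph_down[of j \<pi> v f] ijk by (simp add: \<pi> insert_Diff_if)
    moreover have "({i}, {}) \<in> ?G" using label_graph_down[of i \<pi> "f z" f] inv(1) by (simp add: \<pi>)
    ultimately have "(\<pi> c, {}) \<in> ?G\<^sup>*" unfolding \<pi> by (meson r_into_rtrancl rtrancl_trans)
    then have reach: "(A, {}) \<in> ?G\<^sup>*" for A
      using full_labelling[OF full] inv(2)
      by (intro reach_empty_label[of \<pi> z f, OF _ \<pi>(1)]) (blast, metis empty_iff insert_iff)
    show ?thesis
      using two_cycle_attractor[OF full_labelling(1)[OF full] reach \<pi>(1,2)] inv(1) by blast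
  qed
qed

lemma periodic_is_cycle:
  fixes x :: "'v::finite"
  assumes "x \<in> periodic f"
  shows "\<exists>m. is_cycle f x m"
  by (rule obtain_cycle[OF inj_on_periodic periodic_closed assms]) auto

lemma cycle_disjoint:
  assumes "f ` S \<subseteq> S" "x \<notin> S" "is_cycle f x m"
  shows "cycle_set f x m \<inter> S = {}"
proof (rule ccontr)
  assume "cycle_set f x m \<inter> S \<noteq> {}"
  then obtain y k where y: "y \<in> S" "y = (f ^^ k) x" "k < m" by (auto simp: cycle_set_def)
  have "(f ^^ (m - k)) y = (f ^^ (m - k + k)) x" by (simp add: y(2) funpow_add)
  then have "(f ^^ (m - k)) y = x" using y(3) assms(3) by (simp add: is_cycle_def)
  then show False using funpow_in[OF assms(1) y(1), of "m - k"] assms(2) by simp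
qed

text \<open>A vertex with \<open>f (f x) \<noteq> x\<close> is either non-periodic or on a cycle of
  length at least three; in both cases there is a place for the full set away from the planted
  2-cycle.\<close>

lemma two_cycle_case:
  fixes f :: "'v::finite \<Rightarrow> 'v"
  assumes card: "CARD('v) = 2 ^ CARD('n::finite)" and nofix: "\<And>x. f x \<noteq> x" and z: "f (f z) = z"
  shows "\<exists>\<pi> :: 'v \<Rightarrow> 'n set. has_small_attractor f \<pi>"
proof (cases "\<forall>x. f (f x) = x")
  case True
  then show ?thesis using involution_case[OF card] nofix by blast
next
  case False
  then obtain x where x: "f (f x) \<noteq> x" by blast
  let ?S = "{z, f z}"
  have "x \<noteq> z" "x \<noteq> f z" using x z by auto
  then have "card {z, f z, x} = 3" using nofix[of z] by auto
  then have "3 \<le> CARD('v)" by (metis card_mono finite subset_UNIV)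
  then have n: "CARD('n) \<noteq> 1" using card by auto
  fix i :: 'n
  have UNIV_neq: "UNIV \<noteq> {i}" using n by (metis card_1_singleton_iff One_nat_def)
  interpret spread_labelling f "{{}, {i}}" "{z}"
  proof unfold_locales
    fix A B :: "'n set" assume "B \<in> {{}, {i}}" "A \<subseteq> B"
    then show "A \<in> {{}, {i}}" by auto
  next
    fix u :: "'n set" and l assume u: "u \<notin> {{}, {i}}" "card u < l" "l < CARD('n)"
    then have "card u \<noteq> 0" by simp
    then show "\<exists>w. w \<notin> {{}, {i}} \<and> card w = l \<and> \<not> u \<subseteq> w"
      using u by (intro ex_avoiding_subset) auto
  qed (use card in auto)
  define \<pi>0 where "\<pi>0 = (\<lambda>x. if x = z then {} else {i})"
  have \<pi>0: "\<pi>0 z = {}" "\<pi>0 (f z) = {i}" using nofix by (auto simp: \<pi>0_def)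
  have base: "partial \<pi>0 ?S"
  proof (rule partialI_base)
    show "\<pi>0 (f y) \<noteq> UNIV" for y using UNIV_neq by (auto simp: \<pi>0_def)
  qed (use z in \<open>auto simp: \<pi>0 descends_def\<close>)
  have closed: "f ` ?S \<subseteq> ?S" using z by auto
  have "?S = UNIV \<or> \<not> - ?S \<subseteq> periodic f \<or> (\<exists>c m. c \<notin> ?S \<and> is_cycle f c m \<and> 3 \<le> m)
      \<and> (\<exists>C :: 'n set. C \<notin> {{}, {i}} \<and> Suc (card C) = CARD('n))"
  proof (cases "- ?S \<subseteq> periodic f")
    case True
    then have "x \<in> periodic f" using \<open>x \<noteq> z\<close> \<open>x \<noteq> f z\<close> by auto
    then obtain m where m: "is_cycle f x m"
      using periodic_is_cycle by metis
    have "m \<noteq> 1" using m nofix length_one_cycle by metis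
    moreover have "m \<noteq> 2" using m x length_two_cycle by metis
    ultimately have "3 \<le> m" using m by (auto simp: is_cycle_def)
    have "?S \<inter> cycle_set f x m = {}"
      using cycle_disjoint[OF closed _ m] \<open>x \<noteq> z\<close> \<open>x \<noteq> f z\<close> by blast
    then have "card (?S \<union> cycle_set f x m) = 2 + m"
      using card_cycle_set[OF m] nofix[of z] by (subst card_Un_disjoint) auto
    \<comment> \<open>Five vertices force dimension at least three, where a coatom cannot be one of
      the planted labels.\<close>
    then have "5 \<le> CARD('v)"
      using \<open>3 \<le> m\<close> card_mono[of UNIV "?S \<union> cycle_set f x m"] by simp
    then have "CARD('n) \<noteq> 2" using card by auto
    then have "3 \<le> CARD('n)" using n zero_less_card_finite[where 'a = 'n] by linarith
    then have "card (- {i}) \<noteq> 0" "card (- {i}) \<noteq> 1" using card_coatom[of i] by linarith+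
    then have "- {i} \<notin> {{}, {i}}" by (metis One_nat_def card.empty card_1_singleton_iff insertE singletonD)
    then have "\<exists>C :: 'n set. C \<notin> {{}, {i}} \<and> Suc (card C) = CARD('n)"
      using card_coatom[of i] by (intro exI conjI)
    moreover have "\<exists>c m. c \<notin> ?S \<and> is_cycle f c m \<and> 3 \<le> m"
      using m \<open>3 \<le> m\<close> \<open>x \<noteq> z\<close> \<open>x \<noteq> f z\<close> by auto
    ultimately show ?thesis by (intro disjI2 conjI)
  qed blast
  then obtain \<pi> where \<pi>: "completed \<pi>" and "\<forall>x \<in> ?S. \<pi> x = \<pi>0 x"
    using complete[OF base closed] UNIV_neq by auto
  then have lab: "\<pi> z = {}" "\<pi> (f z) = {i}" using \<pi>0 by auto
  have "(A, {}) \<in> (label_graph f \<pi>)\<^sup>*" for A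
    using completed_reach[OF \<pi>, of "{z}" A] nofix lab by auto
  moreover have "bij \<pi>" using \<pi> by (simp add: completed_def)
  ultimately show ?thesis using two_cycle_attractor[OF _ _ lab refl z] by blast
qed

section \<open>The path attractor and permutations without short cycles\<close>

text \<open>No arc leaves the path: the empty set goes to \<open>{i}\<close> or \<open>{j}\<close>,
  \<open>{i}\<close> goes back, \<open>{j}\<close> goes to the empty set or \<open>{j, k}\<close>,
  and \<open>{j, k}\<close> returns to \<open>{j}\<close>. The vertex \<open>q\<close> need not
  descend, since its climb to \<open>{j, k}\<close> already ends in the path.\<close>

lemma path_attractor:
  fixes \<pi> :: "'v \<Rightarrow> 'n::finite set"
  assumes ijk: "i \<noteq> j" "j \<noteq> k" "i \<noteq> k" and "bij \<pi>"
    and \<pi>: "\<pi> b = {}" "\<pi> a = {i}" "\<pi> c = {j}" "\<pi> d = {j, k}" "\<pi> p = {i, j}" "\<pi> q = {k}"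
    and f: "f a = b" "f b = p" "f d = c" "f c = q" "j \<in> \<pi> (f q)"
    and down: "\<And>x. x \<noteq> b \<Longrightarrow> x \<noteq> q \<Longrightarrow> descends f \<pi> x"
  shows "has_small_attractor f \<pi>"
proof -
  let ?G = "label_graph f \<pi>"
  have "({k}, {j, k}) \<in> ?G" using label_graph_up[of j \<pi> q f] ijk f by (simp add: \<pi>)
  moreover have "({j, k}, {j}) \<in> ?G"
    using label_graph_down[of k \<pi> d f] ijk f by (simp add: \<pi> insert_Diff_if)
  moreover have "({j}, {}) \<in> ?G" using label_graph_down[of j \<pi> c f] f ijk by (simp add: \<pi>)
  ultimately have "(\<pi> q, {}) \<in> ?G\<^sup>*" unfolding \<pi> by (meson r_into_rtrancl rtrancl_trans)
  then have reach: "(A, {}) \<in> ?G\<^sup>*" for A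
    using down by (intro reach_empty_label[of \<pi> b f, OF assms(4) \<pi>(1)]) fast
  have "trap_set ?G {{}, {i}, {j}, {j, k}}"
  proof (rule trap_set_label_graph[where V = "{a, b, c, d}", OF bij_is_inj[OF assms(4)]])
    show "{{}, {i}, {j}, {j, k}} = \<pi> ` {a, b, c, d}" by (auto simp: \<pi>)
    fix v x assume "v \<in> {a, b, c, d}"
    then have v: "v = a \<or> v = b \<or> v = c \<or> v = d" by simp
    show "\<pi> v - {x} \<in> {{}, {i}, {j}, {j, k}}" if "x \<in> \<pi> v" "x \<notin> \<pi> (f v)"
      using v that f ijk by (elim disjE) (auto simp: \<pi>)
    show "insert x (\<pi> v) \<in> {{}, {i}, {j}, {j, k}}" if "x \<notin> \<pi> v" "x \<in> \<pi> (f v)"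
      using v that f ijk by (elim disjE) (auto simp: \<pi>)
  qed simp
  moreover have "card {{}, {i}, {j}, {j, k}} \<le> 4" by (simp add: card_insert_if)
  ultimately show ?thesis using assms(4) reach unfolding has_small_attractor_def
    by (intro conjI allI exI[of _ "{{}, {i}, {j}, {j, k}}"]) auto
qed

abbreviation path_labels :: "'n \<Rightarrow> 'n \<Rightarrow> 'n \<Rightarrow> 'n set set" where
  "path_labels i j k \<equiv> {{}, {i}, {j}, {k}, {i, j}, {j, k}, UNIV}"

text \<open>Plants two strands, \<open>a, b, p\<close> and \<open>d, c, q, t\<close>. The
  alternatives for \<open>f p\<close> and \<open>f t\<close> let the strands lie on one cycle or
  close up as a triangle and a square, and \<open>p\<close> and \<open>t\<close> still
  descend.\<close>

lemma path_base:
  fixes f :: "'v::finite \<Rightarrow> 'v" and i j k :: "'n::finite" and a b p d c q t :: 'v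
  defines "E \<equiv> {b, q}" and "S \<equiv> {a, b, p, d, c, q, t}" and "D0 \<equiv> path_labels i j k"
  assumes card: "CARD('v) = 2 ^ CARD('n)" and ijk: "i \<noteq> j" "j \<noteq> k" "i \<noteq> k"
    and dist: "distinct [a, b, p, d, c, q, t]"
    and f: "f a = b" "f b = p" "f d = c" "f c = q" "f q = t"
    and fp: "f p \<in> {a, d} \<or> f p \<notin> S" and ft: "f t = d \<or> f t \<notin> S"
    and pre: "\<And>y. y \<notin> S \<Longrightarrow> f y \<noteq> t"
  shows "spread_labelling TYPE('v) D0"
    and "\<exists>\<pi>. labelling.partial f D0 E \<pi> S \<and> \<pi> b = {} \<and> \<pi> a = {i} \<and> \<pi> c = {j} \<and> \<pi> d = {j, k}
      \<and> \<pi> p = {i, j} \<and> \<pi> q = {k} \<and> \<pi> t = UNIV"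
proof -
  show spr: "spread_labelling TYPE('v) D0"
  proof unfold_locales
    fix A B :: "'n set" assume "B \<in> D0" "A \<subseteq> B" "B \<noteq> UNIV"
    then show "A \<in> D0" by (rule down_closed_three[of D0 i j k, rotated 3]) (auto simp: D0_def)
  next
    fix u :: "'n set" and l assume u: "u \<notin> D0" "card u < l" "l < CARD('n)"
    then show "\<exists>w. w \<notin> D0 \<and> card w = l \<and> \<not> u \<subseteq> w"
      by (intro ex_avoiding_spread[OF ijk _ _ u]) (auto simp: D0_def)
  qed (fact card)
  interpret spread_labelling f D0 E by (fact spr)
  define \<pi> where "\<pi> = (\<lambda>x. if x = b then {} else if x = a then {i} else if x = c then {j}
    else if x = d then {j, k} else if x = p then {i, j} else if x = q then {k} else UNIV)"
  have \<pi>: "\<pi> b = {}" "\<pi> a = {i}" "\<pi> c = {j}" "\<pi> d = {j, k}" "\<pi> p = {i, j}" "\<pi> q = {k}" "\<pi> t = UNIV"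
    using dist by (auto simp: \<pi>_def)
  have UNIV_neq: "UNIV \<noteq> {i, j}" "UNIV \<noteq> {j, k}" "UNIV \<noteq> {x}" for x :: 'n
    using ijk by (metis UNIV_I insertE singletonD)+
  have "partial \<pi> S"
  proof (rule partialI_base)
    have "distinct (map \<pi> [a, b, p, d, c, q, t])"
      using ijk UNIV_neq by (auto simp: \<pi> doubleton_eq_iff)
    then have "inj_on \<pi> (set [a, b, p, d, c, q, t])" unfolding distinct_map by (rule conjunct2)
    then show "inj_on \<pi> S" unfolding S_def list.set .
    show "\<pi> ` S = D0" by (auto simp: \<pi> S_def D0_def)
    show "f x = x \<or> descends f \<pi> x" if x: "x \<in> S" "x \<notin> E" "f x \<in> S" for x
    proof -
      have "x = a \<or> x = p \<or> x = d \<or> x = c \<or> x = t" using x unfolding S_def E_def by auto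
      then show ?thesis
      proof (elim disjE)
        assume "x = p"
        then have "\<pi> (f x) = {i} \<or> \<pi> (f x) = {j, k}" using fp x(3) \<pi>(2,4) by auto
        moreover have "\<pi> x = {i, j}" using \<open>x = p\<close> \<pi>(5) by simp
        ultimately show ?thesis unfolding descends_def using ijk by auto
      next
        assume "x = t"
        then have "\<pi> (f x) = {j, k}" using ft x(3) \<pi>(4) by auto
        moreover have "\<pi> x = UNIV" using \<open>x = t\<close> \<pi>(7) by simp
        ultimately show ?thesis unfolding descends_def using UNIV_neq(2) by auto
      qed (use f ijk in \<open>auto simp: \<pi> descends_def\<close>)
    qed
    show "\<pi> (f y) \<noteq> UNIV" if y: "y \<notin> S" "f y \<in> S" for y
    proof -
      have "f y \<noteq> t" using pre[OF y(1)] .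
      then have "f y = a \<or> f y = b \<or> f y = p \<or> f y = d \<or> f y = c \<or> f y = q"
        using y(2) unfolding S_def by auto
      then have "\<pi> (f y) \<in> {{i}, {}, {i, j}, {j, k}, {j}, {k}}" using \<pi> by (elim disjE) simp_all
      then show ?thesis using UNIV_neq by auto
    qed
  qed
  then show "\<exists>\<pi>. partial \<pi> S \<and> \<pi> b = {} \<and> \<pi> a = {i} \<and> \<pi> c = {j} \<and> \<pi> d = {j, k}
      \<and> \<pi> p = {i, j} \<and> \<pi> q = {k} \<and> \<pi> t = UNIV"
    using \<pi> by blast
qed

text \<open>Pairs are the critical level, and there the free \<open>{i, k}\<close> misses
  \<open>j\<close>.\<close>

lemma (in labelling) avoidable_three:
  assumes ijk: "i \<noteq> j" "j \<noteq> k" "i \<noteq> k" and D0: "D0 \<subseteq> path_labels i j k" and u: "j \<in> u"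
  shows "avoidable u 1"
  unfolding avoidable_def using u ijk by (intro allI impI ex_avoiding_three[OF ijk _ _ D0]) auto

lemma (in labelling) lowest_not_UNIV:
  assumes "partial \<pi> S" "{} \<in> D0" "UNIV \<in> D0" "lowest \<pi> S w"
  shows "\<not> UNIV \<subseteq> w" "1 \<le> card w"
proof -
  have "w \<notin> D0" using assms by (auto simp: partial_def lowest_def)
  then have "w \<noteq> UNIV" "w \<noteq> {}" using assms(2,3) by auto
  then show "\<not> UNIV \<subseteq> w" "1 \<le> card w" by (auto simp: Suc_le_eq card_gt_0_iff)
qed

text \<open>The free pair \<open>{i, k}\<close> bounds the size of \<open>w\<close> by two, so
  \<open>w\<close> could contain \<open>{i, j}\<close> only by being equal to it.\<close>

lemma (in labelling) lowest_not_pair: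
  assumes "partial \<pi> S" "\<pi> ` S = D0" "{} \<in> D0" "{i, j} \<in> D0" "{i, k} \<notin> D0" "i \<noteq> j" "i \<noteq> k" "lowest \<pi> S w"
  shows "\<not> {i, j} \<subseteq> w" "1 \<le> card w"
proof -
  have w: "w \<notin> D0" "\<And>B. B \<notin> D0 \<Longrightarrow> card w \<le> card B" using assms(2,8) by (auto simp: lowest_def)
  then have "card w \<le> card {i, j}" using assms(5-7) w(2)[of "{i, k}"] by simp
  then have "{i, j} = w" if "{i, j} \<subseteq> w" using that by (intro card_seteq) auto
  then show "\<not> {i, j} \<subseteq> w" using w(1) assms(4) by auto
  have "w \<noteq> {}" using w(1) assms(3) by auto
  then show "1 \<le> card w" by (auto simp: Suc_le_eq card_gt_0_iff)
qed

text \<open>The cycle has at least eight vertices. Seven consecutive ones form both strands, joined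
  by \<open>e 2\<close> leading to \<open>e 3\<close>; the rest is a gap that follows the carrier of
  the full set, where any label other than \<open>UNIV\<close> lets the predecessor descend.\<close>

lemma single_cycle_case:
  fixes f :: "'v::finite \<Rightarrow> 'v"
  assumes card: "CARD('v) = 2 ^ CARD('n::finite)" and n: "3 \<le> CARD('n)"
    and cyc: "is_cycle f x m" "cycle_set f x m = UNIV"
  shows "\<exists>\<pi> :: 'v \<Rightarrow> 'n set. has_small_attractor f \<pi>"
proof -
  obtain i j k :: 'n where ijk: "i \<noteq> j" "j \<noteq> k" "i \<noteq> k" using ex_three_elements[OF n] by blast
  have "8 \<le> CARD('v)" using card power_increasing[OF n, of "2::nat"] by simp
  then have m: "8 \<le> m" using card_cycle_set[OF cyc(1)] cyc(2) by simp
  define e where "e = (\<lambda>i. (f ^^ i) x)"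
  have e_Suc: "f (e i) = e (Suc i)" for i by (simp add: e_def)
  have fe: "(f ^^ i) x = e i" for i by (simp add: e_def)
  have e_eq: "e i = e j \<longleftrightarrow> i = j" if "i < m" "j < m" for i j
    using cyc(1) that by (auto simp: e_def is_cycle_def inj_on_def)
  have e_m: "e m = e 0" using cyc(1) by (simp add: e_def is_cycle_def)
  have e_all: "e ` {..<m} = UNIV" using cyc(2) by (simp add: e_def cycle_set_def)
  let ?S = "{e 0, e 1, e 2, e 3, e 4, e 5, e 6}"
  have S: "?S = e ` {..<7}" by (simp add: lessThan_Suc numeral_eq_Suc insert_commute)
  have steps: "f (e 0) = e 1" "f (e 1) = e 2" "f (e 2) = e 3" "f (e 3) = e 4" "f (e 4) = e 5"
    "f (e 5) = e 6" "f (e 6) = e 7"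
    by (simp_all add: e_Suc numeral_eq_Suc)
  have dist: "distinct [e 0, e 1, e 2, e 3, e 4, e 5, e 6]" using m by (simp add: e_eq)
  have e7: "e 7 \<notin> ?S" using m by (simp add: e_eq)
  have inj: "inj f" using inj_on_periodic[of f] is_cycle_periodic[OF cyc(1)] cyc(2)
    by (auto intro: inj_on_subset)
  have pre: "f y \<noteq> e 6" if "y \<notin> ?S" for y
    using that steps(6) injD[OF inj, of y "e 5"] by auto
  note base = path_base[OF card ijk dist steps(1,2,4,5,6), unfolded steps(3,7)]
  interpret spread_labelling f "path_labels i j k" "{e 1, e 5}"
    by (rule base(1)) (use e7 pre in auto)
  obtain \<pi>0 where part: "partial \<pi>0 ?S" and \<pi>0: "\<pi>0 (e 1) = {}" "\<pi>0 (e 0) = {i}" "\<pi>0 (e 4) = {j}"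
      "\<pi>0 (e 3) = {j, k}" "\<pi>0 (e 2) = {i, j}" "\<pi>0 (e 5) = {k}" "\<pi>0 (e 6) = UNIV"
    using base(2) e7 pre by auto
  have "\<exists>\<pi>. partial \<pi> (?S \<union> (\<lambda>i. (f ^^ i) x) ` {7..<m}) \<and> (\<forall>x \<in> ?S. \<pi> x = \<pi>0 x)"
  proof (rule insert_cycle_segment[OF part cyc(1), where u = UNIV and k = 1], unfold fe)
    show "avoidable UNIV 1" by (rule avoidable_three[OF ijk]) auto
    show "e m \<in> ?S" using e_m by simp
    show "e l \<notin> ?S" if "7 \<le> l" "l < m" for l
      unfolding S using that m by (auto simp: e_eq)
    show "l = 7 \<and> UNIV \<subseteq> \<pi>0 y" if y: "y \<in> ?S" "7 \<le> l" "l < m" "f y = e l" for y l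
    proof -
      obtain h where h: "h < 7" "y = e h" using y(1) unfolding S by auto
      then have "Suc h = l" using y m e_eq[of "Suc h" l] by (simp add: e_Suc)
      then have "h = 6" "l = 7" using h y(2) by auto
      then show ?thesis using h \<pi>0(7) by simp
    qed
    show "\<not> UNIV \<subseteq> w \<and> 1 \<le> card w" if "lowest \<pi>0 ?S w" for w
      using lowest_not_UNIV[OF part _ _ that] by simp
  qed simp_all
  moreover have "?S \<union> e ` {7..<m} = UNIV"
  proof -
    have "{..<m} = {..<7} \<union> {7..<m}" using m by auto
    then show ?thesis unfolding S using e_all by (simp flip: image_Un)
  qed
  ultimately obtain \<pi> where full: "partial \<pi> UNIV" and "\<forall>x \<in> ?S. \<pi> x = \<pi>0 x"
    unfolding e_def[symmetric] by auto
  then have \<pi>: "\<pi> (e 1) = {}" "\<pi> (e 0) = {i}" "\<pi> (e 4) = {j}"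
      "\<pi> (e 3) = {j, k}" "\<pi> (e 2) = {i, j}" "\<pi> (e 5) = {k}" "\<pi> (e 6) = UNIV"
    using \<pi>0 by auto
  have nofix: "f y \<noteq> y" for y
  proof -
    obtain h where h: "h < m" "y = e h" using e_all by (metis imageE lessThan_iff UNIV_I)
    then show ?thesis
      using e_eq[of "Suc h" h] e_eq[of 0 h] e_m m by (cases "Suc h = m") (auto simp: e_Suc)
  qed
  have "has_small_attractor f \<pi>"
  proof (rule path_attractor[OF ijk full_labelling(1)[OF full] \<pi>(1-6) steps(1,2,4,5)])
    show "j \<in> \<pi> (f (e 5))" using steps(6) \<pi>(7) by simp
    show "descends f \<pi> y" if "y \<noteq> e 1" "y \<noteq> e 5" for y
      using full_labelling(2)[OF full, of y] that nofix by simp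
  qed
  then show ?thesis by blast
qed

lemma cycle_eq_iff:
  "is_cycle f x m \<Longrightarrow> i < m \<Longrightarrow> j < m \<Longrightarrow> (f ^^ i) x = (f ^^ j) x \<longleftrightarrow> i = j"
  by (auto simp: is_cycle_def inj_on_def)

text \<open>The cycle of length at least three carries the strand \<open>a, b, p\<close> and the one
  of length at least four the strand \<open>d, c, q, t\<close>; at the minimal lengths the strands
  are the whole cycles.\<close>

lemma two_long_cycles_case:
  fixes f :: "'v::finite \<Rightarrow> 'v"
  assumes card: "CARD('v) = 2 ^ CARD('n::finite)" and n: "3 \<le> CARD('n)"
    and inj: "inj f" and nofix: "\<And>x. f x \<noteq> x"
    and cyc1: "is_cycle f x m1" "3 \<le> m1" and cyc2: "is_cycle f y m2" "4 \<le> m2"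
    and disj: "cycle_set f x m1 \<inter> cycle_set f y m2 = {}"
  shows "\<exists>\<pi> :: 'v \<Rightarrow> 'n set. has_small_attractor f \<pi>"
proof -
  obtain i j k :: 'n where ijk: "i \<noteq> j" "j \<noteq> k" "i \<noteq> k" using ex_three_elements[OF n] by blast
  define e where "e = (\<lambda>i. (f ^^ i) x)"
  define g where "g = (\<lambda>i. (f ^^ i) y)"
  have fe: "(f ^^ i) x = e i" and fg: "(f ^^ i) y = g i" for i by (simp_all add: e_def g_def)
  have e_Suc: "f (e i) = e (Suc i)" and g_Suc: "f (g i) = g (Suc i)" for i
    by (simp_all add: e_def g_def)
  have e_eq: "e i = e j \<longleftrightarrow> i = j" if "i < m1" "j < m1" for i j
    using cycle_eq_iff[OF cyc1(1) that] by (simp add: fe)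
  have g_eq: "g i = g j \<longleftrightarrow> i = j" if "i < m2" "j < m2" for i j
    using cycle_eq_iff[OF cyc2(1) that] by (simp add: fg)
  have e_m: "e m1 = e 0" and g_m: "g m2 = g 0"
    using cyc1(1) cyc2(1) by (simp_all add: e_def g_def is_cycle_def)
  have eg: "e i \<noteq> g j" if "i < m1" "j < m2" for i j
    using disj that unfolding cycle_set_def fe fg by blast
  \<comment> \<open>\<open>e r\<close> is the predecessor of \<open>e 0\<close> and plays the role
    of \<open>a\<close>.\<close>
  define r where "r = m1 - 1"
  have r: "2 \<le> r" "r < m1" "Suc r = m1" using cyc1(2) by (auto simp: r_def)
  let ?S = "{e r, e 0, e 1, g 0, g 1, g 2, g 3}"
  have steps: "f (e r) = e 0" "f (e 0) = e 1" "f (e 1) = e 2"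
    "f (g 0) = g 1" "f (g 1) = g 2" "f (g 2) = g 3" "f (g 3) = g 4"
    using e_m r by (simp_all add: e_Suc g_Suc numeral_eq_Suc)
  have dist: "distinct [e r, e 0, e 1, g 0, g 1, g 2, g 3]"
    using r cyc2(2) by (simp add: e_eq g_eq eg)
  have e2: "e 2 \<in> {e r, g 0} \<or> e 2 \<notin> ?S"
    using r cyc2(2) by (cases "r = 2") (auto simp: e_eq eg)
  have g4: "g 4 = g 0 \<or> g 4 \<notin> ?S"
  proof (cases "m2 = 4")
    case True
    then show ?thesis using g_m by simp
  next
    case False
    then show ?thesis using cyc2(2) r by (auto simp: g_eq eg[THEN not_sym])
  qed
  have pre: "f z \<noteq> g 3" if "z \<notin> ?S" for z
    using that steps(6) injD[OF inj, of z "g 2"] by auto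
  note base = path_base[OF card ijk dist steps(1,2,4,5,6), unfolded steps(3,7), OF e2 g4 pre]
  interpret spread_labelling f "path_labels i j k" "{e 0, g 2}"
    by (rule base(1))
  obtain \<pi>0 where part: "partial \<pi>0 ?S" and \<pi>0: "\<pi>0 (e 0) = {}" "\<pi>0 (e r) = {i}" "\<pi>0 (g 1) = {j}"
      "\<pi>0 (g 0) = {j, k}" "\<pi>0 (e 1) = {i, j}" "\<pi>0 (g 2) = {k}" "\<pi>0 (g 3) = UNIV"
    using base(2) by auto
  \<comment> \<open>The gap behind \<open>{i, j}\<close> is filled first: at this point exactly the
    planted labels are used, so \<open>{i, k}\<close> is known to be free. The gap behind the full
    set can wait.\<close>
  have "\<exists>\<pi>. partial \<pi> (?S \<union> (\<lambda>i. (f ^^ i) x) ` {2..<r}) \<and> (\<forall>x \<in> ?S. \<pi> x = \<pi>0 x)"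
  proof (rule insert_cycle_segment[OF part cyc1(1), where u = "{i, j}" and k = 1], unfold fe)
    show "avoidable {i, j} 1" by (rule avoidable_three[OF ijk]) auto
    show "r \<le> m1" using r by simp
    show notS: "e l \<notin> ?S" if "2 \<le> l" "l < r" for l
      using that r cyc2(2) by (simp add: e_eq eg)
    show "l = 2 \<and> {i, j} \<subseteq> \<pi>0 z" if z: "z \<in> ?S" "2 \<le> l" "l < r" "f z = e l" for z l
    proof -
      have "f z = f (e (l - 1))" using z by (simp add: e_Suc)
      then have zl: "z = e (l - 1)" using injD[OF inj] by blast
      have "l = 2"
      proof (rule ccontr)
        assume "l \<noteq> 2"
        then have "2 \<le> l - 1" "l - 1 < r" using z(2,3) by auto
        then have "z \<notin> ?S" unfolding zl by (rule notS)
        then show False using z(1) by (rule notE)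
      qed
      then show ?thesis using zl \<pi>0(5) by simp
    qed
    show "\<not> {i, j} \<subseteq> w \<and> 1 \<le> card w" if w: "lowest \<pi>0 ?S w" for w
    proof -
      have "j \<notin> {i, k}" using ijk by simp
      then have ik: "{i, k} \<notin> path_labels i j k"
        using ijk by (auto simp: doubleton_eq_iff)
      have img: "\<pi>0 ` ?S = path_labels i j k"
        by (simp only: image_insert image_empty \<pi>0) (simp add: insert_commute)
      show ?thesis using lowest_not_pair[OF part img _ _ ik ijk(1,3) w] by simp
    qed
  qed simp_all
  then obtain \<pi>1 where part1: "partial \<pi>1 (?S \<union> e ` {2..<r})" and agree1: "\<forall>x \<in> ?S. \<pi>1 x = \<pi>0 x"
    unfolding e_def[symmetric] by (elim exE conjE)
  let ?S1 = "?S \<union> e ` {2..<r}"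
  have "\<exists>\<pi>. partial \<pi> (?S1 \<union> (\<lambda>i. (f ^^ i) y) ` {4..<m2}) \<and> (\<forall>x \<in> ?S1. \<pi> x = \<pi>1 x)"
  proof (rule insert_cycle_segment[OF part1 cyc2(1), where u = UNIV and k = 1], unfold fg)
    show "avoidable UNIV 1" by (rule avoidable_three[OF ijk]) auto
    show "g m2 \<in> ?S1" using g_m by simp
    show notS: "g l \<notin> ?S1" if "4 \<le> l" "l < m2" for l
      using that r cyc2(2) by (auto simp: g_eq eg eg[THEN not_sym])
    show "l = 4 \<and> UNIV \<subseteq> \<pi>1 z" if z: "z \<in> ?S1" "4 \<le> l" "l < m2" "f z = g l" for z l
    proof -
      have "f z = f (g (l - 1))" using z by (simp add: g_Suc)
      then have zl: "z = g (l - 1)" using injD[OF inj] by blast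
      have "l = 4"
      proof (rule ccontr)
        assume "l \<noteq> 4"
        then have "4 \<le> l - 1" "l - 1 < m2" using z(2,3) by auto
        then have "z \<notin> ?S1" unfolding zl by (rule notS)
        then show False using z(1) by (rule notE)
      qed
      then show ?thesis using zl \<pi>0(7) agree1 by simp
    qed
    show "\<not> UNIV \<subseteq> w \<and> 1 \<le> card w" if "lowest \<pi>1 ?S1 w" for w
      using lowest_not_UNIV[OF part1 _ _ that] by simp
  qed simp_all
  then obtain \<pi>2 where part2: "partial \<pi>2 (?S1 \<union> g ` {4..<m2})" and agree2: "\<forall>x \<in> ?S1. \<pi>2 x = \<pi>1 x"
    unfolding g_def[symmetric] by (elim exE conjE)
  let ?S2 = "?S1 \<union> g ` {4..<m2}"
  have "?S2 = cycle_set f x m1 \<union> cycle_set f y m2"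
  proof -
    have "{..<m1} = {r, 0, 1} \<union> {2..<r}" using r by auto
    moreover have "{..<m2} = {0, 1, 2, 3} \<union> {4..<m2}" using cyc2(2) by auto
    ultimately show ?thesis unfolding cycle_set_def fe fg by auto
  qed
  then have "f ` ?S2 \<subseteq> ?S2" using cycle_set_closed[OF cyc1(1)] cycle_set_closed[OF cyc2(1)] by auto
  from extend_cycles_first[OF part2 this]
  obtain \<pi> where full: "partial \<pi> UNIV" and "\<forall>x \<in> ?S2. \<pi> x = \<pi>2 x"
    by auto
  then have \<pi>: "\<pi> (e 0) = {}" "\<pi> (e r) = {i}" "\<pi> (g 1) = {j}"
      "\<pi> (g 0) = {j, k}" "\<pi> (e 1) = {i, j}" "\<pi> (g 2) = {k}" "\<pi> (g 3) = UNIV"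
    using \<pi>0 agree1 agree2 by auto
  have "has_small_attractor f \<pi>"
  proof (rule path_attractor[OF ijk full_labelling(1)[OF full] \<pi>(1-6) steps(1,2,4,5)])
    show "j \<in> \<pi> (f (g 2))" using steps(6) \<pi>(7) by simp
    show "descends f \<pi> z" if "z \<noteq> e 0" "z \<noteq> g 2" for z
      using full_labelling(2)[OF full, of z] that nofix by simp
  qed
  then show ?thesis by blast
qed

lemma not_three_dvd_power_two: "\<not> 3 dvd (2::nat) ^ n"
proof (induction n)
  case (Suc n)
  then show ?case by (simp add: dvd_eq_mod_eq_0) presburger
qed simp

text \<open>Three does not divide \<open>2 ^ n\<close>, so some cycle has length at least four. It
  either covers everything or leaves room for a second cycle of length at least three.\<close>

lemma long_cycles_permutation_case:
  fixes f :: "'v::finite \<Rightarrow> 'v"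
  assumes card: "CARD('v) = 2 ^ CARD('n::finite)"
    and perm: "periodic f = UNIV" and nofix: "\<And>x. f x \<noteq> x" and no2: "\<And>x. f (f x) \<noteq> x"
  shows "\<exists>\<pi> :: 'v \<Rightarrow> 'n set. has_small_attractor f \<pi>"
proof -
  have inj: "inj f" using inj_on_periodic[of f] perm by simp
  have long: "3 \<le> m" if "is_cycle f c m" for c m
  proof -
    have "m \<noteq> 1" using that nofix length_one_cycle by metis
    moreover have "m \<noteq> 2" using that no2 length_two_cycle by metis
    ultimately show ?thesis using that by (auto simp: is_cycle_def)
  qed
  have "\<exists>c m. is_cycle f c m \<and> m \<noteq> 3"
  proof (rule ccontr)
    assume "\<nexists>c m. is_cycle f c m \<and> m \<noteq> 3"
    then have m3: "m = 3" if "is_cycle f c m" for c m using that by blast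
    have "3 dvd CARD('v)" by (rule cycle_lengths_dvd_card[where f = f]) (use inj m3 in auto)
    then show False using card not_three_dvd_power_two by simp
  qed
  then obtain y m2 where cyc2: "is_cycle f y m2" and "m2 \<noteq> 3" by blast
  then have "4 \<le> m2" using long[OF cyc2] by linarith
  note cyc2 = cyc2 this
  have m2: "m2 \<le> 2 ^ CARD('n)" using cycle_length_le[OF cyc2(1)] card by simp
  consider "CARD('n) = 1" | "CARD('n) = 2" | "3 \<le> CARD('n)"
    using zero_less_card_finite[where 'a = 'n] by linarith
  then show ?thesis
  proof cases
    case 1
    then show ?thesis using m2 cyc2(2) by simp
  next
    case 2
    then have "m2 = 4" using m2 cyc2(2) by simp
    define g where "g = (\<lambda>i. (f ^^ i) y)"
    have g_eq: "g i = g j \<longleftrightarrow> i = j" if "i < 4" "j < 4" for i j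
      using cycle_eq_iff[OF cyc2(1)] that \<open>m2 = 4\<close> by (simp add: g_def)
    have steps: "f (g 0) = g 1" "f (g 1) = g 2" "f (g 2) = g 3" "f (g 3) = g 0"
      using cyc2(1) \<open>m2 = 4\<close> by (simp_all add: g_def is_cycle_def numeral_eq_Suc)
    have "card (cycle_set f y 4) = CARD('v)" using card_cycle_set[OF cyc2(1)] \<open>m2 = 4\<close> card 2 by simp
    then have "cycle_set f y 4 = UNIV" by (metis card_subset_eq finite subset_UNIV)
    moreover have "{..<4::nat} = {0, 1, 2, 3}" by auto
    ultimately have S: "{g 0, g 1, g 2, g 3} = UNIV" by (simp add: cycle_set_def g_def)
    obtain i j :: 'n where ij: "UNIV = {i, j}" "i \<noteq> j" using 2 by (metis card_2_iff)
    \<comment> \<open>A Gray code along the 4-cycle: \<open>{i}\<close> has to climb to the full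
      set, but from there the labels descend to the empty set.\<close>
    define \<pi> where "\<pi> = (\<lambda>x. if x = g 0 then {} else if x = g 1 then {i} else if x = g 2 then {i, j} else {j})"
    have \<pi>: "\<pi> (g 0) = {}" "\<pi> (g 1) = {i}" "\<pi> (g 2) = {i, j}" "\<pi> (g 3) = {j}"
      by (simp_all add: \<pi>_def g_eq)
    have "inj_on \<pi> {g 0, g 1, g 2, g 3}" using ij(2) by (auto simp: \<pi> simp del: One_nat_def)
    then have bij: "bij \<pi>" unfolding S using card by (intro bij_of_inj)
    let ?G = "label_graph f \<pi>"
    have "({i}, {i, j}) \<in> ?G"
      using label_graph_up[of j \<pi> "g 1" f] ij(2) steps by (simp add: \<pi> insert_commute del: One_nat_def)
    moreover have "({i, j}, {j}) \<in> ?G"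
      using label_graph_down[of i \<pi> "g 2" f] ij(2) steps by (simp add: \<pi> del: One_nat_def)
    moreover have "({j}, {}) \<in> ?G" using label_graph_down[of j \<pi> "g 3" f] steps by (simp add: \<pi> del: One_nat_def)
    ultimately have g1: "(\<pi> (g 1), {}) \<in> ?G\<^sup>*" unfolding \<pi> by (meson r_into_rtrancl rtrancl_trans)
    have "(A, {}) \<in> ?G\<^sup>*" for A
    proof (rule reach_empty_label[OF bij \<pi>(1)])
      fix x assume "x \<noteq> g 0"
      then have "x = g 1 \<or> x = g 2 \<or> x = g 3" using S by blast
      then show "descends f \<pi> x \<or> (\<pi> x, {}) \<in> ?G\<^sup>*"
        using g1 steps ij(2) by (elim disjE) (auto simp: descends_def \<pi> simp del: One_nat_def)
    qed
    then show ?thesis using small_attractor_two_dim[OF 2 bij] by blast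
  next
    case 3
    show ?thesis
    proof (cases "cycle_set f y m2 = UNIV")
      case True
      then show ?thesis by (rule single_cycle_case[OF card 3 cyc2(1)])
    next
      case False
      then obtain x where x: "x \<notin> cycle_set f y m2" by blast
      obtain m1 where cyc1: "is_cycle f x m1" using periodic_is_cycle[of x f] perm by auto
      have "cycle_set f x m1 \<inter> cycle_set f y m2 = {}"
        by (rule cycle_disjoint[OF cycle_set_closed[OF cyc2(1)] x cyc1])
      then show ?thesis by (rule two_long_cycles_case[OF card 3 inj nofix cyc1 long[OF cyc1] cyc2])
    qed
  qed
qed

section \<open>A periodic vertex with two preimages\<close>

lemma fork_attractor:
  fixes \<pi> :: "'v \<Rightarrow> 'n::finite set"
  assumes "i \<noteq> j" "bij \<pi>" "\<And>A. (A, {}) \<in> (label_graph f \<pi>)\<^sup>*"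
    and \<pi>: "\<pi> z = {}" "\<pi> a = {i}" "\<pi> y = {j}" "\<pi> (f z) = {i, j}" and f: "f a = z" "f y = z"
  shows "has_small_attractor f \<pi>"
proof -
  have "trap_set (label_graph f \<pi>) {{}, {i}, {j}}"
  proof (rule trap_set_label_graph[where V = "{a, y, z}", OF bij_is_inj[OF assms(2)]])
    show "{{}, {i}, {j}} = \<pi> ` {a, y, z}" by (auto simp: \<pi>)
    fix v x assume "v \<in> {a, y, z}"
    then have v: "v = a \<or> v = y \<or> v = z" by simp
    show "\<pi> v - {x} \<in> {{}, {i}, {j}}" if "x \<in> \<pi> v" "x \<notin> \<pi> (f v)"
      using v that f by (elim disjE) (auto simp: \<pi>)
    show "insert x (\<pi> v) \<in> {{}, {i}, {j}}" if "x \<notin> \<pi> v" "x \<in> \<pi> (f v)"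
      using v that f by (elim disjE) (auto simp: \<pi>)
  qed simp
  moreover have "card {{}, {i}, {j}} \<le> 4" by (simp add: card_insert_if)
  ultimately show ?thesis using assms(2,3) unfolding has_small_attractor_def
    by (intro conjI allI exI[of _ "{{}, {i}, {j}}"]) auto
qed

text \<open>The full set is not planted: \<open>f q = d\<close> has the label \<open>{j, k}\<close>,
  which already contains the coordinate \<open>j\<close> that \<open>q\<close> must gain. As every
  orbit enters \<open>S\<close>, \<open>extend_to_all\<close> suffices.\<close>

lemma two_triangles_case:
  fixes f :: "'v::finite \<Rightarrow> 'v" and a b p d c q :: 'v
  defines "S \<equiv> {a, b, p, d, c, q}"
  assumes card: "CARD('v) = 2 ^ CARD('n::finite)" and n: "3 \<le> CARD('n)" and nofix: "\<And>x. f x \<noteq> x"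
    and dist: "distinct [a, b, p, d, c, q]"
    and f: "f a = b" "f b = p" "f p = a" "f d = c" "f c = q" "f q = d"
    and into: "\<And>y. \<exists>k. (f ^^ k) y \<in> S"
  shows "\<exists>\<pi> :: 'v \<Rightarrow> 'n set. has_small_attractor f \<pi>"
proof -
  obtain i j k :: 'n where ijk: "i \<noteq> j" "j \<noteq> k" "i \<noteq> k" using ex_three_elements[OF n] by blast
  let ?D0 = "{{}, {i}, {j}, {k}, {i, j}, {j, k}}"
  interpret labelling f ?D0 "{b, q}"
  proof unfold_locales
    fix A B :: "'n set" assume "B \<in> ?D0" "A \<subseteq> B" "B \<noteq> UNIV"
    then show "A \<in> ?D0" by (rule down_closed_three[of ?D0 i j k, rotated 3]) auto
  qed (fact card)
  define \<pi>0 where "\<pi>0 = (\<lambda>x. if x = b then {} else if x = a then {i} else if x = c then {j}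
    else if x = d then {j, k} else if x = p then {i, j} else {k})"
  have \<pi>0: "\<pi>0 b = {}" "\<pi>0 a = {i}" "\<pi>0 c = {j}" "\<pi>0 d = {j, k}" "\<pi>0 p = {i, j}" "\<pi>0 q = {k}"
    using dist by (auto simp: \<pi>0_def)
  have UNIV_neq: "UNIV \<noteq> {i, j}" "UNIV \<noteq> {j, k}" "UNIV \<noteq> {x}" for x :: 'n
    using ijk by (metis UNIV_I insertE singletonD)+
  have closed: "f ` S \<subseteq> S" using f by (auto simp: S_def)
  have base: "partial \<pi>0 S"
  proof (rule partialI_base)
    have "distinct (map \<pi>0 [a, b, p, d, c, q])"
      using ijk by (auto simp: \<pi>0 doubleton_eq_iff)
    then have "inj_on \<pi>0 (set [a, b, p, d, c, q])" unfolding distinct_map by (rule conjunct2)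
    then show "inj_on \<pi>0 S" unfolding S_def list.set .
    show img: "\<pi>0 ` S = ?D0"
      by (simp only: S_def image_insert image_empty \<pi>0) (simp add: insert_commute)
    show "f x = x \<or> descends f \<pi>0 x" if x: "x \<in> S" "x \<notin> {b, q}" for x
    proof -
      have "x = a \<or> x = p \<or> x = d \<or> x = c" using x unfolding S_def by auto
      then show ?thesis using f ijk by (elim disjE) (auto simp: \<pi>0 descends_def)
    qed
    show "\<pi>0 (f y) \<noteq> UNIV" if "f y \<in> S" for y
    proof -
      have "\<pi>0 (f y) \<in> ?D0" using that img by blast
      then show ?thesis using UNIV_neq by auto
    qed
  qed
  obtain \<pi> where full: "partial \<pi> UNIV" and agree: "\<forall>x \<in> S. \<pi> x = \<pi>0 x"
    using extend_to_all[OF base closed into] by blast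
  then have \<pi>: "\<pi> b = {}" "\<pi> a = {i}" "\<pi> c = {j}" "\<pi> d = {j, k}" "\<pi> p = {i, j}" "\<pi> q = {k}"
    using \<pi>0 by (auto simp: S_def)
  have "has_small_attractor f \<pi>"
  proof (rule path_attractor[OF ijk full_labelling(1)[OF full] \<pi> f(1,2,4,5)])
    show "j \<in> \<pi> (f q)" using f(6) \<pi>(4) by simp
    show "descends f \<pi> z" if "z \<noteq> b" "z \<noteq> q" for z
      using full_labelling(2)[OF full, of z] that nofix by simp
  qed
  then show ?thesis by blast
qed

text \<open>On the square \<open>t\<close> carries the full set. No vertex outside \<open>S\<close>
  maps to \<open>t\<close>, so only its predecessor \<open>q\<close> is prevented from
  descending.\<close>

lemma triangle_and_square_case:
  fixes f :: "'v::finite \<Rightarrow> 'v" and a b p d c q t :: 'v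
  defines "S \<equiv> {a, b, p, d, c, q, t}"
  assumes card: "CARD('v) = 2 ^ CARD('n::finite)" and n: "3 \<le> CARD('n)" and nofix: "\<And>x. f x \<noteq> x"
    and dist: "distinct [a, b, p, d, c, q, t]"
    and f: "f a = b" "f b = p" "f p = a" "f d = c" "f c = q" "f q = t" "f t = d"
    and into: "\<And>y. \<exists>k. (f ^^ k) y \<in> S" and pre: "\<And>y. y \<notin> S \<Longrightarrow> f y \<noteq> t"
  shows "\<exists>\<pi> :: 'v \<Rightarrow> 'n set. has_small_attractor f \<pi>"
proof -
  obtain i j k :: 'n where ijk: "i \<noteq> j" "j \<noteq> k" "i \<noteq> k" using ex_three_elements[OF n] by blast
  note base = path_base[OF card ijk dist f(1,2,4-6), folded S_def]
  interpret spread_labelling f "path_labels i j k" "{b, q}"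
    by (rule base(1)) (use f pre in auto)
  obtain \<pi>0 where part: "partial \<pi>0 S" and \<pi>0: "\<pi>0 b = {}" "\<pi>0 a = {i}" "\<pi>0 c = {j}"
      "\<pi>0 d = {j, k}" "\<pi>0 p = {i, j}" "\<pi>0 q = {k}" "\<pi>0 t = UNIV"
    using base(2) f pre by auto
  have closed: "f ` S \<subseteq> S" using f by (auto simp: S_def)
  obtain \<pi> where full: "partial \<pi> UNIV" and agree: "\<forall>x \<in> S. \<pi> x = \<pi>0 x"
    using extend_to_all[OF part closed into] by blast
  then have \<pi>: "\<pi> b = {}" "\<pi> a = {i}" "\<pi> c = {j}" "\<pi> d = {j, k}" "\<pi> p = {i, j}" "\<pi> q = {k}" "\<pi> t = UNIV"
    using \<pi>0 by (auto simp: S_def)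
  have "has_small_attractor f \<pi>"
  proof (rule path_attractor[OF ijk full_labelling(1)[OF full] \<pi>(1-6) f(1,2,4,5)])
    show "j \<in> \<pi> (f q)" using f(6) \<pi>(7) by simp
    show "descends f \<pi> z" if "z \<noteq> b" "z \<noteq> q" for z
      using full_labelling(2)[OF full, of z] that nofix by simp
  qed
  then show ?thesis by blast
qed

lemma ex_attached_vertex:
  fixes f :: "'v::finite \<Rightarrow> 'v"
  assumes "periodic f \<noteq> UNIV"
  obtains y where "y \<notin> periodic f" "f y \<in> periodic f"
proof -
  obtain x where x: "x \<notin> periodic f" using assms by blast
  define k where "k = (LEAST k. (f ^^ k) x \<in> periodic f)"
  have k: "(f ^^ k) x \<in> periodic f" unfolding k_def using eventually_periodic by (rule LeastI_ex)
  then obtain j where j: "k = Suc j" using x by (cases k) auto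
  have "(f ^^ j) x \<notin> periodic f"
    using not_less_Least[of j "\<lambda>k. (f ^^ k) x \<in> periodic f"] j k_def by simp
  then show ?thesis using that[of "(f ^^ j) x"] k j by simp
qed

text \<open>The fork consists of \<open>e (m - 1)\<close> and \<open>y\<close>, both mapped to
  \<open>e 0\<close>. From length four on, the vertex \<open>e (m - 2)\<close> differs from
  \<open>e 1\<close> and can take \<open>{k}\<close>, which keeps the labels spread even in
  dimension three.\<close>

lemma long_attached_cycle_case:
  fixes f :: "'v::finite \<Rightarrow> 'v"
  assumes card: "CARD('v) = 2 ^ CARD('n::finite)" and nofix: "\<And>x. f x \<noteq> x"
    and long: "\<And>c m. is_cycle f c m \<Longrightarrow> 3 \<le> m"
    and y: "y \<notin> periodic f" and cyc: "is_cycle f (f y) m" "4 \<le> m"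
  shows "\<exists>\<pi> :: 'v \<Rightarrow> 'n set. has_small_attractor f \<pi>"
proof -
  define e where "e = (\<lambda>i. (f ^^ i) (f y))"
  have fe: "(f ^^ i) (f y) = e i" for i by (simp add: e_def)
  have e_Suc: "f (e i) = e (Suc i)" for i by (simp add: e_def)
  have e_eq: "e i = e j \<longleftrightarrow> i = j" if "i < m" "j < m" for i j
    using cycle_eq_iff[OF cyc(1) that] by (simp add: fe)
  have e_m: "e m = e 0" using cyc(1) by (simp add: e_def is_cycle_def)
  have ye: "y \<noteq> e i" "e i \<noteq> y" if "i < m" for i
    using is_cycle_periodic[OF cyc(1)] y that unfolding cycle_set_def fe by auto
  have set: "cycle_set f (f y) m = e ` {..<m}" by (simp add: cycle_set_def e_def)
  define r where "r = m - 2"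
  have r: "2 \<le> r" "r < m" "Suc r < m" "Suc (Suc r) = m" using cyc(2) by (auto simp: r_def)
  have cardS1: "card (insert y (cycle_set f (f y) m)) = Suc m"
    using card_cycle_set[OF cyc(1)] ye unfolding set by (subst card_insert_disjoint) auto
  then have Sm: "Suc m \<le> CARD('v)"
    using card_mono[of UNIV "insert y (cycle_set f (f y) m)"] by simp
  have n: "3 \<le> CARD('n)"
  proof (rule ccontr)
    assume "\<not> 3 \<le> CARD('n)"
    then have "(2::nat) ^ CARD('n) \<le> 2 ^ 2" by (intro power_increasing) auto
    then show False using Sm card cyc(2) by simp
  qed
  have cardV: "8 \<le> CARD('v)" using card power_increasing[OF n, of "2::nat"] by simp
  obtain i j k :: 'n where ijk: "i \<noteq> j" "j \<noteq> k" "i \<noteq> k" using ex_three_elements[OF n] by blast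
  let ?D0 = "{{}, {i}, {j}, {k}, {i, j}}"
  have sub: "?D0 \<subseteq> path_labels i j k" by auto
  interpret spread_labelling f ?D0 "{e 0}"
  proof unfold_locales
    fix A B :: "'n set" assume "B \<in> ?D0" "A \<subseteq> B" "B \<noteq> UNIV"
    then show "A \<in> ?D0" by (rule down_closed_three[of ?D0 i j k, rotated 3]) auto
  next
    fix u :: "'n set" and l assume u: "u \<notin> ?D0" "card u < l" "l < CARD('n)"
    then show "\<exists>w. w \<notin> ?D0 \<and> card w = l \<and> \<not> u \<subseteq> w"
      by (intro ex_avoiding_spread[OF ijk _ _ u]) auto
  qed (fact card)
  let ?S = "{e 0, e (Suc r), y, e r, e 1}"
  have steps: "f (e 0) = e 1" "f (e (Suc r)) = e 0" "f y = e 0" "f (e r) = e (Suc r)" "f (e 1) = e 2"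
    using e_m r by (simp_all add: e_Suc numeral_eq_Suc, simp add: e_def)
  define \<pi>0 where "\<pi>0 = (\<lambda>x. if x = e 0 then {} else if x = e (Suc r) then {i} else if x = y then {j}
    else if x = e r then {k} else {i, j})"
  have \<pi>0: "\<pi>0 (e 0) = {}" "\<pi>0 (e (Suc r)) = {i}" "\<pi>0 y = {j}" "\<pi>0 (e r) = {k}" "\<pi>0 (e 1) = {i, j}"
    using r ye by (auto simp: \<pi>0_def e_eq)
  have UNIV_neq: "UNIV \<noteq> {i, j}" "UNIV \<noteq> {x}" for x :: 'n
    using ijk by (metis UNIV_I insertE singletonD)+
  have img: "\<pi>0 ` ?S = ?D0" by (simp only: image_insert image_empty \<pi>0)
  have dist: "distinct [e 0, e (Suc r), y, e r, e 1]" using r ye by (simp add: e_eq)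
  have base: "partial \<pi>0 ?S"
  proof (rule partialI_base[OF _ img])
    have "distinct (map \<pi>0 [e 0, e (Suc r), y, e r, e 1])"
      unfolding list.map \<pi>0 using ijk by (auto simp: doubleton_eq_iff)
    then have "inj_on \<pi>0 (set [e 0, e (Suc r), y, e r, e 1])" unfolding distinct_map by (rule conjunct2)
    then show "inj_on \<pi>0 ?S" unfolding list.set .
    show "f x = x \<or> descends f \<pi>0 x" if x: "x \<in> ?S" "x \<notin> {e 0}" "f x \<in> ?S" for x
    proof -
      have "x = e (Suc r) \<or> x = y \<or> x = e r \<or> x = e 1" using x(1,2) by auto
      then show ?thesis
      proof (elim disjE)
        assume x1: "x = e 1"
        \<comment> \<open>The image of \<open>e 1\<close> is planted only on a cycle of length four;
          then it is \<open>e r\<close> with the label \<open>{k}\<close>.\<close>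
        have "r = 2"
        proof (rule ccontr)
          assume "r \<noteq> 2"
          then have "e 2 \<notin> ?S" using r ye by (simp add: e_eq)
          then show False using x(3) steps(5) x1 by simp
        qed
        then have "\<pi>0 (f x) = {k}" using steps(5) x1 \<pi>0(4) by simp
        moreover have "\<pi>0 x = {i, j}" using x1 \<pi>0(5) by simp
        ultimately show ?thesis using ijk by (auto simp: descends_def)
      qed (use steps ijk in \<open>auto simp: descends_def \<pi>0\<close>)
    qed
    show "\<pi>0 (f y) \<noteq> UNIV" if "f y \<in> ?S" for y
    proof -
      have "\<pi>0 (f y) \<in> ?D0" using that img by blast
      then show ?thesis using UNIV_neq by auto
    qed
  qed
  have av: "avoidable {i, j} 1" by (rule avoidable_three[OF ijk sub]) simp
  have low: "\<not> {i, j} \<subseteq> w" "1 \<le> card w" if w: "lowest \<pi>0 ?S w" for w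
  proof -
    have "j \<notin> {i, k}" using ijk by simp
    then have ik: "{i, k} \<notin> ?D0" using ijk by (auto simp: doubleton_eq_iff)
    show "\<not> {i, j} \<subseteq> w" "1 \<le> card w"
      using lowest_not_pair[OF base img _ _ ik ijk(1,3) w] by simp_all
  qed
  have notS: "e l \<notin> ?S" if "2 \<le> l" "l < r" for l
    using that r ye by (simp add: e_eq)
  have preS: "l = 2 \<and> x = e 1" if x: "x \<in> ?S" "f x = e l" "2 \<le> l" "l < r" for x l
  proof -
    have "x = e 0 \<or> x = e (Suc r) \<or> x = y \<or> x = e r \<or> x = e 1" using x(1) by auto
    then have "f x = e 1 \<or> f x = e 0 \<or> f x = e (Suc r) \<or> (x = e 1 \<and> f x = e 2)"
      using steps by (elim disjE) simp_all
    then show ?thesis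
      unfolding x(2)
      using x(3,4) r e_eq[of l 1] e_eq[of l 0] e_eq[of l "Suc r"] e_eq[of l 2] by auto
  qed
  obtain C :: "'n set" where C: "C \<notin> ?D0" "Suc (card C) = CARD('n)"
    using ex_coatom_three[OF ijk n sub] by blast
  have cycle_split: "insert y (cycle_set f (f y) m) = ?S \<union> e ` {2..<r}"
  proof -
    have "{..<m} = {0, Suc r, r, 1} \<union> {2..<r}" using r by auto
    then show ?thesis unfolding set by auto
  qed
  have cardS: "card ?S = 5" using distinct_card[OF dist] by simp
  have "\<exists>\<pi>. completed \<pi> \<and> (\<forall>x \<in> ?S. \<pi> x = \<pi>0 x)"
  proof (cases "Suc m = CARD('v)")
    case True
    \<comment> \<open>Every vertex besides \<open>y\<close> is on the cycle, and \<open>y\<close>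
      already carries \<open>{j}\<close>; so the full set must go into the gap.\<close>
    then have "insert y (cycle_set f (f y) m) = UNIV" using cardS1 by (metis card_subset_eq finite subset_UNIV)
    then have all: "?S \<union> e ` {2..<r} = UNIV" using cycle_split by simp
    have big: "5 \<le> r" using True cardV r by linarith
    obtain w where w: "lowest \<pi>0 ?S w"
    proof -
      have "?S \<noteq> UNIV"
      proof
        assume "?S = UNIV"
        then have "CARD('v) = 5" using cardS by (simp only:)
        then show False using cardV by simp
      qed
      then show ?thesis using that ex_lowest[OF partial_inj[OF base]] by blast
    qed
    \<comment> \<open>Shifted by one: the gap starts at \<open>e 2\<close>, while
      \<open>insert_last_path\<close> counts from 1.\<close>
    define g where "g = (\<lambda>l. e (Suc l))"
    have g_img: "g ` {a..<r - 1} = e ` {Suc a..<r}" for a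
    proof -
      have "Suc ` {a..<r - 1} = {Suc a..<r}" using big by (simp add: image_Suc_atLeastLessThan)
      then show ?thesis unfolding g_def by (metis image_image)
    qed
    have "\<exists>\<pi>' d. bij \<pi>' \<and> (\<forall>x \<in> ?S. \<pi>' x = \<pi>0 x) \<and> climbs_to_top \<pi>' d
      \<and> (\<forall>x. x \<notin> {e 0} \<longrightarrow> x \<noteq> d \<longrightarrow> f x = x \<or> descends f \<pi>' x)"
    proof (rule insert_last_path[where g = g and b = "r - 1", OF base _ _ _ _ _ _ w low[OF w] av _ _ C])
      show "f (g l) = g (Suc l)" for l by (simp add: g_def e_Suc)
      show "inj_on g {1..<r - 1}"
      proof (rule inj_onI)
        fix x y assume xy: "x \<in> {1..<r - 1}" "y \<in> {1..<r - 1}" "g x = g y"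
        then have "Suc x < m" "Suc y < m" using r by auto
        then show "x = y" using xy(3) e_eq[of "Suc x" "Suc y"] by (simp add: g_def)
      qed
      show "- ?S = g ` {1..<r - 1}"
      proof -
        have compl: "- A = B" if "A \<union> B = UNIV" "\<And>x. x \<in> B \<Longrightarrow> x \<notin> A" for A B :: "'v set"
          using that by blast
        have "- ?S = e ` {2..<r}"
        proof (rule compl[OF all])
          fix x assume "x \<in> e ` {2..<r}"
          then obtain l where l: "2 \<le> l" "l < r" "x = e l" by auto
          from l(1,2) show "x \<notin> ?S" unfolding l(3) by (rule notS)
        qed
        then show ?thesis unfolding g_img by (simp add: numeral_2_eq_2)
      qed
      show "f x \<notin> g ` {2..<r - 1}" if "x \<in> ?S" for x
      proof
        assume "f x \<in> g ` {2..<r - 1}"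
        then obtain l where "Suc 2 \<le> l" "l < r" "f x = e l" unfolding g_img by auto
        then show False using preS[OF that, of l] by simp
      qed
      show "g (r - 1) \<in> ?S" using big by (simp add: g_def)
      show "{i, j} \<subseteq> \<pi>0 x" if x: "x \<in> ?S - {e 0}" "f x = g 1" for x
      proof -
        have "x \<in> ?S" using x(1) by (rule DiffD1)
        then have "x = e 1" using preS[of x 2] x(2) big by (simp add: g_def numeral_2_eq_2)
        then show ?thesis using \<pi>0(5) by simp
      qed
      show "3 \<le> r - 1" using big by simp
      show "UNIV \<notin> \<pi>0 ` ?S" unfolding img using UNIV_neq by auto
    qed
    then show ?thesis unfolding completed_def by blast
  next
    case False
    have "\<exists>\<pi>. partial \<pi> (?S \<union> (\<lambda>i. (f ^^ i) (f y)) ` {2..<r}) \<and> (\<forall>x \<in> ?S. \<pi> x = \<pi>0 x)"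
    proof (rule insert_cycle_segment[OF base cyc(1), where u = "{i, j}" and k = 1], unfold fe)
      show "l = 2 \<and> {i, j} \<subseteq> \<pi>0 x" if x: "x \<in> ?S" "2 \<le> l" "l < r" "f x = e l" for x l
        using preS[OF x(1,4,2,3)] \<pi>0(5) by simp
      show "UNIV \<in> ?D0 \<or> r - 2 < card (- ?S)"
      proof -
        have "card (- ?S) = CARD('v) - 5" unfolding card_compl cardS ..
        moreover have "r - 2 < CARD('v) - 5" using False Sm r cardV by linarith
        ultimately show ?thesis by (simp only: simp_thms)
      qed
      show "\<not> {i, j} \<subseteq> w \<and> 1 \<le> card w" if "lowest \<pi>0 ?S w" for w using low[OF that] by blast
    qed (use r notS av in simp_all)
    then obtain \<pi>1 where part1: "partial \<pi>1 (?S \<union> e ` {2..<r})" and agree1: "\<forall>x \<in> ?S. \<pi>1 x = \<pi>0 x"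
      unfolding e_def[symmetric] by (elim exE conjE)
    let ?S1 = "insert y (cycle_set f (f y) m)"
    have part1': "partial \<pi>1 ?S1" using part1 unfolding cycle_split .
    have closed: "f ` ?S1 \<subseteq> ?S1"
      using cycle_set_closed[OF cyc(1)] cycle_set_self[OF cyc(1)] by auto
    have "?S1 \<noteq> UNIV"
    proof
      assume "?S1 = UNIV"
      then show False using cardS1 False by (simp only:)
    qed
    have "\<exists>c m. c \<notin> ?S1 \<and> is_cycle f c m \<and> 3 \<le> m" if per: "- ?S1 \<subseteq> periodic f"
    proof -
      obtain c where "c \<notin> ?S1" using \<open>?S1 \<noteq> UNIV\<close> by blast
      then show ?thesis using per periodic_is_cycle[of c f] long by blast
    qed
    then have H: "?S1 = UNIV \<or> \<not> - ?S1 \<subseteq> periodic f \<or> (\<exists>c m. c \<notin> ?S1 \<and> is_cycle f c m \<and> 3 \<le> m)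
      \<and> (\<exists>C :: 'n set. C \<notin> ?D0 \<and> Suc (card C) = CARD('n))"
      using C by (cases "- ?S1 \<subseteq> periodic f") (simp_all only: simp_thms, rule disjI2, rule exI, rule conjI)
    have U: "UNIV \<notin> ?D0" using UNIV_neq by auto
    obtain \<pi> where "completed \<pi>" and agree: "\<forall>x \<in> ?S1. \<pi> x = \<pi>1 x"
      using complete[OF part1' closed U H] by (elim exE conjE)
    moreover have "?S \<subseteq> ?S1" unfolding cycle_split by (rule Un_upper1)
    ultimately show ?thesis using agree1 by (intro exI[of _ \<pi>] conjI ballI) (auto dest: subsetD)
  qed
  then obtain \<pi> where comp: "completed \<pi>" and "\<forall>x \<in> ?S. \<pi> x = \<pi>0 x" by blast
  then have \<pi>: "\<pi> (e 0) = {}" "\<pi> (e (Suc r)) = {i}" "\<pi> y = {j}" "\<pi> (f (e 0)) = {i, j}"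
    using \<pi>0 steps(1) by auto
  have "(A, {}) \<in> (label_graph f \<pi>)\<^sup>*" for A
    using completed_reach[OF comp, of "{e 0}" A] nofix \<pi>(1) by auto
  moreover have "bij \<pi>" using comp by (simp add: completed_def)
  ultimately show ?thesis using fork_attractor[OF ijk(1) _ _ \<pi> steps(2,3)] by blast
qed

text \<open>From dimension four on, some pair \<open>{i, k}\<close> avoids both \<open>j\<close> and
  the element of a singleton \<open>u\<close>. In dimension three the third singleton has no such
  pair, as only the planted \<open>{i, j}\<close> misses it.\<close>

lemma ex_avoiding_four:
  fixes u :: "'n::finite set"
  assumes "4 \<le> CARD('n)" "i \<noteq> j"
    and u: "u \<notin> {{}, {i}, {j}, {i, j}}" "card u < l" "l < CARD('n)"
  shows "\<exists>w. w \<notin> {{}, {i}, {j}, {i, j}} \<and> card w = l \<and> \<not> u \<subseteq> w"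
proof (cases "l = 2")
  case True
  have "u \<noteq> {}" using u(1) by auto
  then have "card u \<noteq> 0" by simp
  then have "card u = 1" using True u(2) by linarith
  then obtain x where x: "u = {x}" by (rule card_1_singletonE)
  have "card {i, j, x} \<le> 3" by (simp add: card_insert_if)
  then have "{i, j, x} \<noteq> UNIV" using assms(1) by auto
  then obtain k where k: "k \<noteq> i" "k \<noteq> j" "k \<noteq> x" by blast
  have "card {i, k} = l" using k(1) True by simp
  moreover have "\<not> u \<subseteq> {i, k}" using u(1) x k(3) by auto
  moreover have "{i, k} \<notin> {{}, {i}, {j}, {i, j}}" using k assms(2) by (auto simp: doubleton_eq_iff)
  ultimately show ?thesis by (intro exI[of _ "{i, k}"] conjI)
next
  case False
  have "u \<noteq> {}" using u(1) by auto
  moreover have "card u \<noteq> 0" using \<open>u \<noteq> {}\<close> by simp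
  then have "2 < l" using u(2) False by linarith
  then have "card w \<noteq> l" if "w \<in> {{}, {i}, {j}, {i, j}}" for w
    using that assms(2) by auto
  ultimately show ?thesis using u(3) by (intro ex_avoiding_subset)
qed

text \<open>On a triangle the fork uses up the cycle and no vertex is left for \<open>{k}\<close>,
  so the labels spread only from dimension four on. In dimension three a second cycle has length
  three or four, and the path replaces the fork.\<close>

lemma attached_triangle_case:
  fixes f :: "'v::finite \<Rightarrow> 'v"
  assumes card: "CARD('v) = 2 ^ CARD('n::finite)" and nofix: "\<And>x. f x \<noteq> x"
    and long: "\<And>c m. is_cycle f c m \<Longrightarrow> 3 \<le> m"
    and y: "y \<notin> periodic f" and cyc: "is_cycle f (f y) 3"
  shows "\<exists>\<pi> :: 'v \<Rightarrow> 'n set. has_small_attractor f \<pi>"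
proof -
  define a b p where "a = f (f (f y))" and "b = f y" and "p = f (f y)"
  have f: "f a = b" "f b = p" "f p = a" "f y = b"
    using cyc by (simp_all add: is_cycle_def a_def b_def p_def numeral_3_eq_3)
  have "b \<in> periodic f" using cycle_set_self[OF cyc] is_cycle_periodic[OF cyc] unfolding b_def by (rule subsetD[rotated])
  then have "p \<in> periodic f" using periodic_closed[of f] unfolding f(2)[symmetric] by (meson image_subset_iff)
  then have "a \<in> periodic f" using periodic_closed[of f] unfolding f(3)[symmetric] by (meson image_subset_iff)
  note per = this \<open>b \<in> periodic f\<close> \<open>p \<in> periodic f\<close>
  have abp: "a \<noteq> b" "b \<noteq> p" "a \<noteq> p"
    using nofix f by metis+
  have yS: "y \<noteq> a" "y \<noteq> b" "y \<noteq> p" using y per by auto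
  let ?S = "{b, a, y, p}"
  have closed: "f ` ?S \<subseteq> ?S" using f by auto
  have cardS: "card ?S = 4" using abp yS by auto
  then have "4 \<le> CARD('v)" using card_mono[of UNIV ?S] by simp
  then have "CARD('n) \<noteq> 1" using card by auto
  then have "2 \<le> CARD('n)" using zero_less_card_finite[where 'a = 'n] by linarith
  then obtain N :: "'n set" where "card N = 2" by (metis obtain_subset_with_card_n)
  then obtain i j :: 'n where ij: "i \<noteq> j" by (auto simp: card_2_iff)
  let ?D0 = "{{}, {i}, {j}, {i, j}}"
  interpret labelling f ?D0 "{b}"
  proof unfold_locales
    fix A B :: "'n set" assume "B \<in> ?D0" "A \<subseteq> B" "B \<noteq> UNIV"
    \<comment> \<open>Taking \<open>k = j\<close> merely repeats planted labels.\<close>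
    then show "A \<in> ?D0" by (rule down_closed_three[of ?D0 i j j, rotated 3]) auto
  qed (fact card)
  define \<pi>0 where "\<pi>0 = (\<lambda>x. if x = b then {} else if x = a then {i} else if x = y then {j} else {i, j})"
  have \<pi>0: "\<pi>0 b = {}" "\<pi>0 a = {i}" "\<pi>0 y = {j}" "\<pi>0 p = {i, j}"
    using abp yS by (auto simp: \<pi>0_def)
  have img: "\<pi>0 ` ?S = ?D0" by (simp only: image_insert image_empty \<pi>0)
  have base: "partial \<pi>0 ?S"
  proof (rule partialI_base[OF _ img])
    show "inj_on \<pi>0 ?S" using ij by (auto simp: \<pi>0 doubleton_eq_iff)
    show "f x = x \<or> descends f \<pi>0 x" if x: "x \<in> ?S" "x \<notin> {b}" for x
    proof -
      have "x = a \<or> x = y \<or> x = p" using x by auto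
      then show ?thesis using f ij by (elim disjE) (auto simp: descends_def \<pi>0)
    qed
    show "\<pi>0 (f x) \<noteq> UNIV" if "x \<notin> ?S" "f x \<in> ?S" for x
    proof
      assume "\<pi>0 (f x) = UNIV"
      then have "UNIV \<in> ?D0" using that(2) img by (metis image_eqI)
      moreover have "card A \<le> 2" if "A \<in> ?D0" for A using that ij by auto
      \<comment> \<open>In dimension two \<open>{i, j}\<close> is the full set, but then the four
        vertices of \<open>?S\<close> are all there are.\<close>
      ultimately have "CARD('n) \<le> 2" by blast
      then have "CARD('v) \<le> 2 ^ 2" unfolding card by (intro power_increasing) auto
      then have "?S = UNIV" using cardS by (intro card_seteq) auto
      then show False using that(1) by (metis UNIV_I)
    qed
  qed
  have finish: "has_small_attractor f \<pi>" if comp: "completed \<pi>" and "\<forall>x \<in> ?S. \<pi> x = \<pi>0 x" for \<pi>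
  proof -
    have \<pi>: "\<pi> b = {}" "\<pi> a = {i}" "\<pi> y = {j}" "\<pi> (f b) = {i, j}"
      using that(2) \<pi>0 f(2) by auto
    have "(A, {}) \<in> (label_graph f \<pi>)\<^sup>*" for A
      using completed_reach[OF comp, of "{b}" A] nofix \<pi>(1) by auto
    moreover have "bij \<pi>" using comp by (simp add: completed_def)
    ultimately show ?thesis using fork_attractor[OF ij _ _ \<pi> f(1,4)] by blast
  qed
  show ?thesis
  proof (cases "periodic f \<subseteq> ?S")
    case True
    then have into: "\<exists>k. (f ^^ k) x \<in> ?S" for x using eventually_periodic[of f x] by (meson subsetD)
    obtain \<pi> where "partial \<pi> UNIV" "\<forall>x \<in> ?S. \<pi> x = \<pi>0 x"
      using extend_to_all[OF base closed into] by (elim exE conjE)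
    then show ?thesis using finish[OF completed_full] by blast
  next
    case False
    then obtain c where c: "c \<in> periodic f" "c \<notin> ?S" by (meson subsetI)
    obtain m where m: "is_cycle f c m" using periodic_is_cycle[OF c(1)] by blast
    have "3 \<le> m" using long[OF m] .
    have disj: "cycle_set f c m \<inter> ?S = {}" using cycle_disjoint[OF closed c(2) m] .
    have "card (cycle_set f c m \<union> ?S) = m + 4"
      using card_Un_disjoint[OF _ _ disj] card_cycle_set[OF m] cardS by simp
    then have le: "m + 4 \<le> CARD('v)" using card_mono[of UNIV "cycle_set f c m \<union> ?S"] by simp
    have n: "3 \<le> CARD('n)"
    proof (rule ccontr)
      assume "\<not> 3 \<le> CARD('n)"
      then have "(2::nat) ^ CARD('n) \<le> 2 ^ 2" by (intro power_increasing) auto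
      then show False using le card \<open>3 \<le> m\<close> by simp
    qed
    have notS: "(f ^^ h) c \<notin> ?S" if "h < m" for h
      using disj that unfolding cycle_set_def by blast
    consider "CARD('n) = 3" "m = 3" | "CARD('n) = 3" "m = 4" | "4 \<le> CARD('n)"
    proof (cases "CARD('n) = 3")
      case True
      then have "m \<le> 4" using le card by simp
      then show ?thesis using that True \<open>3 \<le> m\<close> by linarith
    next
      case False
      then show ?thesis using that n by linarith
    qed
    then show ?thesis
    proof cases
      case 1
      have fc: "f (f (f c)) = c" using m 1 by (simp add: is_cycle_def numeral_3_eq_3)
      have neq: "c \<noteq> f c" "f c \<noteq> f (f c)" "c \<noteq> f (f c)" using nofix fc by metis+
      have new: "c \<notin> ?S" "f c \<notin> ?S" "f (f c) \<notin> ?S"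
        using notS[of 0] notS[of 1] notS[of 2] 1 by (simp_all add: numeral_2_eq_2)
      let ?T = "{a, b, p, c, f c, f (f c)}"
      have dist: "distinct [a, b, p, c, f c, f (f c)]" using abp neq new by auto
      have closedT: "f ` ?T \<subseteq> ?T" using f fc by auto
      have "periodic f \<subseteq> ?T"
      proof (rule ccontr)
        assume "\<not> periodic f \<subseteq> ?T"
        \<comment> \<open>A further periodic vertex would bring its image along; together with
          \<open>y\<close> this makes nine vertices where there are only eight.\<close>
        then obtain w where w: "w \<in> periodic f - ?T" by blast
        then have "f w \<in> periodic f - ?T" using periodic_complement_closed[OF closedT] by blast
        then have "distinct [a, b, p, c, f c, f (f c), y, w, f w]"
          using dist w y per new(1-3) nofix[of w] yS by auto
        then have "card (set [a, b, p, c, f c, f (f c), y, w, f w]) = 9"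
          by (simp only: distinct_card) simp
        then show False
          using card_mono[of UNIV "set [a, b, p, c, f c, f (f c), y, w, f w]"] card 1 by simp
      qed
      then have into: "\<exists>k. (f ^^ k) x \<in> ?T" for x using eventually_periodic[of f x] by (meson subsetD)
      show ?thesis
        by (rule two_triangles_case[OF card n nofix dist f(1-3) refl refl fc into])
    next
      case 2
      have fc: "f (f (f (f c))) = c" using m 2 by (simp add: is_cycle_def numeral_eq_Suc)
      have inj: "inj_on (\<lambda>h. (f ^^ h) c) {..<4}" using m 2 by (simp add: is_cycle_def)
      have "distinct (map (\<lambda>h. (f ^^ h) c) [0, 1, 2, 3])"
        unfolding distinct_map by (intro conjI inj_on_subset[OF inj]) auto
      then have neq: "distinct [c, f c, f (f c), f (f (f c))]" by (simp add: numeral_eq_Suc)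
      have new: "c \<notin> ?S" "f c \<notin> ?S" "f (f c) \<notin> ?S" "f (f (f c)) \<notin> ?S"
        using notS[of 0] notS[of 1] notS[of 2] notS[of 3] 2 by (simp_all add: numeral_eq_Suc)
      let ?T = "{a, b, p, c, f c, f (f c), f (f (f c))}"
      have dist: "distinct [a, b, p, c, f c, f (f c), f (f (f c))]" using abp neq new by auto
      have yT: "y \<notin> ?T" using yS new by auto
      have "card ?T = 7" using distinct_card[OF dist] by simp
      then have "card (insert y ?T) = CARD('v)" using yT card 2 by (subst card_insert_disjoint) auto
      then have all: "insert y ?T = UNIV" by (metis card_subset_eq finite subset_UNIV)
      have into: "\<exists>k. (f ^^ k) x \<in> ?T" for x
      proof (cases "x = y")
        case True
        then have "(f ^^ 1) x \<in> ?T" using f(4) by simp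
        then show ?thesis by (rule exI)
      next
        case False
        have "x \<in> insert y ?T" unfolding all by simp
        then have "(f ^^ 0) x \<in> ?T" using False by simp
        then show ?thesis by (rule exI)
      qed
      have pre: "f x \<noteq> f (f (f c))" if "x \<notin> ?T" for x
      proof -
        have "x \<in> insert y ?T" unfolding all by simp
        then have "x = y" using that by (metis insertE)
        then show ?thesis using f(4) new(4) by auto
      qed
      show ?thesis
        by (rule triangle_and_square_case[OF card n nofix dist f(1-3) refl refl refl fc into pre])
    next
      case 3
      interpret spread_labelling f ?D0 "{b}"
        by unfold_locales (rule ex_avoiding_four[OF 3 ij])
      have coatom: "3 \<le> card (- {i})" using card_coatom[of i] 3 by linarith
      have small: "card A \<le> 2" if "A \<in> ?D0" for A using that ij by (auto simp: card_insert_if)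
      have U: "UNIV \<notin> ?D0" using small[of UNIV] 3 by linarith
      have "- {i} \<notin> ?D0" using small[of "- {i}"] coatom by linarith
      then have "\<exists>C :: 'n set. C \<notin> ?D0 \<and> Suc (card C) = CARD('n)"
        using card_coatom[of i] by (intro exI conjI)
      moreover have "\<exists>c m. c \<notin> ?S \<and> is_cycle f c m \<and> 3 \<le> m"
        using c(2) m \<open>3 \<le> m\<close> by (intro exI conjI)
      ultimately have H: "?S = UNIV \<or> \<not> - ?S \<subseteq> periodic f \<or> (\<exists>c m. c \<notin> ?S \<and> is_cycle f c m \<and> 3 \<le> m)
        \<and> (\<exists>C :: 'n set. C \<notin> ?D0 \<and> Suc (card C) = CARD('n))"
        by (intro disjI2 conjI)
      obtain \<pi> where "completed \<pi>" "\<forall>x \<in> ?S. \<pi> x = \<pi>0 x"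
        using complete[OF base closed U H] by (elim exE conjE)
      then show ?thesis using finish by blast
    qed
  qed
qed

section \<open>Assembling the cases\<close>

lemma no_fixed_point_case:
  fixes f :: "'v::finite \<Rightarrow> 'v"
  assumes card: "CARD('v) = 2 ^ CARD('n::finite)" and nofix: "\<And>x. f x \<noteq> x"
  shows "\<exists>\<pi> :: 'v \<Rightarrow> 'n set. has_small_attractor f \<pi>"
proof (cases "\<exists>z. f (f z) = z")
  case True
  then show ?thesis using two_cycle_case[OF card nofix] by blast
next
  case False
  then have no2: "f (f x) \<noteq> x" for x by blast
  have long: "3 \<le> m" if "is_cycle f c m" for c m
  proof -
    have "m \<noteq> 1" using that nofix length_one_cycle by metis
    moreover have "m \<noteq> 2" using that no2 length_two_cycle by metis
    ultimately show ?thesis using that by (auto simp: is_cycle_def)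
  qed
  show ?thesis
  proof (cases "periodic f = UNIV")
    case True
    then show ?thesis by (rule long_cycles_permutation_case[OF card _ nofix no2])
  next
    case False
    then obtain y where y: "y \<notin> periodic f" "f y \<in> periodic f" by (rule ex_attached_vertex)
    obtain m where m: "is_cycle f (f y) m" using periodic_is_cycle[OF y(2)] by blast
    show ?thesis
    proof (cases "m = 3")
      case True
      then have m3: "is_cycle f (f y) 3" using m by simp
      show ?thesis by (rule attached_triangle_case[OF card nofix _ y(1) m3]) (rule long)
    next
      case False
      then have m4: "4 \<le> m" using long[OF m] by linarith
      show ?thesis by (rule long_attached_cycle_case[OF card nofix _ y(1) m m4]) (rule long)
    qed
  qed
qed

theorem theorem3:
  fixes f :: "'n::finite config \<Rightarrow> 'n config"
  shows "(fixed_points f \<noteq> {} \<longrightarrow>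
            (\<exists>h :: 'n config \<Rightarrow> 'n config. h \<sim>\<^sub>S f \<and>
               card {X. attractor (async_graph h) X} = fp f)) \<and>
         (fixed_points f = {} \<longrightarrow>
            (\<exists>h :: 'n config \<Rightarrow> 'n config. h \<sim>\<^sub>S f \<and>
               (\<exists>X. {Y. attractor (async_graph h) Y} = {X} \<and> card X \<le> 4)))"
proof (intro conjI impI)
  assume "fixed_points f \<noteq> {}"
  then obtain z where "f z = z" by (auto simp: fixed_points_def)
  then obtain \<pi> :: "'n config \<Rightarrow> 'n set" where "bij \<pi>"
    "\<And>A. \<exists>t \<in> fixed_points f. (A, \<pi> t) \<in> (label_graph f \<pi>)\<^sup>*"
    using fixed_point_case[OF card_config, of f z] by blast
  then show "\<exists>h. h \<sim>\<^sub>S f \<and> card {X. attractor (async_graph h) X} = fp f"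
    by (rule config_of_labelling_fixed_points)
next
  assume "fixed_points f = {}"
  then have "f x \<noteq> x" for x by (auto simp: fixed_points_def)
  then obtain \<pi> :: "'n config \<Rightarrow> 'n set" where "has_small_attractor f \<pi>"
    using no_fixed_point_case[OF card_config, of f] by blast
  then obtain X where "bij \<pi>" "\<And>A. (A, {}) \<in> (label_graph f \<pi>)\<^sup>*"
    "trap_set (label_graph f \<pi>) X" "{} \<in> X" "card X \<le> 4"
    unfolding has_small_attractor_def by blast
  then show "\<exists>h. h \<sim>\<^sub>S f \<and> (\<exists>X. {Y. attractor (async_graph h) Y} = {X} \<and> card X \<le> 4)"
    by (rule config_of_labelling_small_attractor)
qed

end
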